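(* ${\rm LZFC}+VP\vdash Loc^{ext}({\rm ZFC})$.
   Context: All theories are in the language $\{\in\}$. BST is the theory with axioms: Empty set, Extensionality, Pair, Union, Cartesian Product, "$\omega$ exists", $\Delta_0$-Separation. $Loc({\rm ZFC})$ is the statement that every set belongs to a transitive model of ZFC; ${\rm LZFC}={\rm BST}+Loc({\rm ZFC})$. "Model" means a (set) transitive model of ZFC. A model $M$ is extendible if there is a model $N$ such that $M\in N$ and $M\prec N$. $Loc^{ext}({\rm ZFC})$ is the statement that every set belongs to an extendible model. $VP$ (Vopěnka's Principle) is the scheme consisting of the following statement for each formula $\phi(x)$ of the language $\{\in\}$ (set parameters allowed), where $X_\phi=\{x:\phi(x)\}$: if $X_\phi$ is a proper class of structures of some fixed first-order language, then there are distinct $x,y\in X_\phi$ and an elementary embedding $j:x\rightarrow y$ (possibly trivial, i.e. $x\prec y$). *)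

theory Defs
  imports Main
begin

section \<open>First-order logic in the language of set theory\<close>

text \<open>De Bruijn formulas of the language with \<open>\<in>\<close> and \<open>=\<close>. The only terms are variables.\<close>

datatype fm = Bot | Mem nat nat | Eq nat nat | Imp fm fm | Forall fm

primrec rename :: "(nat \<Rightarrow> nat) \<Rightarrow> fm \<Rightarrow> fm" where
  "rename f Bot = Bot"
| "rename f (Mem i j) = Mem (f i) (f j)"
| "rename f (Eq i j) = Eq (f i) (f j)"
| "rename f (Imp p q) = Imp (rename f p) (rename f q)"
| "rename f (Forall p) = Forall (rename (case_nat 0 (\<lambda>i. Suc (f i))) p)"

text \<open>All free variables have index below \<open>n\<close>.\<close>

primrec closed_at :: "nat \<Rightarrow> fm \<Rightarrow> bool" where
  "closed_at n Bot \<longleftrightarrow> True"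
| "closed_at n (Mem i j) \<longleftrightarrow> i < n \<and> j < n"
| "closed_at n (Eq i j) \<longleftrightarrow> i < n \<and> j < n"
| "closed_at n (Imp p q) \<longleftrightarrow> closed_at n p \<and> closed_at n q"
| "closed_at n (Forall p) \<longleftrightarrow> closed_at (Suc n) p"

text \<open>Provability: classical natural deduction with equality. The renaming \<open>case_nat t id\<close>
  is substitution of the variable \<open>t\<close> for the outermost variable \<open>0\<close>.\<close>

inductive proves :: "fm set \<Rightarrow> fm \<Rightarrow> bool" (infix "\<turnstile>" 50) where
  Assumption: "p \<in> \<Gamma> \<Longrightarrow> \<Gamma> \<turnstile> p"
| ImpI: "insert p \<Gamma> \<turnstile> q \<Longrightarrow> \<Gamma> \<turnstile> Imp p q"
| ImpE: "\<Gamma> \<turnstile> Imp p q \<Longrightarrow> \<Gamma> \<turnstile> p \<Longrightarrow> \<Gamma> \<turnstile> q"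
| Contradiction: "insert (Imp p Bot) \<Gamma> \<turnstile> Bot \<Longrightarrow> \<Gamma> \<turnstile> p"
| ForallI: "rename Suc ` \<Gamma> \<turnstile> p \<Longrightarrow> \<Gamma> \<turnstile> Forall p"
| ForallE: "\<Gamma> \<turnstile> Forall p \<Longrightarrow> \<Gamma> \<turnstile> rename (case_nat t id) p"
| EqRefl: "\<Gamma> \<turnstile> Eq t t"
| EqSubst: "\<Gamma> \<turnstile> Eq s t \<Longrightarrow> \<Gamma> \<turnstile> rename (case_nat s id) p \<Longrightarrow> \<Gamma> \<turnstile> rename (case_nat t id) p"

text \<open>The \<open>\<Delta>\<^sub>0\<close> formulas; the quantifier clause is \<open>\<forall>x\<in>v\<^sub>j. p\<close>.\<close>

inductive delta0 :: "fm \<Rightarrow> bool" where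
  "delta0 Bot"
| "delta0 (Mem i j)"
| "delta0 (Eq i j)"
| "delta0 p \<Longrightarrow> delta0 q \<Longrightarrow> delta0 (Imp p q)"
| "delta0 p \<Longrightarrow> delta0 (Forall (Imp (Mem 0 (Suc j)) p))"


section \<open>Writing formulas with named binders\<close>

text \<open>A \<open>frag\<close> maps the number \<open>d\<close> of enclosing quantifiers to a de Bruijn formula. Variables are
  passed around as binding levels: the variable bound by the outermost quantifier is \<open>0\<close>, the next
  one \<open>1\<close>, and so on, so that at depth \<open>d\<close> level \<open>x < d\<close> is the index \<open>d - Suc x\<close>.
  Sentences are obtained by evaluating a \<open>frag\<close> at depth \<open>0\<close>. All functions \<open>nat \<Rightarrow> frag\<close> below
  are formulas with one argument that is such a variable.\<close>

type_synonym frag = "nat \<Rightarrow> fm"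

definition f_bot :: frag ("\<^bold>\<bottom>") where
  "\<^bold>\<bottom> = (\<lambda>d. Bot)"

definition f_mem :: "nat \<Rightarrow> nat \<Rightarrow> frag" (infix "\<^bold>\<in>" 50) where
  "(x \<^bold>\<in> y) = (\<lambda>d. Mem (d - Suc x) (d - Suc y))"

definition f_eq :: "nat \<Rightarrow> nat \<Rightarrow> frag" (infix "\<^bold>=" 50) where
  "(x \<^bold>= y) = (\<lambda>d. Eq (d - Suc x) (d - Suc y))"

definition f_imp :: "frag \<Rightarrow> frag \<Rightarrow> frag" (infixr "\<^bold>\<longrightarrow>" 25) where
  "(P \<^bold>\<longrightarrow> Q) = (\<lambda>d. Imp (P d) (Q d))"

definition f_all :: "(nat \<Rightarrow> frag) \<Rightarrow> frag" (binder "\<^bold>\<forall>" 10) where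
  "f_all F = (\<lambda>d. Forall (F d (Suc d)))"

definition f_not :: "frag \<Rightarrow> frag" ("\<^bold>\<not> _" [40] 40) where
  "(\<^bold>\<not> P) = (P \<^bold>\<longrightarrow> \<^bold>\<bottom>)"

definition f_and :: "frag \<Rightarrow> frag \<Rightarrow> frag" (infixr "\<^bold>\<and>" 35) where
  "(P \<^bold>\<and> Q) = (\<^bold>\<not> (P \<^bold>\<longrightarrow> \<^bold>\<not> Q))"

definition f_or :: "frag \<Rightarrow> frag \<Rightarrow> frag" (infixr "\<^bold>\<or>" 30) where
  "(P \<^bold>\<or> Q) = (\<^bold>\<not> P \<^bold>\<longrightarrow> Q)"

definition f_iff :: "frag \<Rightarrow> frag \<Rightarrow> frag" (infix "\<^bold>\<longleftrightarrow>" 25) where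
  "(P \<^bold>\<longleftrightarrow> Q) = ((P \<^bold>\<longrightarrow> Q) \<^bold>\<and> (Q \<^bold>\<longrightarrow> P))"

definition f_ex :: "(nat \<Rightarrow> frag) \<Rightarrow> frag" (binder "\<^bold>\<exists>" 10) where
  "f_ex F = (\<^bold>\<not> (\<^bold>\<forall>x. \<^bold>\<not> F x))"

text \<open>For a formula \<open>p\<close> with free indices below \<open>Suc n\<close>: index \<open>0\<close> becomes the variable \<open>x\<close>, and
  index \<open>Suc i\<close> the parameter with level \<open>i < n\<close>, bound by the prefix \<open>closure n\<close>.\<close>

definition inst :: "fm \<Rightarrow> nat \<Rightarrow> frag" where
  "inst p x = (\<lambda>d. rename (case_nat (d - Suc x) (\<lambda>i. d - Suc i)) p)"

definition closure :: "nat \<Rightarrow> frag \<Rightarrow> fm" where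
  "closure n P = (Forall ^^ n) (P n)"


section \<open>Basic set-theoretic vocabulary\<close>

text \<open>A predicate whose last argument is the object being described doubles as a \<open>desc\<close>,
  a description of that object. Compound objects are described by composing descriptions.\<close>

type_synonym desc = "nat \<Rightarrow> frag"

definition the_var :: "nat \<Rightarrow> desc" where
  "the_var x v = (v \<^bold>= x)"

definition subset :: "nat \<Rightarrow> nat \<Rightarrow> frag" where
  "subset x y = (\<^bold>\<forall>z. z \<^bold>\<in> x \<^bold>\<longrightarrow> z \<^bold>\<in> y)"

definition transitive :: "nat \<Rightarrow> frag" where
  "transitive x = (\<^bold>\<forall>y. y \<^bold>\<in> x \<^bold>\<longrightarrow> subset y x)"

definition is_empty :: desc where
  "is_empty v = (\<^bold>\<forall>z. \<^bold>\<not> z \<^bold>\<in> v)"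

definition is_upair :: "nat \<Rightarrow> nat \<Rightarrow> desc" where
  "is_upair x y v = (\<^bold>\<forall>z. z \<^bold>\<in> v \<^bold>\<longleftrightarrow> (z \<^bold>= x \<^bold>\<or> z \<^bold>= y))"

definition is_pair :: "nat \<Rightarrow> nat \<Rightarrow> desc" where
  "is_pair x y v = (\<^bold>\<forall>z. z \<^bold>\<in> v \<^bold>\<longleftrightarrow> (is_upair x x z \<^bold>\<or> is_upair x y z))"

definition upair :: "desc \<Rightarrow> desc \<Rightarrow> desc" where
  "upair A B v = (\<^bold>\<exists>x y. A x \<^bold>\<and> B y \<^bold>\<and> is_upair x y v)"

definition pair :: "desc \<Rightarrow> desc \<Rightarrow> desc" where
  "pair A B v = (\<^bold>\<exists>x y. A x \<^bold>\<and> B y \<^bold>\<and> is_pair x y v)"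

definition is_suc :: "nat \<Rightarrow> desc" where
  "is_suc x v = (\<^bold>\<forall>z. z \<^bold>\<in> v \<^bold>\<longleftrightarrow> (z \<^bold>\<in> x \<^bold>\<or> z \<^bold>= x))"

definition suc :: "desc \<Rightarrow> desc" where
  "suc A v = (\<^bold>\<exists>x. A x \<^bold>\<and> is_suc x v)"

primrec num :: "nat \<Rightarrow> desc" where
  "num 0 = is_empty"
| "num (Suc k) = suc (num k)"

definition is_inductive :: "nat \<Rightarrow> frag" where
  "is_inductive w = ((\<^bold>\<exists>e. is_empty e \<^bold>\<and> e \<^bold>\<in> w) \<^bold>\<and>
     (\<^bold>\<forall>x. x \<^bold>\<in> w \<^bold>\<longrightarrow> (\<^bold>\<exists>y. is_suc x y \<^bold>\<and> y \<^bold>\<in> w)))"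

definition is_omega :: desc where
  "is_omega w = (is_inductive w \<^bold>\<and> (\<^bold>\<forall>u. is_inductive u \<^bold>\<longrightarrow> subset w u))"

definition natural :: "nat \<Rightarrow> frag" where
  "natural n = (\<^bold>\<exists>w. is_omega w \<^bold>\<and> n \<^bold>\<in> w)"

definition app :: "nat \<Rightarrow> nat \<Rightarrow> desc" where
  "app f x y = (\<^bold>\<exists>p. is_pair x y p \<^bold>\<and> p \<^bold>\<in> f)"

text \<open>The set \<open>f\<close> is a function whose domain is the class defined by \<open>D\<close>.\<close>

definition function_on :: "(nat \<Rightarrow> frag) \<Rightarrow> nat \<Rightarrow> frag" where
  "function_on D f =
     ((\<^bold>\<forall>p. p \<^bold>\<in> f \<^bold>\<longrightarrow> (\<^bold>\<exists>x y. D x \<^bold>\<and> is_pair x y p)) \<^bold>\<and>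
      (\<^bold>\<forall>x. D x \<^bold>\<longrightarrow> (\<^bold>\<exists>y. \<^bold>\<forall>z. app f x z \<^bold>\<longleftrightarrow> z \<^bold>= y)))"

definition is_function :: "nat \<Rightarrow> nat \<Rightarrow> nat \<Rightarrow> frag" where
  "is_function f a b = (function_on (\<lambda>x. x \<^bold>\<in> a) f \<^bold>\<and> (\<^bold>\<forall>x y. app f x y \<^bold>\<longrightarrow> y \<^bold>\<in> b))"


section \<open>First-order languages, structures and formulas as sets\<close>

text \<open>A language is a pair of functions assigning arities in \<open>\<omega>\<close> to its relation symbols and to its
  function symbols, respectively. Constants are function symbols of arity \<open>0\<close>. The symbols are
  arbitrary sets. A tuple of length \<open>m\<close> is a function with domain \<open>m = {0,\<dots>,m-1}\<close>.\<close>

definition is_language :: "nat \<Rightarrow> frag" where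
  "is_language L = (\<^bold>\<exists>R F w r f. is_omega w \<^bold>\<and> is_function R r w \<^bold>\<and> is_function F f w \<^bold>\<and> is_pair R F L)"

definition rel_symbol :: "nat \<Rightarrow> nat \<Rightarrow> nat \<Rightarrow> frag" where
  "rel_symbol L r m = (\<^bold>\<exists>R F. is_pair R F L \<^bold>\<and> app R r m)"

definition fun_symbol :: "nat \<Rightarrow> nat \<Rightarrow> nat \<Rightarrow> frag" where
  "fun_symbol L f m = (\<^bold>\<exists>R F. is_pair R F L \<^bold>\<and> app F f m)"

text \<open>A structure is \<open>\<langle>A, \<langle>I, J\<rangle>\<rangle>\<close> with domain \<open>A\<close>, relations \<open>I\<close> and functions \<open>J\<close>.\<close>

definition is_triple :: "nat \<Rightarrow> nat \<Rightarrow> nat \<Rightarrow> desc" where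
  "is_triple A I J = pair (the_var A) (pair (the_var I) (the_var J))"

definition struct_dom :: "nat \<Rightarrow> desc" where
  "struct_dom X A = (\<^bold>\<exists>I J. is_triple A I J X)"

definition struct_rel :: "nat \<Rightarrow> nat \<Rightarrow> desc" where
  "struct_rel X r e = (\<^bold>\<exists>A I J. is_triple A I J X \<^bold>\<and> app I r e)"

definition struct_fun :: "nat \<Rightarrow> nat \<Rightarrow> desc" where
  "struct_fun X f h = (\<^bold>\<exists>A I J. is_triple A I J X \<^bold>\<and> app J f h)"

definition is_structure :: "nat \<Rightarrow> nat \<Rightarrow> frag" where
  "is_structure L X = (\<^bold>\<exists>A I J. is_triple A I J X \<^bold>\<and> (\<^bold>\<exists>x. x \<^bold>\<in> A) \<^bold>\<and>
     function_on (\<lambda>r. \<^bold>\<exists>m. rel_symbol L r m) I \<^bold>\<and>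
     (\<^bold>\<forall>r m e. rel_symbol L r m \<^bold>\<and> app I r e \<^bold>\<longrightarrow> (\<^bold>\<forall>s. s \<^bold>\<in> e \<^bold>\<longrightarrow> is_function s m A)) \<^bold>\<and>
     function_on (\<lambda>f. \<^bold>\<exists>m. fun_symbol L f m) J \<^bold>\<and>
     (\<^bold>\<forall>f m h. fun_symbol L f m \<^bold>\<and> app J f h \<^bold>\<longrightarrow>
        function_on (\<lambda>s. is_function s m A) h \<^bold>\<and> (\<^bold>\<forall>s y. app h s y \<^bold>\<longrightarrow> y \<^bold>\<in> A)))"

text \<open>Codes of terms and formulas. Object-level variables are \<open>v\<^sub>k\<close> with \<open>k \<in> \<omega>\<close>.\<close>

definition c_var :: "desc \<Rightarrow> desc" where
  "c_var k = pair (num 0) k"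

definition c_app :: "desc \<Rightarrow> desc \<Rightarrow> desc" where
  "c_app f ts = pair (num 1) (pair f ts)"

definition c_eq :: "desc \<Rightarrow> desc \<Rightarrow> desc" where
  "c_eq t u = pair (num 0) (pair t u)"

definition c_rel :: "desc \<Rightarrow> desc \<Rightarrow> desc" where
  "c_rel r ts = pair (num 1) (pair r ts)"

definition c_bot :: desc where
  "c_bot = pair (num 2) (num 0)"

definition c_imp :: "desc \<Rightarrow> desc \<Rightarrow> desc" where
  "c_imp p q = pair (num 3) (pair p q)"

definition c_all :: "desc \<Rightarrow> desc \<Rightarrow> desc" where
  "c_all k p = pair (num 4) (pair k p)"

text \<open>Some finite sequence ending in \<open>x\<close> has each of its entries obtained by \<open>step P\<close>,
  where \<open>P\<close> holds of the earlier entries.\<close>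

definition generated :: "((nat \<Rightarrow> frag) \<Rightarrow> nat \<Rightarrow> frag) \<Rightarrow> nat \<Rightarrow> frag" where
  "generated step x = (\<^bold>\<exists>m k s. natural m \<^bold>\<and> is_suc m k \<^bold>\<and> function_on (\<lambda>i. i \<^bold>\<in> k) s \<^bold>\<and>
     (\<^bold>\<forall>i y. app s i y \<^bold>\<longrightarrow> step (\<lambda>z. \<^bold>\<exists>j. j \<^bold>\<in> i \<^bold>\<and> app s j z) y) \<^bold>\<and> app s m x)"

text \<open>Terms and formulas of \<open>L\<close> all of whose variables, free or bound, are among
  \<open>v\<^sub>0,\<dots>,v\<^bsub>n-1\<^esub>\<close>, so that assignments for them are functions on \<open>n\<close>.\<close>

definition is_term :: "nat \<Rightarrow> nat \<Rightarrow> nat \<Rightarrow> frag" where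
  "is_term L n = generated (\<lambda>P t.
     (\<^bold>\<exists>k. k \<^bold>\<in> n \<^bold>\<and> c_var (the_var k) t) \<^bold>\<or>
     (\<^bold>\<exists>f m ts. fun_symbol L f m \<^bold>\<and> function_on (\<lambda>i. i \<^bold>\<in> m) ts \<^bold>\<and>
        (\<^bold>\<forall>i u. app ts i u \<^bold>\<longrightarrow> P u) \<^bold>\<and> c_app (the_var f) (the_var ts) t))"

definition is_formula :: "nat \<Rightarrow> nat \<Rightarrow> nat \<Rightarrow> frag" where
  "is_formula L n = generated (\<lambda>P p.
     (\<^bold>\<exists>t u. is_term L n t \<^bold>\<and> is_term L n u \<^bold>\<and> c_eq (the_var t) (the_var u) p) \<^bold>\<or>
     (\<^bold>\<exists>r m ts. rel_symbol L r m \<^bold>\<and> function_on (\<lambda>i. i \<^bold>\<in> m) ts \<^bold>\<and>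
        (\<^bold>\<forall>i u. app ts i u \<^bold>\<longrightarrow> is_term L n u) \<^bold>\<and> c_rel (the_var r) (the_var ts) p) \<^bold>\<or>
     c_bot p \<^bold>\<or>
     (\<^bold>\<exists>q r. P q \<^bold>\<and> P r \<^bold>\<and> c_imp (the_var q) (the_var r) p) \<^bold>\<or>
     (\<^bold>\<exists>k q. k \<^bold>\<in> n \<^bold>\<and> P q \<^bold>\<and> c_all (the_var k) (the_var q) p))"


section \<open>Satisfaction and elementary embeddings\<close>

text \<open>\<open>bs\<close> is the composition \<open>g \<circ> ts\<close>, with \<open>ts\<close> mapped into the domain of \<open>g\<close>.\<close>

definition is_comp :: "nat \<Rightarrow> nat \<Rightarrow> desc" where
  "is_comp g ts bs = (function_on (\<lambda>i. \<^bold>\<exists>u. app ts i u) bs \<^bold>\<and>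
     (\<^bold>\<forall>i u b. app ts i u \<^bold>\<and> app bs i b \<^bold>\<longrightarrow> app g u b))"

text \<open>\<open>g\<close> is a set of pairs (term, value) each justified by the assignment \<open>a\<close> or by further pairs
  in \<open>g\<close>. By induction on terms, \<open>g\<close> is then part of the evaluation function.\<close>

definition partial_eval :: "nat \<Rightarrow> nat \<Rightarrow> nat \<Rightarrow> frag" where
  "partial_eval X a g = (\<^bold>\<forall>t b. app g t b \<^bold>\<longrightarrow>
     (\<^bold>\<exists>k. c_var (the_var k) t \<^bold>\<and> app a k b) \<^bold>\<or>
     (\<^bold>\<exists>f ts h bs. c_app (the_var f) (the_var ts) t \<^bold>\<and> struct_fun X f h \<^bold>\<and>
        is_comp g ts bs \<^bold>\<and> app h bs b))"

definition term_value :: "nat \<Rightarrow> nat \<Rightarrow> nat \<Rightarrow> desc" where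
  "term_value X a t b = (\<^bold>\<exists>g. partial_eval X a g \<^bold>\<and> app g t b)"

definition term_values :: "nat \<Rightarrow> nat \<Rightarrow> nat \<Rightarrow> desc" where
  "term_values X a ts bs = (function_on (\<lambda>i. \<^bold>\<exists>u. app ts i u) bs \<^bold>\<and>
     (\<^bold>\<forall>i u b. app ts i u \<^bold>\<and> app bs i b \<^bold>\<longrightarrow> term_value X a u b))"

text \<open>\<open>S\<close> is a satisfaction relation for \<open>X\<close> on the set \<open>D\<close> of formulas, closed under subformulas,
  with assignments in the \<open>n\<close>-th power of the domain of \<open>X\<close>; \<open>app S p a\<close> reads: \<open>a\<close> satisfies \<open>p\<close>.\<close>

definition sat_relation :: "nat \<Rightarrow> nat \<Rightarrow> nat \<Rightarrow> nat \<Rightarrow> frag" where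
  "sat_relation X n D S = (\<^bold>\<exists>A. struct_dom X A \<^bold>\<and> (\<^bold>\<forall>p a. p \<^bold>\<in> D \<^bold>\<and> is_function a n A \<^bold>\<longrightarrow>
     (\<^bold>\<forall>t u. c_eq (the_var t) (the_var u) p \<^bold>\<longrightarrow>
        (app S p a \<^bold>\<longleftrightarrow> (\<^bold>\<exists>b. term_value X a t b \<^bold>\<and> term_value X a u b))) \<^bold>\<and>
     (\<^bold>\<forall>r ts. c_rel (the_var r) (the_var ts) p \<^bold>\<longrightarrow>
        (app S p a \<^bold>\<longleftrightarrow> (\<^bold>\<exists>e bs. struct_rel X r e \<^bold>\<and> term_values X a ts bs \<^bold>\<and> bs \<^bold>\<in> e))) \<^bold>\<and>
     (c_bot p \<^bold>\<longrightarrow> \<^bold>\<not> app S p a) \<^bold>\<and>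
     (\<^bold>\<forall>q r. c_imp (the_var q) (the_var r) p \<^bold>\<longrightarrow> q \<^bold>\<in> D \<^bold>\<and> r \<^bold>\<in> D \<^bold>\<and>
        (app S p a \<^bold>\<longleftrightarrow> (app S q a \<^bold>\<longrightarrow> app S r a))) \<^bold>\<and>
     (\<^bold>\<forall>k q. c_all (the_var k) (the_var q) p \<^bold>\<longrightarrow> q \<^bold>\<in> D \<^bold>\<and>
        (app S p a \<^bold>\<longleftrightarrow>
          (\<^bold>\<forall>a'. is_function a' n A \<^bold>\<and> (\<^bold>\<forall>i b. \<^bold>\<not> i \<^bold>= k \<^bold>\<longrightarrow> (app a' i b \<^bold>\<longleftrightarrow> app a i b))
             \<^bold>\<longrightarrow> app S q a')))))"

definition sat :: "nat \<Rightarrow> nat \<Rightarrow> nat \<Rightarrow> nat \<Rightarrow> frag" where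
  "sat X n p a = (\<^bold>\<exists>D S. sat_relation X n D S \<^bold>\<and> p \<^bold>\<in> D \<^bold>\<and> app S p a)"

text \<open>\<open>p\<close> holds in the \<open>L\<close>-structure \<open>X\<close> under all assignments.\<close>

definition valid_in :: "nat \<Rightarrow> nat \<Rightarrow> nat \<Rightarrow> frag" where
  "valid_in L X p = (\<^bold>\<forall>n A a. natural n \<^bold>\<and> is_formula L n p \<^bold>\<and> struct_dom X A \<^bold>\<and> is_function a n A
     \<^bold>\<longrightarrow> sat X n p a)"

definition elementary_embedding :: "nat \<Rightarrow> nat \<Rightarrow> nat \<Rightarrow> nat \<Rightarrow> frag" where
  "elementary_embedding L X Y j = (\<^bold>\<exists>A B. struct_dom X A \<^bold>\<and> struct_dom Y B \<^bold>\<and> is_function j A B \<^bold>\<and>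
     (\<^bold>\<forall>n p a b. natural n \<^bold>\<and> is_formula L n p \<^bold>\<and> is_function a n A \<^bold>\<and> is_comp j a b \<^bold>\<longrightarrow>
        (sat X n p a \<^bold>\<longleftrightarrow> sat Y n p b)))"


section \<open>Transitive models of ZFC\<close>

text \<open>The language with the single binary relation symbol \<open>0\<close>, and the structure
  \<open>(M,\<in>)\<close> for it, for nonempty \<open>M\<close>.\<close>

definition eps_language :: desc where
  "eps_language = pair (upair (pair (num 0) (num 2)) (pair (num 0) (num 2))) (num 0)"

definition eps_structure :: "nat \<Rightarrow> desc" where
  "eps_structure M X = ((\<^bold>\<exists>x. x \<^bold>\<in> M) \<^bold>\<and>
     (\<^bold>\<exists>e. (\<^bold>\<forall>s. s \<^bold>\<in> e \<^bold>\<longleftrightarrow>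
           ((\<^bold>\<exists>k. num 2 k \<^bold>\<and> is_function s k M) \<^bold>\<and>
            (\<^bold>\<exists>i j x y. num 0 i \<^bold>\<and> num 1 j \<^bold>\<and> app s i x \<^bold>\<and> app s j y \<^bold>\<and> x \<^bold>\<in> y))) \<^bold>\<and>
        pair (the_var M)
          (pair (upair (pair (num 0) (the_var e)) (pair (num 0) (the_var e))) (num 0)) X))"

text \<open>Codes of formulas of this language; \<open>k\<close> and \<open>l\<close> describe the indices of the variables.\<close>

definition c_veq :: "desc \<Rightarrow> desc \<Rightarrow> desc" where
  "c_veq k l = c_eq (c_var k) (c_var l)"

definition c_vmem :: "desc \<Rightarrow> desc \<Rightarrow> desc" where
  "c_vmem k l = c_rel (num 0) (upair (pair (num 0) (c_var k)) (pair (num 1) (c_var l)))"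

definition c_not :: "desc \<Rightarrow> desc" where
  "c_not p = c_imp p c_bot"

definition c_and :: "desc \<Rightarrow> desc \<Rightarrow> desc" where
  "c_and p q = c_not (c_imp p (c_not q))"

definition c_iff :: "desc \<Rightarrow> desc \<Rightarrow> desc" where
  "c_iff p q = c_and (c_imp p q) (c_imp q p)"

definition c_ex :: "desc \<Rightarrow> desc \<Rightarrow> desc" where
  "c_ex k p = c_not (c_all k (c_not p))"

text \<open>The code of a formula at depth \<open>d\<close>: the variable with level \<open>x\<close> is coded as \<open>v\<^sub>x\<close>.\<close>

primrec quote :: "nat \<Rightarrow> fm \<Rightarrow> desc" where
  "quote d Bot = c_bot"
| "quote d (Mem i j) = c_vmem (num (d - Suc i)) (num (d - Suc j))"
| "quote d (Eq i j) = c_veq (num (d - Suc i)) (num (d - Suc j))"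
| "quote d (Imp p q) = c_imp (quote d p) (quote d q)"
| "quote d (Forall p) = c_all (num d) (quote (Suc d) p)"

definition extensionality :: fm where
  "extensionality = (\<^bold>\<forall>x y. (\<^bold>\<forall>z. z \<^bold>\<in> x \<^bold>\<longleftrightarrow> z \<^bold>\<in> y) \<^bold>\<longrightarrow> x \<^bold>= y) 0"

definition foundation :: fm where
  "foundation = (\<^bold>\<forall>x. (\<^bold>\<exists>y. y \<^bold>\<in> x) \<^bold>\<longrightarrow> (\<^bold>\<exists>y. y \<^bold>\<in> x \<^bold>\<and> (\<^bold>\<forall>z. z \<^bold>\<in> x \<^bold>\<longrightarrow> \<^bold>\<not> z \<^bold>\<in> y))) 0"

definition pairing :: fm where
  "pairing = (\<^bold>\<forall>x y. \<^bold>\<exists>z. is_upair x y z) 0"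

definition union :: fm where
  "union = (\<^bold>\<forall>x. \<^bold>\<exists>y. \<^bold>\<forall>z. z \<^bold>\<in> y \<^bold>\<longleftrightarrow> (\<^bold>\<exists>u. u \<^bold>\<in> x \<^bold>\<and> z \<^bold>\<in> u)) 0"

definition powerset :: fm where
  "powerset = (\<^bold>\<forall>x. \<^bold>\<exists>y. \<^bold>\<forall>z. z \<^bold>\<in> y \<^bold>\<longleftrightarrow> subset z x) 0"

definition infinity :: fm where
  "infinity = (\<^bold>\<exists>w. is_inductive w) 0"

definition choice :: fm where
  "choice = (\<^bold>\<forall>x. (\<^bold>\<forall>y. y \<^bold>\<in> x \<^bold>\<longrightarrow> (\<^bold>\<exists>z. z \<^bold>\<in> y)) \<^bold>\<and>
       (\<^bold>\<forall>y z. y \<^bold>\<in> x \<^bold>\<and> z \<^bold>\<in> x \<^bold>\<and> (\<^bold>\<exists>u. u \<^bold>\<in> y \<^bold>\<and> u \<^bold>\<in> z) \<^bold>\<longrightarrow> y \<^bold>= z) \<^bold>\<longrightarrow>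
     (\<^bold>\<exists>c. \<^bold>\<forall>y. y \<^bold>\<in> x \<^bold>\<longrightarrow> (\<^bold>\<exists>u. \<^bold>\<forall>z. (z \<^bold>\<in> y \<^bold>\<and> z \<^bold>\<in> c) \<^bold>\<longleftrightarrow> z \<^bold>= u))) 0"

text \<open>Instances of the schemata for a formula \<open>p\<close> with variables among \<open>v\<^sub>0,\<dots>,v\<^bsub>n-1\<^esub>\<close>, hence with
  \<open>v\<^sub>n\<close>, \<open>v\<^bsub>n+1\<^esub>\<close>, \<open>v\<^bsub>n+2\<^esub>\<close> fresh. Separation for \<open>p(v\<^sub>0)\<close> is
  \<open>\<forall>v\<^sub>n \<exists>v\<^bsub>n+1\<^esub> \<forall>v\<^sub>0 (v\<^sub>0 \<in> v\<^bsub>n+1\<^esub> \<longleftrightarrow> v\<^sub>0 \<in> v\<^sub>n \<and> p)\<close>. Replacement for \<open>p(v\<^sub>0,v\<^sub>1)\<close> is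
  \<open>\<forall>v\<^sub>n (\<forall>v\<^sub>0\<in>v\<^sub>n \<exists>v\<^bsub>n+2\<^esub> \<forall>v\<^sub>1 (p \<longleftrightarrow> v\<^sub>1 = v\<^bsub>n+2\<^esub>) \<longrightarrow> \<exists>v\<^bsub>n+1\<^esub> \<forall>v\<^sub>1 (v\<^sub>1 \<in> v\<^bsub>n+1\<^esub> \<longleftrightarrow> \<exists>v\<^sub>0\<in>v\<^sub>n p))\<close>.
  The remaining variables of \<open>p\<close> are parameters.\<close>

definition c_separation :: "desc \<Rightarrow> desc \<Rightarrow> desc" where
  "c_separation n p = c_all n (c_ex (suc n) (c_all (num 0)
     (c_iff (c_vmem (num 0) (suc n)) (c_and (c_vmem (num 0) n) p))))"

definition c_replacement :: "desc \<Rightarrow> desc \<Rightarrow> desc" where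
  "c_replacement n p = c_all n (c_imp
     (c_all (num 0) (c_imp (c_vmem (num 0) n)
        (c_ex (suc (suc n)) (c_all (num 1) (c_iff p (c_veq (num 1) (suc (suc n))))))))
     (c_ex (suc n) (c_all (num 1) (c_iff (c_vmem (num 1) (suc n))
        (c_ex (num 0) (c_and (c_vmem (num 0) n) p))))))"

text \<open>In the schemata \<open>1 \<in> n\<close> is required so that \<open>v\<^sub>n\<close> differs from \<open>v\<^sub>0\<close> and \<open>v\<^sub>1\<close>. Every formula
  has its variables among \<open>v\<^sub>0,\<dots>,v\<^bsub>n-1\<^esub>\<close> for such an \<open>n\<close>.\<close>

definition zfc_axiom :: desc where
  "zfc_axiom c =
     (quote 0 extensionality c \<^bold>\<or> quote 0 foundation c \<^bold>\<or> quote 0 pairing c \<^bold>\<or>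
      quote 0 union c \<^bold>\<or> quote 0 powerset c \<^bold>\<or> quote 0 infinity c \<^bold>\<or> quote 0 choice c \<^bold>\<or>
      (\<^bold>\<exists>L n u p. eps_language L \<^bold>\<and> natural n \<^bold>\<and> num 1 u \<^bold>\<and> u \<^bold>\<in> n \<^bold>\<and> is_formula L n p \<^bold>\<and>
         (c_separation (the_var n) (the_var p) c \<^bold>\<or> c_replacement (the_var n) (the_var p) c)))"

definition model :: "nat \<Rightarrow> frag" where
  "model M = (transitive M \<^bold>\<and> (\<^bold>\<exists>L X. eps_language L \<^bold>\<and> eps_structure M X \<^bold>\<and>
     (\<^bold>\<forall>c. zfc_axiom c \<^bold>\<longrightarrow> valid_in L X c)))"

text \<open>\<open>M \<prec> N\<close>: the identity on \<open>M\<close> is an elementary embedding of \<open>(M,\<in>)\<close> into \<open>(N,\<in>)\<close>.\<close>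

definition elementary_submodel :: "nat \<Rightarrow> nat \<Rightarrow> frag" where
  "elementary_submodel M N = (\<^bold>\<exists>L X Y j. eps_language L \<^bold>\<and> eps_structure M X \<^bold>\<and>
     eps_structure N Y \<^bold>\<and> (\<^bold>\<forall>x y. app j x y \<^bold>\<longleftrightarrow> (x \<^bold>\<in> M \<^bold>\<and> x \<^bold>= y)) \<^bold>\<and>
     elementary_embedding L X Y j)"

definition extendible :: "nat \<Rightarrow> frag" where
  "extendible M = (model M \<^bold>\<and> (\<^bold>\<exists>N. model N \<^bold>\<and> M \<^bold>\<in> N \<^bold>\<and> elementary_submodel M N))"


section \<open>The theories\<close>

definition empty_set :: fm where
  "empty_set = (\<^bold>\<exists>x. is_empty x) 0"

definition cartesian_product :: fm where
  "cartesian_product = (\<^bold>\<forall>a b. \<^bold>\<exists>c. \<^bold>\<forall>z. z \<^bold>\<in> c \<^bold>\<longleftrightarrow>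
     (\<^bold>\<exists>x y. x \<^bold>\<in> a \<^bold>\<and> y \<^bold>\<in> b \<^bold>\<and> is_pair x y z)) 0"

definition omega_exists :: fm where
  "omega_exists = (\<^bold>\<exists>w. is_omega w) 0"

definition separation :: "nat \<Rightarrow> fm \<Rightarrow> fm" where
  "separation n p = closure n (\<^bold>\<forall>a. \<^bold>\<exists>b. \<^bold>\<forall>x. x \<^bold>\<in> b \<^bold>\<longleftrightarrow> (x \<^bold>\<in> a \<^bold>\<and> inst p x))"

definition BST :: "fm set" where
  "BST = {empty_set, extensionality, pairing, union, cartesian_product, omega_exists} \<union>
     {separation n p | n p. delta0 p \<and> closed_at (Suc n) p}"

definition Loc_ZFC :: fm where
  "Loc_ZFC = (\<^bold>\<forall>x. \<^bold>\<exists>M. model M \<^bold>\<and> x \<^bold>\<in> M) 0"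

definition LZFC :: "fm set" where
  "LZFC = BST \<union> {Loc_ZFC}"

definition Loc_ext_ZFC :: fm where
  "Loc_ext_ZFC = (\<^bold>\<forall>x. \<^bold>\<exists>M. extendible M \<^bold>\<and> x \<^bold>\<in> M) 0"

text \<open>A proper class is a class that is not the extension of a set.\<close>

definition vopenka :: "nat \<Rightarrow> fm \<Rightarrow> fm" where
  "vopenka n p = closure n (\<^bold>\<forall>L.
     is_language L \<^bold>\<and> (\<^bold>\<forall>x. inst p x \<^bold>\<longrightarrow> is_structure L x) \<^bold>\<and>
     \<^bold>\<not> (\<^bold>\<exists>s. \<^bold>\<forall>x. x \<^bold>\<in> s \<^bold>\<longleftrightarrow> inst p x) \<^bold>\<longrightarrow>
     (\<^bold>\<exists>x y j. inst p x \<^bold>\<and> inst p y \<^bold>\<and> \<^bold>\<not> x \<^bold>= y \<^bold>\<and> elementary_embedding L x y j))"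

definition VP :: "fm set" where
  "VP = {vopenka n p | n p. closed_at (Suc n) p}"

end

theory Submission
  imports Defs "HOL-Library.Countable"
begin

text \<open>By completeness of the calculus it suffices to work in an arbitrary structure that satisfies
  LZFC and VP.

  Vopenka's Principle gives full separation and powerset: a definable family of subsets \<open>z\<close> of a set
  \<open>a\<close> is coded by one-point structures in which the symbol \<open>r \<in> a\<close> is interpreted by whether \<open>r \<in> z\<close>,
  and distinct such structures do not embed into each other. Foundation and choice are inherited from
  the models of ZFC.

  Given \<open>x\<close>, let \<open>b\<close> be a transitive model with \<open>x \<in> b\<close> and consider the cumulative hierarchy over \<open>b\<close>.
  Its levels form a proper class, so there is an embedding \<open>j\<close> between structures on two distinct
  levels that preserves the satisfaction relation of the levels and fixes the elements of \<open>b\<close>. If \<open>K\<close> is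
  the least level that \<open>j\<close> moves, then \<open>j\<close> is the identity on \<open>K\<close>, so \<open>K \<prec> j(K)\<close> and \<open>K \<in> j(K)\<close>. The
  latter implies replacement in \<open>K\<close>, hence \<open>K\<close> is a model of ZFC, and so is \<open>j(K)\<close>.\<close>

section \<open>Completeness of the proof system\<close>

text \<open>BST separates by Delta_0 formulas only and has neither powerset nor replacement, so at
  the outset not even satisfaction relations of set structures are known to exist, and recursion
  along ordinals is not at hand. This shapes the proof. The first use of Vopenka's Principle
  evaluates atomic formulas, whose satisfaction relation is a mere product, and reads the principle
  contrapositively: a definable class of structures without embeddings between distinct members is a
  set. Satisfaction is built afterwards, and being a level is given by a formula instead of a
  recursion. The levels need not exhaust the universe; by a Burali-Forti argument they do not form a
  set.

  The base \<open>b\<close> puts \<open>x\<close> and \<omega> into every level, and its elements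
  get names in the language, so that they are fixed. The second use again evaluates atomic formulas:
  satisfaction, levelhood and being a model are relations of the structures, with formula and
  assignment packed into one argument. These finite objects must therefore lie in \<open>K\<close>,
  which is one reason to show that \<open>K\<close> is a limit.\<close>

primrec fv :: "fm \<Rightarrow> nat set" where
  "fv Bot = {}"
| "fv (Mem i j) = {i, j}"
| "fv (Eq i j) = {i, j}"
| "fv (Imp p q) = fv p \<union> fv q"
| "fv (Forall p) = {i. Suc i \<in> fv p}"

lemma finite_fv: "finite (fv p)"
proof (induction p)
  case (Forall p)
  have "fv (Forall p) = Suc -` fv p" by auto
  then show ?case using finite_vimageI[OF Forall, of Suc] by simp
qed auto

lemma rename_cong: "(\<And>i. i \<in> fv p \<Longrightarrow> f i = g i) \<Longrightarrow> rename f p = rename g p"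
proof (induction p arbitrary: f g)
  case (Forall p)
  have "rename (case_nat 0 (\<lambda>i. Suc (f i))) p = rename (case_nat 0 (\<lambda>i. Suc (g i))) p"
    using Forall.prems by (intro Forall.IH) (auto split: nat.split)
  then show ?case by simp
next
  case (Imp p q)
  then show ?case by (metis UnCI fv.simps(4) rename.simps(4))
qed auto

lemma rename_rename: "rename f (rename g p) = rename (\<lambda>i. f (g i)) p"
proof (induction p arbitrary: f g)
  case (Forall p)
  have "(\<lambda>i. case_nat 0 (\<lambda>i. Suc (f i)) (case_nat 0 (\<lambda>i. Suc (g i)) i)) =
      case_nat 0 (\<lambda>i. Suc (f (g i)))"
    by (auto split: nat.split)
  then show ?case using Forall by simp
qed auto

lemma rename_id: "rename (\<lambda>i. i) p = p"
proof (induction p)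
  case (Forall p)
  have "case_nat 0 Suc = (\<lambda>i. i)" by (auto split: nat.split)
  then show ?case using Forall by simp
qed auto

lemma proves_weaken: "\<Gamma> \<turnstile> p \<Longrightarrow> \<Gamma> \<subseteq> \<Delta> \<Longrightarrow> \<Delta> \<turnstile> p"
proof (induction arbitrary: \<Delta> rule: proves.induct)
  case (ImpI p \<Gamma> q)
  from ImpI.IH[OF insert_mono[OF ImpI.prems]] show ?case by (rule proves.ImpI)
next
  case (Contradiction p \<Gamma>)
  from Contradiction.IH[OF insert_mono[OF Contradiction.prems]] show ?case by (rule proves.Contradiction)
next
  case (ForallI \<Gamma> p)
  from ForallI.IH[OF image_mono[OF ForallI.prems]] show ?case by (rule proves.ForallI)
next
  case (EqSubst \<Gamma> s t p)
  then show ?case by (intro proves.EqSubst[of _ s t p])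
next
  case (ImpE \<Gamma> p q)
  then show ?case by (intro proves.ImpE[of _ p q])
next
  case (ForallE \<Gamma> p t)
  then show ?case by (intro proves.ForallE)
qed (auto intro: proves.Assumption proves.EqRefl)

text \<open>The rules are uniform in the variables, so a whole derivation can be renamed, even by a
  map that is not injective. This turns a fresh variable into index 0 and later undoes the doubling
  of all indices.\<close>

lemma proves_rename: "\<Gamma> \<turnstile> p \<Longrightarrow> rename f ` \<Gamma> \<turnstile> rename f p"
proof (induction arbitrary: f rule: proves.induct)
  case (ForallI \<Gamma> p)
  have "rename (case_nat 0 (\<lambda>i. Suc (f i))) ` rename Suc ` \<Gamma> = rename Suc ` rename f ` \<Gamma>"
    by (simp add: image_image rename_rename)
  then have "rename Suc ` rename f ` \<Gamma> \<turnstile> rename (case_nat 0 (\<lambda>i. Suc (f i))) p"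
    using ForallI.IH[of "case_nat 0 (\<lambda>i. Suc (f i))"] by metis
  then have "rename f ` \<Gamma> \<turnstile> Forall (rename (case_nat 0 (\<lambda>i. Suc (f i))) p)"
    by (rule proves.ForallI)
  then show ?case by simp
next
  case (ForallE \<Gamma> p t)
  have "rename f ` \<Gamma> \<turnstile> rename (case_nat (f t) id) (rename (case_nat 0 (\<lambda>i. Suc (f i))) p)"
    using ForallE.IH[of f] by (simp only: rename.simps) (rule proves.ForallE)
  moreover have "(\<lambda>i. case_nat (f t) id (case_nat 0 (\<lambda>i. Suc (f i)) i)) =
      (\<lambda>i. f (case_nat t id i))"
    by (auto split: nat.split)
  ultimately show ?case by (simp add: rename_rename)
next
  case (EqSubst \<Gamma> s t p)
  have eq: "rename f (rename (case_nat x id) p) =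
      rename (case_nat (f x) id) (rename (case_nat 0 (\<lambda>i. Suc (f i))) p)" for x
  proof -
    have "(\<lambda>i. case_nat (f x) id (case_nat 0 (\<lambda>i. Suc (f i)) i)) = (\<lambda>i. f (case_nat x id i))"
      by (auto split: nat.split)
    then show ?thesis by (simp add: rename_rename)
  qed
  then show ?case
    using proves.EqSubst[OF EqSubst.IH(1)[of f, unfolded rename.simps] EqSubst.IH(2)[of f, unfolded eq]]
    by (simp only: eq)
next
  case (ImpI p \<Gamma> q)
  from ImpI.IH[of f] show ?case by (simp only: image_insert rename.simps) (rule proves.ImpI)
next
  case (ImpE \<Gamma> p q)
  show ?case by (rule proves.ImpE[OF ImpE.IH(1)[of f, unfolded rename.simps] ImpE.IH(2)])
next
  case (Contradiction p \<Gamma>)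
  from Contradiction.IH[of f] show ?case
    by (simp only: image_insert rename.simps) (rule proves.Contradiction)
qed (auto intro: proves.Assumption proves.EqRefl)

text \<open>Every rule has finitely many premises. This is the compactness needed at the union of
  the Henkin stages.\<close>

lemma proves_finite: "\<Gamma> \<turnstile> p \<Longrightarrow> \<exists>\<Delta>\<subseteq>\<Gamma>. finite \<Delta> \<and> \<Delta> \<turnstile> p"
proof (induction rule: proves.induct)
  case (Assumption p \<Gamma>)
  then show ?case by (intro exI[of _ "{p}"]) (auto intro: proves.Assumption)
next
  case (ImpI p \<Gamma> q)
  then obtain \<Delta> where \<Delta>: "\<Delta> \<subseteq> insert p \<Gamma>" "finite \<Delta>" "\<Delta> \<turnstile> q" by auto
  have "insert p (\<Delta> - {p}) \<turnstile> q" by (rule proves_weaken[OF \<Delta>(3)]) auto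
  then have "\<Delta> - {p} \<turnstile> Imp p q" by (rule proves.ImpI)
  with \<Delta> show ?case by (intro exI[of _ "\<Delta> - {p}"]) auto
next
  case (ImpE \<Gamma> p q)
  then obtain \<Delta> \<Delta>' where \<Delta>: "\<Delta> \<subseteq> \<Gamma>" "finite \<Delta>" "\<Delta> \<turnstile> Imp p q" "\<Delta>' \<subseteq> \<Gamma>" "finite \<Delta>'" "\<Delta>' \<turnstile> p"
    by auto
  have "\<Delta> \<union> \<Delta>' \<turnstile> Imp p q" "\<Delta> \<union> \<Delta>' \<turnstile> p"
    by (rule proves_weaken[OF \<Delta>(3)], simp) (rule proves_weaken[OF \<Delta>(6)], simp)
  then have "\<Delta> \<union> \<Delta>' \<turnstile> q" by (rule proves.ImpE)
  with \<Delta> show ?case by (intro exI[of _ "\<Delta> \<union> \<Delta>'"]) auto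
next
  case (Contradiction p \<Gamma>)
  then obtain \<Delta> where \<Delta>: "\<Delta> \<subseteq> insert (Imp p Bot) \<Gamma>" "finite \<Delta>" "\<Delta> \<turnstile> Bot" by auto
  have "insert (Imp p Bot) (\<Delta> - {Imp p Bot}) \<turnstile> Bot" by (rule proves_weaken[OF \<Delta>(3)]) auto
  then have "\<Delta> - {Imp p Bot} \<turnstile> p" by (rule proves.Contradiction)
  with \<Delta> show ?case by (intro exI[of _ "\<Delta> - {Imp p Bot}"]) auto
next
  case (ForallI \<Gamma> p)
  then obtain \<Delta> where \<Delta>: "\<Delta> \<subseteq> rename Suc ` \<Gamma>" "finite \<Delta>" "\<Delta> \<turnstile> p" by auto
  from finite_subset_image[OF \<Delta>(2,1)] obtain \<Delta>' where "\<Delta>' \<subseteq> \<Gamma>" "finite \<Delta>'" "\<Delta> = rename Suc ` \<Delta>'"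
    by auto
  then show ?case using \<Delta>(3) proves.ForallI[of \<Delta>' p] by auto
next
  case (ForallE \<Gamma> p t)
  then obtain \<Delta> where "\<Delta> \<subseteq> \<Gamma>" "finite \<Delta>" "\<Delta> \<turnstile> Forall p" by auto
  then show ?case using proves.ForallE[of \<Delta> p t] by auto
next
  case (EqRefl \<Gamma> t)
  show ?case by (intro exI[of _ "{}"]) (simp add: proves.EqRefl)
next
  case (EqSubst \<Gamma> s t p)
  then obtain \<Delta> \<Delta>' where \<Delta>: "\<Delta> \<subseteq> \<Gamma>" "finite \<Delta>" "\<Delta> \<turnstile> Eq s t"
    "\<Delta>' \<subseteq> \<Gamma>" "finite \<Delta>'" "\<Delta>' \<turnstile> rename (case_nat s id) p"
    by auto
  have "\<Delta> \<union> \<Delta>' \<turnstile> Eq s t" "\<Delta> \<union> \<Delta>' \<turnstile> rename (case_nat s id) p"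
    by (rule proves_weaken[OF \<Delta>(3)], simp) (rule proves_weaken[OF \<Delta>(6)], simp)
  then have "\<Delta> \<union> \<Delta>' \<turnstile> rename (case_nat t id) p" by (rule proves.EqSubst)
  with \<Delta> show ?case by (intro exI[of _ "\<Delta> \<union> \<Delta>'"]) auto
qed

text \<open>In place of an eigenvariable condition, \<open>ForallI\<close> shifts the assumptions
  away from index 0. The renaming \<open>?f\<close> sends the fresh \<open>v\<close> to 0 and shifts
  all other indices, so it acts as the shift on the assumptions and undoes the substitution in
  \<open>p\<close>.\<close>

lemma proves_Forall_fresh:
  assumes "\<Gamma> \<turnstile> rename (case_nat v id) p" and "\<And>q. q \<in> \<Gamma> \<Longrightarrow> v \<notin> fv q" and "v \<notin> fv (Forall p)"
  shows "\<Gamma> \<turnstile> Forall p"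
proof -
  let ?f = "\<lambda>i. if i = v then 0 else Suc i"
  have "rename ?f q = rename Suc q" if "q \<in> \<Gamma>" for q
    using assms(2)[OF that] by (intro rename_cong) auto
  then have "rename ?f ` \<Gamma> = rename Suc ` \<Gamma>" by auto
  moreover have "rename ?f (rename (case_nat v id) p) = rename (\<lambda>i. i) p"
    unfolding rename_rename using assms(3) by (intro rename_cong) (auto split: nat.split)
  ultimately show ?thesis
    using proves_rename[OF assms(1), of ?f] by (metis proves.ForallI rename_id)
qed

instance fm :: countable
  by countable_datatype

section \<open>Saturated sets by the Henkin construction\<close>

definition consistent :: "fm set \<Rightarrow> bool" where
  "consistent \<Gamma> \<longleftrightarrow> \<not> \<Gamma> \<turnstile> Bot"

definition fresh_for :: "fm set \<Rightarrow> nat set" where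
  "fresh_for \<Gamma> = {v. \<forall>p\<in>\<Gamma>. v \<notin> fv p}"

definition saturated :: "fm set \<Rightarrow> bool" where
  "saturated H \<longleftrightarrow> consistent H \<and> (\<forall>p. p \<in> H \<or> Imp p Bot \<in> H) \<and>
     (\<forall>p. Imp (Forall p) Bot \<in> H \<longrightarrow> (\<exists>v. Imp (rename (case_nat v id) p) Bot \<in> H))"

text \<open>A set of at most one formula, so that formulas of other shapes contribute nothing. The
  stages apply it to a set that already contains \<open>p\<close>, hence the chosen variable is
  fresh for \<open>p\<close> too.\<close>

definition witness :: "fm set \<Rightarrow> fm \<Rightarrow> fm set" where
  "witness \<Gamma> p = {Imp (rename (case_nat (SOME v. v \<in> fresh_for \<Gamma>) id) q) Bot | q. p = Imp (Forall q) Bot}"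

primrec henkin_stage :: "fm set \<Rightarrow> nat \<Rightarrow> fm set" where
  "henkin_stage \<Gamma> 0 = \<Gamma>"
| "henkin_stage \<Gamma> (Suc k) = (let \<Delta> = insert (from_nat k) (henkin_stage \<Gamma> k) in
     if consistent \<Delta> then \<Delta> \<union> witness \<Delta> (from_nat k) else henkin_stage \<Gamma> k)"

lemma witness_cases:
  obtains "witness \<Gamma> p = {}"
  | q v where "p = Imp (Forall q) Bot" "v = (SOME v. v \<in> fresh_for \<Gamma>)"
      "witness \<Gamma> p = {Imp (rename (case_nat v id) q) Bot}"
  unfolding witness_def by (cases "\<exists>q. p = Imp (Forall q) Bot") auto

text \<open>A formula has finitely many free variables, so each stage uses up finitely many of them.
  Variables thus suffice as Henkin witnesses, without new constants.\<close>

lemma infinite_fresh_insert: "infinite (fresh_for \<Gamma>) \<Longrightarrow> infinite (fresh_for (insert p \<Gamma>))"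
proof -
  assume "infinite (fresh_for \<Gamma>)"
  moreover have "fresh_for (insert p \<Gamma>) = fresh_for \<Gamma> - fv p" unfolding fresh_for_def by auto
  ultimately show ?thesis using finite_fv by auto
qed

lemma infinite_fresh_witness: "infinite (fresh_for \<Gamma>) \<Longrightarrow> infinite (fresh_for (\<Gamma> \<union> witness \<Gamma> p))"
  by (cases rule: witness_cases[of \<Gamma> p]) (simp_all add: infinite_fresh_insert)

text \<open>If the negated instance led to a contradiction, the instance at the fresh
  \<open>v\<close> would be derivable, hence \<open>Forall q\<close>, whose negation is
  \<open>p\<close>.\<close>

lemma consistent_witness:
  assumes inf: "infinite (fresh_for \<Gamma>)" and p: "p \<in> \<Gamma>" and con: "consistent \<Gamma>"
  shows "consistent (\<Gamma> \<union> witness \<Gamma> p)"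
proof (cases rule: witness_cases[of \<Gamma> p])
  case 1
  then show ?thesis using con by simp
next
  case (2 q v)
  have v: "v \<in> fresh_for \<Gamma>" using inf 2(2) by (metis finite.emptyI ex_in_conv someI_ex)
  have "\<not> insert (Imp (rename (case_nat v id) q) Bot) \<Gamma> \<turnstile> Bot"
  proof
    assume "insert (Imp (rename (case_nat v id) q) Bot) \<Gamma> \<turnstile> Bot"
    then have "\<Gamma> \<turnstile> rename (case_nat v id) q" by (rule proves.Contradiction)
    moreover have "v \<notin> fv (Forall q)" using v p 2(1) unfolding fresh_for_def by force
    ultimately have "\<Gamma> \<turnstile> Forall q" using v by (auto intro!: proves_Forall_fresh[of _ v] simp: fresh_for_def)
    moreover have "\<Gamma> \<turnstile> Imp (Forall q) Bot" using p 2(1) by (simp add: proves.Assumption)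
    ultimately have "\<Gamma> \<turnstile> Bot" using proves.ImpE by blast
    then show False using con by (simp add: consistent_def)
  qed
  then show ?thesis using 2 by (simp add: consistent_def)
qed

lemma henkin_stage_inv:
  assumes "infinite (fresh_for \<Gamma>)" "consistent \<Gamma>"
  shows "infinite (fresh_for (henkin_stage \<Gamma> k)) \<and> consistent (henkin_stage \<Gamma> k)"
proof (induction k)
  case (Suc k)
  let ?\<Delta> = "insert (from_nat k) (henkin_stage \<Gamma> k)"
  have "infinite (fresh_for ?\<Delta>)" using Suc infinite_fresh_insert by blast
  then have "infinite (fresh_for (?\<Delta> \<union> witness ?\<Delta> (from_nat k)))"
    "consistent ?\<Delta> \<Longrightarrow> consistent (?\<Delta> \<union> witness ?\<Delta> (from_nat k))"
    using infinite_fresh_witness consistent_witness by blast+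
  then show ?case using Suc by (simp only: henkin_stage.simps Let_def split: if_split) simp
qed (use assms in auto)

lemma henkin_stage_mono: "k \<le> l \<Longrightarrow> henkin_stage \<Gamma> k \<subseteq> henkin_stage \<Gamma> l"
  by (rule lift_Suc_mono_le[of "henkin_stage \<Gamma>"]) (auto simp: Let_def)

lemma saturated_extension:
  assumes "infinite (fresh_for \<Gamma>)" "consistent \<Gamma>"
  obtains H where "saturated H" "\<Gamma> \<subseteq> H"
proof -
  define H where "H = (\<Union>k. henkin_stage \<Gamma> k)"
  have con: "consistent H"
    unfolding consistent_def
  proof
    assume "H \<turnstile> Bot"
    then obtain \<Delta> where \<Delta>: "\<Delta> \<subseteq> H" "finite \<Delta>" "\<Delta> \<turnstile> Bot" using proves_finite by blast
    have "\<exists>k. \<Delta> \<subseteq> henkin_stage \<Gamma> k" using \<Delta>(2,1)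
    proof (induction rule: finite_induct)
      case (insert p \<Delta>)
      then obtain k l where "\<Delta> \<subseteq> henkin_stage \<Gamma> k" "p \<in> henkin_stage \<Gamma> l" unfolding H_def by auto
      then have "insert p \<Delta> \<subseteq> henkin_stage \<Gamma> (max k l)"
        using henkin_stage_mono[of k "max k l" \<Gamma>] henkin_stage_mono[of l "max k l" \<Gamma>] by auto
      then show ?case ..
    qed auto
    then show False
      using \<Delta>(3) henkin_stage_inv[OF assms] proves_weaken[of \<Delta> Bot] by (auto simp: consistent_def)
  qed
  have stage: "henkin_stage \<Gamma> k \<subseteq> H" for k unfolding H_def by auto
  have max: "p \<in> H \<or> Imp p Bot \<in> H" for p
  proof (rule ccontr)
    assume *: "\<not> (p \<in> H \<or> Imp p Bot \<in> H)"
    \<comment> \<open>Every formula is considered at the stage given by its number. If it is not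
      accepted there, it is inconsistent with that stage and therefore refuted by \<open>H\<close>.
      This is applied to \<open>p\<close> and to its negation.\<close>
    have "H \<turnstile> Imp q Bot" if "q \<notin> H" for q
    proof -
      obtain k where k: "q = from_nat k" by (metis from_nat_to_nat)
      have "\<not> consistent (insert q (henkin_stage \<Gamma> k))"
        using that stage[of "Suc k"] k by (auto simp: Let_def split: if_splits)
      then have "insert q H \<turnstile> Bot"
        using proves_weaken[OF _ insert_mono[OF stage]] by (simp add: consistent_def)
      then show ?thesis by (rule proves.ImpI)
    qed
    then have "H \<turnstile> Imp p Bot" "H \<turnstile> Imp (Imp p Bot) Bot" using * by auto
    then have "H \<turnstile> Bot" using proves.ImpE by blast
    then show False using con by (simp add: consistent_def)
  qed
  have "\<exists>v. Imp (rename (case_nat v id) p) Bot \<in> H" if "Imp (Forall p) Bot \<in> H" for p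
  proof -
    obtain k where k: "Imp (Forall p) Bot = from_nat k" by (metis from_nat_to_nat)
    let ?\<Delta> = "insert (from_nat k) (henkin_stage \<Gamma> k)"
    have "?\<Delta> \<subseteq> H" using that stage[of k] k by auto
    then have "consistent ?\<Delta>" using con proves_weaken[of ?\<Delta> Bot H] by (auto simp: consistent_def)
    then have "witness ?\<Delta> (from_nat k) \<subseteq> H" using stage[of "Suc k"] by (auto simp: Let_def)
    then show ?thesis unfolding witness_def k[symmetric] by auto
  qed
  then have "saturated H" using con max unfolding saturated_def by blast
  moreover have "\<Gamma> \<subseteq> H" using stage[of 0] by simp
  ultimately show ?thesis by (rule that)
qed

lemma saturated_closed:
  assumes "saturated H" "H \<turnstile> p"
  shows "p \<in> H"
proof (rule ccontr)
  assume "p \<notin> H"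
  then have "H \<turnstile> Imp p Bot"
    using assms(1) by (intro proves.Assumption) (auto simp: saturated_def)
  then have "H \<turnstile> Bot" using assms(2) by (rule proves.ImpE)
  then show False using assms(1) by (simp add: saturated_def consistent_def)
qed

lemma saturated_Imp: "saturated H \<Longrightarrow> Imp p q \<in> H \<longleftrightarrow> (p \<in> H \<longrightarrow> q \<in> H)"
proof
  assume H: "saturated H" and "p \<in> H \<longrightarrow> q \<in> H"
  then consider "q \<in> H" | "Imp p Bot \<in> H" unfolding saturated_def by blast
  then have "insert p H \<turnstile> q"
  proof cases
    case 2
    then have "insert (Imp q Bot) (insert p H) \<turnstile> Bot"
      by (intro proves.ImpE[of _ p Bot] proves.Assumption) auto
    then show ?thesis by (rule proves.Contradiction)
  qed (auto intro: proves.Assumption)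
  then show "Imp p q \<in> H" by (rule saturated_closed[OF H proves.ImpI])
next
  assume H: "saturated H" and "Imp p q \<in> H"
  then have "H \<turnstile> q" if "p \<in> H"
    using that by (intro proves.ImpE[of H p q] proves.Assumption)
  then show "p \<in> H \<longrightarrow> q \<in> H" using saturated_closed[OF H] by blast
qed

lemma saturated_Forall:
  assumes H: "saturated H"
  shows "Forall p \<in> H \<longleftrightarrow> (\<forall>t. rename (case_nat t id) p \<in> H)"
proof
  assume "Forall p \<in> H"
  then have "H \<turnstile> rename (case_nat t id) p" for t
    by (rule proves.ForallE[OF proves.Assumption])
  then show "\<forall>t. rename (case_nat t id) p \<in> H" using saturated_closed[OF H] by blast
next
  assume *: "\<forall>t. rename (case_nat t id) p \<in> H"
  show "Forall p \<in> H"
  proof (rule ccontr)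
    assume "Forall p \<notin> H"
    then obtain v where "Imp (rename (case_nat v id) p) Bot \<in> H"
      using H unfolding saturated_def by blast
    then have "Bot \<in> H" using * saturated_Imp[OF H] by blast
    then show False using H by (simp add: saturated_def consistent_def proves.Assumption)
  qed
qed

lemma saturated_Eq_refl: "saturated H \<Longrightarrow> Eq i i \<in> H"
  by (rule saturated_closed) (auto intro: proves.EqRefl)

lemma saturated_Eq_subst:
  "saturated H \<Longrightarrow> Eq s t \<in> H \<Longrightarrow> rename (case_nat s id) p \<in> H \<Longrightarrow> rename (case_nat t id) p \<in> H"
  by (erule saturated_closed, rule proves.EqSubst[of _ s]; rule proves.Assumption)

text \<open>Substitution lowers the index \<open>Suc i\<close> to \<open>i\<close>. Hence inserting
  \<open>i\<close> for 0 in \<open>Eq 0 (Suc i)\<close> gives reflexivity, and inserting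
  \<open>j\<close> gives the claim.\<close>

lemma saturated_Eq_sym: "saturated H \<Longrightarrow> Eq i j \<in> H \<Longrightarrow> Eq j i \<in> H"
  using saturated_Eq_subst[of H i j "Eq 0 (Suc i)"] saturated_Eq_refl by simp

lemma saturated_Eq_trans: "saturated H \<Longrightarrow> Eq i j \<in> H \<Longrightarrow> Eq j k \<in> H \<Longrightarrow> Eq i k \<in> H"
  using saturated_Eq_subst[of H j k "Eq (Suc i) 0"] by simp

lemma saturated_Mem_cong:
  "saturated H \<Longrightarrow> Eq i i' \<in> H \<Longrightarrow> Eq j j' \<in> H \<Longrightarrow> Mem i j \<in> H \<Longrightarrow> Mem i' j' \<in> H"
  using saturated_Eq_subst[of H i i' "Mem 0 (Suc j)"] saturated_Eq_subst[of H j j' "Mem (Suc i') 0"]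
  by simp

text \<open>\<open>C\<close> bounds the quantifiers only. With \<open>UNIV\<close> this is truth in
  the universe, with the elements of a set \<open>A\<close> it is truth in the structure on
  \<open>A\<close>, over the same carrier type.\<close>

primrec holds :: "('a \<Rightarrow> 'a \<Rightarrow> bool) \<Rightarrow> 'a set \<Rightarrow> (nat \<Rightarrow> 'a) \<Rightarrow> fm \<Rightarrow> bool" where
  "holds E C e Bot \<longleftrightarrow> False"
| "holds E C e (Mem i j) \<longleftrightarrow> E (e i) (e j)"
| "holds E C e (Eq i j) \<longleftrightarrow> e i = e j"
| "holds E C e (Imp p q) \<longleftrightarrow> (holds E C e p \<longrightarrow> holds E C e q)"
| "holds E C e (Forall p) \<longleftrightarrow> (\<forall>x\<in>C. holds E C (case_nat x e) p)"

lemma holds_rename: "holds E C e (rename f p) \<longleftrightarrow> holds E C (\<lambda>i. e (f i)) p"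
proof (induction p arbitrary: e f)
  case (Forall p)
  have "(\<lambda>i. case_nat x e (case_nat 0 (\<lambda>i. Suc (f i)) i)) = case_nat x (\<lambda>i. e (f i))" for x
    by (auto split: nat.split)
  then show ?case using Forall by simp
qed auto

lemma holds_cong: "closed_at n p \<Longrightarrow> (\<And>i. i < n \<Longrightarrow> e i = e' i) \<Longrightarrow> holds E C e p \<longleftrightarrow> holds E C e' p"
proof (induction p arbitrary: n e e')
  case (Forall p)
  have "holds E C (case_nat x e) p = holds E C (case_nat x e') p" for x
    using Forall.prems by (intro Forall.IH[of "Suc n"]) (auto split: nat.split)
  then show ?case by simp
next
  case (Imp p q)
  then show ?case by (metis closed_at.simps(4) holds.simps(4))
qed auto

lemma closed_at_mono: "closed_at n p \<Longrightarrow> n \<le> m \<Longrightarrow> closed_at m p"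
proof (induction p arbitrary: n m)
  case (Forall p)
  then show ?case by (metis Suc_le_mono closed_at.simps(5))
qed auto

lemma ex_closed_at: "\<exists>n. closed_at (Suc n) p"
proof (induction p)
  case (Mem i j)
  show ?case by (intro exI[of _ "max i j"]) auto
next
  case (Eq i j)
  show ?case by (intro exI[of _ "max i j"]) auto
next
  case (Imp p q)
  then obtain m n where "closed_at (Suc m) p" "closed_at (Suc n) q" by auto
  then show ?case by (intro exI[of _ "max m n"]) (auto elim: closed_at_mono)
next
  case (Forall p)
  then obtain n where "closed_at (Suc n) p" by auto
  then show ?case by (intro exI[of _ n]) (auto elim: closed_at_mono)
qed auto

text \<open>Truth lemma of the term model, \<open>c i\<close> being the element named by the
  variable \<open>i\<close>. The renaming \<open>f\<close> is arbitrary because a quantifier turns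
  it into \<open>case_nat t f\<close>, matching the renamed instances in the Henkin
  property.\<close>

lemma saturated_holds:
  assumes H: "saturated H" and c: "\<And>i j. c i = c j \<longleftrightarrow> Eq i j \<in> H" and "surj c"
  defines "E \<equiv> \<lambda>x y. \<exists>i j. x = c i \<and> y = c j \<and> Mem i j \<in> H"
  shows "holds E UNIV (\<lambda>i. c (f i)) p \<longleftrightarrow> rename f p \<in> H"
proof (induction p arbitrary: f)
  case Bot
  then show ?case using H by (auto simp: saturated_def consistent_def intro: proves.Assumption)
next
  case (Mem i j)
  have "E (c (f i)) (c (f j)) \<longleftrightarrow> Mem (f i) (f j) \<in> H"
  proof
    assume "E (c (f i)) (c (f j))"
    then obtain i' j' where "Eq i' (f i) \<in> H" "Eq j' (f j) \<in> H" "Mem i' j' \<in> H"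
      unfolding E_def c using saturated_Eq_sym[OF H] by blast
    then show "Mem (f i) (f j) \<in> H" by (rule saturated_Mem_cong[OF H])
  qed (auto simp: E_def)
  then show ?case by simp
next
  case (Imp p q)
  then show ?case using H by (simp add: saturated_Imp)
next
  case (Forall p)
  have f: "(\<lambda>i. case_nat t id (case_nat 0 (\<lambda>i. Suc (f i)) i)) = case_nat t f" for t
    by (auto split: nat.split)
  have *: "case_nat (c t) (\<lambda>i. c (f i)) = (\<lambda>i. c (case_nat t f i))" for t
    by (auto split: nat.split)
  have "holds E UNIV (\<lambda>i. c (f i)) (Forall p) \<longleftrightarrow>
      (\<forall>t. holds E UNIV (case_nat (c t) (\<lambda>i. c (f i))) p)"
    using \<open>surj c\<close> by simp (metis surjD)
  also have "\<dots> \<longleftrightarrow> rename f (Forall p) \<in> H"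
    by (simp add: H saturated_Forall rename_rename f * Forall)
  finally show ?case .
qed (simp add: c)

text \<open>Doubling frees all odd indices for witnesses, whatever variables occur in the theory.
  Halving is a left inverse and carries a contradiction back.\<close>

lemma consistent_double:
  assumes "\<not> \<Gamma> \<turnstile> p"
  shows "consistent (rename (\<lambda>i. 2 * i) ` insert (Imp p Bot) \<Gamma>)"
  unfolding consistent_def
proof
  assume "rename (\<lambda>i. 2 * i) ` insert (Imp p Bot) \<Gamma> \<turnstile> Bot"
  from proves_rename[OF this, of "\<lambda>i. i div 2"] have "insert (Imp p Bot) \<Gamma> \<turnstile> Bot"
    by (simp add: image_image rename_rename rename_id)
  then show False using assms proves.Contradiction[of p \<Gamma>] by simp
qed

lemma infinite_fresh_double: "infinite (fresh_for (rename (\<lambda>i. 2 * i) ` \<Gamma>))"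
proof -
  have "fv (rename f p) \<subseteq> range f" for f p
  proof (induction p arbitrary: f)
    case (Forall p)
    show ?case
    proof
      fix i assume "i \<in> fv (rename f (Forall p))"
      then have "Suc i \<in> range (case_nat 0 (\<lambda>i. Suc (f i)))" using Forall by auto
      then show "i \<in> range f" by (auto split: nat.splits)
    qed
  qed auto
  then have "Suc (2 * i) \<notin> fv (rename (\<lambda>i. 2 * i) p)" for i p
    by (metis (no_types, lifting) imageE double_not_eq_Suc_double subsetD)
  then have "range (\<lambda>i. Suc (2 * i)) \<subseteq> fresh_for (rename (\<lambda>i. 2 * i) ` \<Gamma>)"
    unfolding fresh_for_def by auto
  moreover have "infinite (range (\<lambda>i::nat. Suc (2 * i)))"
    by (auto dest!: finite_imageD simp: inj_def)
  ultimately show ?thesis using infinite_super by blast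
qed

section \<open>Semantics of the formulas with named binders\<close>

text \<open>Here \<open>v\<close> is indexed by binding levels; \<open>u\<close> only matters for indices that no quantifier binds.\<close>

definition level_env :: "(nat \<Rightarrow> 'a) \<Rightarrow> nat \<Rightarrow> (nat \<Rightarrow> 'a) \<Rightarrow> nat \<Rightarrow> 'a" where
  "level_env u d v i = (if i < d then v (d - Suc i) else u (i - d))"

definition tr :: "('a \<Rightarrow> 'a \<Rightarrow> bool) \<Rightarrow> 'a set \<Rightarrow> (nat \<Rightarrow> 'a) \<Rightarrow> frag \<Rightarrow> nat \<Rightarrow> (nat \<Rightarrow> 'a) \<Rightarrow> bool" where
  "tr E C u F d v \<longleftrightarrow> holds E C (level_env u d v) (F d)"

lemma case_nat_level_env: "case_nat x (level_env u d v) = level_env u (Suc d) (v(d := x))"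
  by (auto simp: level_env_def fun_eq_iff split: nat.split)

lemma level_env_level: "x < d \<Longrightarrow> level_env u d v (d - Suc x) = v x"
  by (simp add: level_env_def)

lemma tr_connectives [simp]:
  "tr E C u \<^bold>\<bottom> d v \<longleftrightarrow> False"
  "x < d \<Longrightarrow> y < d \<Longrightarrow> tr E C u (x \<^bold>\<in> y) d v \<longleftrightarrow> E (v x) (v y)"
  "x < d \<Longrightarrow> y < d \<Longrightarrow> tr E C u (x \<^bold>= y) d v \<longleftrightarrow> v x = v y"
  "tr E C u (P \<^bold>\<longrightarrow> Q) d v \<longleftrightarrow> (tr E C u P d v \<longrightarrow> tr E C u Q d v)"
  "tr E C u (\<^bold>\<not> P) d v \<longleftrightarrow> \<not> tr E C u P d v"
  "tr E C u (P \<^bold>\<and> Q) d v \<longleftrightarrow> tr E C u P d v \<and> tr E C u Q d v"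
  "tr E C u (P \<^bold>\<or> Q) d v \<longleftrightarrow> tr E C u P d v \<or> tr E C u Q d v"
  "tr E C u (P \<^bold>\<longleftrightarrow> Q) d v \<longleftrightarrow> (tr E C u P d v \<longleftrightarrow> tr E C u Q d v)"
  "tr E C u (f_all F) d v \<longleftrightarrow> (\<forall>a\<in>C. tr E C u (F d) (Suc d) (v(d := a)))"
  "tr E C u (f_ex F) d v \<longleftrightarrow> (\<exists>a\<in>C. tr E C u (F d) (Suc d) (v(d := a)))"
  by (auto simp: tr_def f_bot_def f_mem_def f_eq_def f_imp_def f_not_def f_and_def f_or_def f_iff_def
      f_all_def f_ex_def case_nat_level_env level_env_level)

lemma update_below [simp]: "x < (d :: nat) \<Longrightarrow> (v(d := a)) x = v x"
  by auto

lemma holds_closure: "holds E UNIV u (closure n P) \<longleftrightarrow> (\<forall>v. tr E UNIV u P n v)"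
proof -
  have "(\<forall>v. holds E UNIV (level_env u d v) ((Forall ^^ k) p)) \<longleftrightarrow>
      (\<forall>v. holds E UNIV (level_env u (d + k) v) p)" for d k p
  proof (induction k arbitrary: d)
    case (Suc k)
    have "(\<forall>v. holds E UNIV (level_env u d v) ((Forall ^^ Suc k) p)) \<longleftrightarrow>
        (\<forall>v x. holds E UNIV (level_env u (Suc d) (v(d := x))) ((Forall ^^ k) p))"
      by (simp add: case_nat_level_env)
    also have "\<dots> \<longleftrightarrow> (\<forall>v. holds E UNIV (level_env u (Suc d) v) ((Forall ^^ k) p))"
      by (metis fun_upd_triv)
    finally show ?case using Suc by simp
  qed simp
  moreover have "level_env u 0 v = u" for v by (simp add: level_env_def fun_eq_iff)
  ultimately show ?thesis unfolding closure_def tr_def by (metis add_0)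
qed

text \<open>Parameters are numbered by their levels, so the assignment \<open>v\<close> of the
  levels serves directly as the environment of the indices \<open>Suc i\<close> of
  \<open>p\<close>.\<close>

lemma tr_inst:
  assumes "closed_at (Suc n) p" "x < d" "n \<le> d"
  shows "tr E C u (inst p x) d v \<longleftrightarrow> holds E C (case_nat (v x) v) p"
  unfolding tr_def inst_def holds_rename using assms
  by (intro holds_cong[of "Suc n"]) (auto simp: level_env_def split: nat.split)

text \<open>These axioms already make empty set, unordered pair and successor total, so that every
  compound description of the vocabulary denotes. The other axioms are stated once this vocabulary
  can be read semantically.\<close>

locale set_universe =
  fixes E :: "'a \<Rightarrow> 'a \<Rightarrow> bool" (infix "\<epsilon>" 50)
  assumes extensional: "(\<And>z. z \<epsilon> x \<longleftrightarrow> z \<epsilon> y) \<Longrightarrow> x = y"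
    and ex_empty: "\<exists>x. \<forall>z. \<not> z \<epsilon> x"
    and ex_upair: "\<exists>w. \<forall>z. z \<epsilon> w \<longleftrightarrow> z = x \<or> z = y"
    and ex_union: "\<exists>w. \<forall>z. z \<epsilon> w \<longleftrightarrow> (\<exists>y. y \<epsilon> x \<and> z \<epsilon> y)"
begin

definition emp :: 'a where "emp = (THE x. \<forall>z. \<not> z \<epsilon> x)"
definition upr :: "'a \<Rightarrow> 'a \<Rightarrow> 'a" where "upr x y = (THE w. \<forall>z. z \<epsilon> w \<longleftrightarrow> z = x \<or> z = y)"
definition un :: "'a \<Rightarrow> 'a" where "un x = (THE w. \<forall>z. z \<epsilon> w \<longleftrightarrow> (\<exists>y. y \<epsilon> x \<and> z \<epsilon> y))"

lemma the_set: "\<exists>w. \<forall>z. z \<epsilon> w \<longleftrightarrow> P z \<Longrightarrow> z \<epsilon> (THE w. \<forall>z. z \<epsilon> w \<longleftrightarrow> P z) \<longleftrightarrow> P z"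
proof -
  assume "\<exists>w. \<forall>z. z \<epsilon> w \<longleftrightarrow> P z"
  then have "\<exists>!w. \<forall>z. z \<epsilon> w \<longleftrightarrow> P z" using extensional by (metis (full_types))
  from theI'[OF this] show ?thesis by blast
qed

lemma mem_emp [simp]: "\<not> z \<epsilon> emp"
  using the_set[of "\<lambda>z. False"] ex_empty by (simp add: emp_def)

lemma mem_upr [simp]: "z \<epsilon> upr x y \<longleftrightarrow> z = x \<or> z = y"
  unfolding upr_def by (rule the_set[OF ex_upair])

lemma mem_un [simp]: "z \<epsilon> un x \<longleftrightarrow> (\<exists>y. y \<epsilon> x \<and> z \<epsilon> y)"
  unfolding un_def by (rule the_set[OF ex_union])

lemma set_eq_iff: "x = y \<longleftrightarrow> (\<forall>z. z \<epsilon> x \<longleftrightarrow> z \<epsilon> y)"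
  using extensional by blast

definition pr :: "'a \<Rightarrow> 'a \<Rightarrow> 'a" where "pr x y = upr (upr x x) (upr x y)"
definition sc :: "'a \<Rightarrow> 'a" where "sc x = un (upr x (upr x x))"
definition sub :: "'a \<Rightarrow> 'a \<Rightarrow> bool" where "sub x y \<longleftrightarrow> (\<forall>z. z \<epsilon> x \<longrightarrow> z \<epsilon> y)"
definition trans_set :: "'a \<Rightarrow> bool" where "trans_set x \<longleftrightarrow> (\<forall>y. y \<epsilon> x \<longrightarrow> sub y x)"

primrec nn :: "nat \<Rightarrow> 'a" where
  "nn 0 = emp"
| "nn (Suc k) = sc (nn k)"

declare nn.simps [simp del] num.simps [simp del]

lemma upr_eq_iff: "upr x y = upr x' y' \<longleftrightarrow> x = x' \<and> y = y' \<or> x = y' \<and> y = x'"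
  unfolding set_eq_iff[of "upr x y"] mem_upr by metis

lemma pr_eq_iff [simp]: "pr x y = pr x' y' \<longleftrightarrow> x = x' \<and> y = y'"
  unfolding pr_def upr_eq_iff by blast

lemma mem_sc [simp]: "z \<epsilon> sc x \<longleftrightarrow> z \<epsilon> x \<or> z = x"
  by (auto simp: sc_def)

definition Ind :: "'a \<Rightarrow> bool" where
  "Ind w \<longleftrightarrow> emp \<epsilon> w \<and> (\<forall>x. x \<epsilon> w \<longrightarrow> sc x \<epsilon> w)"

definition Om :: "'a \<Rightarrow> bool" where
  "Om w \<longleftrightarrow> Ind w \<and> (\<forall>u. Ind u \<longrightarrow> sub w u)"

definition Nat :: "'a \<Rightarrow> bool" where
  "Nat n \<longleftrightarrow> (\<exists>w. Om w \<and> n \<epsilon> w)"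

definition FunOn :: "('a \<Rightarrow> bool) \<Rightarrow> 'a \<Rightarrow> bool" where
  "FunOn D f \<longleftrightarrow> (\<forall>p. p \<epsilon> f \<longrightarrow> (\<exists>x y. D x \<and> p = pr x y)) \<and>
     (\<forall>x. D x \<longrightarrow> (\<exists>y. \<forall>z. pr x z \<epsilon> f \<longleftrightarrow> z = y))"

definition Func :: "'a \<Rightarrow> 'a \<Rightarrow> 'a \<Rightarrow> bool" where
  "Func f a b \<longleftrightarrow> FunOn (\<lambda>x. x \<epsilon> a) f \<and> (\<forall>x y. pr x y \<epsilon> f \<longrightarrow> y \<epsilon> b)"

definition Lang :: "'a \<Rightarrow> bool" where
  "Lang L \<longleftrightarrow> (\<exists>R F w r f. Om w \<and> Func R r w \<and> Func F f w \<and> L = pr R F)"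

definition RelSym :: "'a \<Rightarrow> 'a \<Rightarrow> 'a \<Rightarrow> bool" where
  "RelSym L r m \<longleftrightarrow> (\<exists>R F. L = pr R F \<and> pr r m \<epsilon> R)"

definition FunSym :: "'a \<Rightarrow> 'a \<Rightarrow> 'a \<Rightarrow> bool" where
  "FunSym L f m \<longleftrightarrow> (\<exists>R F. L = pr R F \<and> pr f m \<epsilon> F)"

definition StrDom :: "'a \<Rightarrow> 'a \<Rightarrow> bool" where
  "StrDom X A \<longleftrightarrow> (\<exists>I J. X = pr A (pr I J))"

definition StrRel :: "'a \<Rightarrow> 'a \<Rightarrow> 'a \<Rightarrow> bool" where
  "StrRel X r e \<longleftrightarrow> (\<exists>A I J. X = pr A (pr I J) \<and> pr r e \<epsilon> I)"

definition StrFun :: "'a \<Rightarrow> 'a \<Rightarrow> 'a \<Rightarrow> bool" where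
  "StrFun X f h \<longleftrightarrow> (\<exists>A I J. X = pr A (pr I J) \<and> pr f h \<epsilon> J)"

definition Struct :: "'a \<Rightarrow> 'a \<Rightarrow> bool" where
  "Struct L X \<longleftrightarrow> (\<exists>A I J. X = pr A (pr I J) \<and> (\<exists>x. x \<epsilon> A) \<and>
     FunOn (\<lambda>r. \<exists>m. RelSym L r m) I \<and>
     (\<forall>r m e. RelSym L r m \<and> pr r e \<epsilon> I \<longrightarrow> (\<forall>s. s \<epsilon> e \<longrightarrow> Func s m A)) \<and>
     FunOn (\<lambda>f. \<exists>m. FunSym L f m) J \<and>
     (\<forall>f m h. FunSym L f m \<and> pr f h \<epsilon> J \<longrightarrow>
        FunOn (\<lambda>s. Func s m A) h \<and> (\<forall>s y. pr s y \<epsilon> h \<longrightarrow> y \<epsilon> A)))"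

definition cvar :: "'a \<Rightarrow> 'a" where "cvar k = pr (nn 0) k"
definition capp :: "'a \<Rightarrow> 'a \<Rightarrow> 'a" where "capp f ts = pr (nn 1) (pr f ts)"
definition ceq :: "'a \<Rightarrow> 'a \<Rightarrow> 'a" where "ceq t u = pr (nn 0) (pr t u)"
definition crel :: "'a \<Rightarrow> 'a \<Rightarrow> 'a" where "crel r ts = pr (nn 1) (pr r ts)"
definition cbot :: 'a where "cbot = pr (nn 2) (nn 0)"
definition cimp :: "'a \<Rightarrow> 'a \<Rightarrow> 'a" where "cimp p q = pr (nn 3) (pr p q)"
definition call :: "'a \<Rightarrow> 'a \<Rightarrow> 'a" where "call k p = pr (nn 4) (pr k p)"

definition Gen :: "(('a \<Rightarrow> bool) \<Rightarrow> 'a \<Rightarrow> bool) \<Rightarrow> 'a \<Rightarrow> bool" where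
  "Gen step x \<longleftrightarrow> (\<exists>m s. Nat m \<and> FunOn (\<lambda>i. i \<epsilon> sc m) s \<and>
     (\<forall>i y. pr i y \<epsilon> s \<longrightarrow> step (\<lambda>z. \<exists>j. j \<epsilon> i \<and> pr j z \<epsilon> s) y) \<and> pr m x \<epsilon> s)"

definition term_step :: "'a \<Rightarrow> 'a \<Rightarrow> ('a \<Rightarrow> bool) \<Rightarrow> 'a \<Rightarrow> bool" where
  "term_step L n P t \<longleftrightarrow> (\<exists>k. k \<epsilon> n \<and> t = cvar k) \<or>
     (\<exists>f m ts. FunSym L f m \<and> FunOn (\<lambda>i. i \<epsilon> m) ts \<and> (\<forall>i u. pr i u \<epsilon> ts \<longrightarrow> P u) \<and> t = capp f ts)"

definition Term :: "'a \<Rightarrow> 'a \<Rightarrow> 'a \<Rightarrow> bool" where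
  "Term L n = Gen (term_step L n)"

definition form_step :: "'a \<Rightarrow> 'a \<Rightarrow> ('a \<Rightarrow> bool) \<Rightarrow> 'a \<Rightarrow> bool" where
  "form_step L n P p \<longleftrightarrow>
     (\<exists>t u. Term L n t \<and> Term L n u \<and> p = ceq t u) \<or>
     (\<exists>r m ts. RelSym L r m \<and> FunOn (\<lambda>i. i \<epsilon> m) ts \<and>
        (\<forall>i u. pr i u \<epsilon> ts \<longrightarrow> Term L n u) \<and> p = crel r ts) \<or>
     p = cbot \<or>
     (\<exists>q r. P q \<and> P r \<and> p = cimp q r) \<or>
     (\<exists>k q. k \<epsilon> n \<and> P q \<and> p = call k q)"

definition Form :: "'a \<Rightarrow> 'a \<Rightarrow> 'a \<Rightarrow> bool" where
  "Form L n = Gen (form_step L n)"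

definition Comp :: "'a \<Rightarrow> 'a \<Rightarrow> 'a \<Rightarrow> bool" where
  "Comp g ts bs \<longleftrightarrow> FunOn (\<lambda>i. \<exists>u. pr i u \<epsilon> ts) bs \<and>
     (\<forall>i u b. pr i u \<epsilon> ts \<and> pr i b \<epsilon> bs \<longrightarrow> pr u b \<epsilon> g)"

definition PEval :: "'a \<Rightarrow> 'a \<Rightarrow> 'a \<Rightarrow> bool" where
  "PEval X a g \<longleftrightarrow> (\<forall>t b. pr t b \<epsilon> g \<longrightarrow> (\<exists>k. t = cvar k \<and> pr k b \<epsilon> a) \<or>
     (\<exists>f ts h bs. t = capp f ts \<and> StrFun X f h \<and> Comp g ts bs \<and> pr bs b \<epsilon> h))"

definition TVal :: "'a \<Rightarrow> 'a \<Rightarrow> 'a \<Rightarrow> 'a \<Rightarrow> bool" where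
  "TVal X a t b \<longleftrightarrow> (\<exists>g. PEval X a g \<and> pr t b \<epsilon> g)"

definition TVals :: "'a \<Rightarrow> 'a \<Rightarrow> 'a \<Rightarrow> 'a \<Rightarrow> bool" where
  "TVals X a ts bs \<longleftrightarrow> FunOn (\<lambda>i. \<exists>u. pr i u \<epsilon> ts) bs \<and>
     (\<forall>i u b. pr i u \<epsilon> ts \<and> pr i b \<epsilon> bs \<longrightarrow> TVal X a u b)"

definition variant :: "'a \<Rightarrow> 'a \<Rightarrow> 'a \<Rightarrow> bool" where
  "variant k a a' \<longleftrightarrow> (\<forall>i b. i \<noteq> k \<longrightarrow> (pr i b \<epsilon> a' \<longleftrightarrow> pr i b \<epsilon> a))"

definition SatRel :: "'a \<Rightarrow> 'a \<Rightarrow> 'a \<Rightarrow> 'a \<Rightarrow> bool" where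
  "SatRel X n D S \<longleftrightarrow> (\<exists>A. StrDom X A \<and> (\<forall>p a. p \<epsilon> D \<and> Func a n A \<longrightarrow>
     (\<forall>t u. p = ceq t u \<longrightarrow> (pr p a \<epsilon> S \<longleftrightarrow> (\<exists>b. TVal X a t b \<and> TVal X a u b))) \<and>
     (\<forall>r ts. p = crel r ts \<longrightarrow>
        (pr p a \<epsilon> S \<longleftrightarrow> (\<exists>e bs. StrRel X r e \<and> TVals X a ts bs \<and> bs \<epsilon> e))) \<and>
     (p = cbot \<longrightarrow> \<not> pr p a \<epsilon> S) \<and>
     (\<forall>q r. p = cimp q r \<longrightarrow> q \<epsilon> D \<and> r \<epsilon> D \<and>
        (pr p a \<epsilon> S \<longleftrightarrow> (pr q a \<epsilon> S \<longrightarrow> pr r a \<epsilon> S))) \<and>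
     (\<forall>k q. p = call k q \<longrightarrow> q \<epsilon> D \<and>
        (pr p a \<epsilon> S \<longleftrightarrow> (\<forall>a'. Func a' n A \<and> variant k a a' \<longrightarrow> pr q a' \<epsilon> S)))))"

definition Sat :: "'a \<Rightarrow> 'a \<Rightarrow> 'a \<Rightarrow> 'a \<Rightarrow> bool" where
  "Sat X n p a \<longleftrightarrow> (\<exists>D S. SatRel X n D S \<and> p \<epsilon> D \<and> pr p a \<epsilon> S)"

definition Valid :: "'a \<Rightarrow> 'a \<Rightarrow> 'a \<Rightarrow> bool" where
  "Valid L X p \<longleftrightarrow>
     (\<forall>n A a. Nat n \<and> Form L n p \<and> StrDom X A \<and> Func a n A \<longrightarrow> Sat X n p a)"

definition Elem :: "'a \<Rightarrow> 'a \<Rightarrow> 'a \<Rightarrow> 'a \<Rightarrow> bool" where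
  "Elem L X Y j \<longleftrightarrow> (\<exists>A B. StrDom X A \<and> StrDom Y B \<and> Func j A B \<and>
     (\<forall>n p a b. Nat n \<and> Form L n p \<and> Func a n A \<and> Comp j a b \<longrightarrow> (Sat X n p a \<longleftrightarrow> Sat Y n p b)))"

definition epsL :: 'a where
  "epsL = pr (upr (pr (nn 0) (nn 2)) (pr (nn 0) (nn 2))) (nn 0)"

definition EpsStr :: "'a \<Rightarrow> 'a \<Rightarrow> bool" where
  "EpsStr M X \<longleftrightarrow> (\<exists>x. x \<epsilon> M) \<and>
     (\<exists>e. (\<forall>s. s \<epsilon> e \<longleftrightarrow> Func s (nn 2) M \<and> (\<exists>x y. pr (nn 0) x \<epsilon> s \<and> pr (nn 1) y \<epsilon> s \<and> x \<epsilon> y)) \<and>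
        X = pr M (pr (upr (pr (nn 0) e) (pr (nn 0) e)) (nn 0)))"

definition cveq :: "'a \<Rightarrow> 'a \<Rightarrow> 'a" where "cveq k l = ceq (cvar k) (cvar l)"
definition cvmem :: "'a \<Rightarrow> 'a \<Rightarrow> 'a" where
  "cvmem k l = crel (nn 0) (upr (pr (nn 0) (cvar k)) (pr (nn 1) (cvar l)))"
definition cnot :: "'a \<Rightarrow> 'a" where "cnot p = cimp p cbot"
definition cand :: "'a \<Rightarrow> 'a \<Rightarrow> 'a" where "cand p q = cnot (cimp p (cnot q))"
definition ciff :: "'a \<Rightarrow> 'a \<Rightarrow> 'a" where "ciff p q = cand (cimp p q) (cimp q p)"
definition cex :: "'a \<Rightarrow> 'a \<Rightarrow> 'a" where "cex k p = cnot (call k (cnot p))"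

primrec code :: "nat \<Rightarrow> fm \<Rightarrow> 'a" where
  "code d Bot = cbot"
| "code d (Mem i j) = cvmem (nn (d - Suc i)) (nn (d - Suc j))"
| "code d (Eq i j) = cveq (nn (d - Suc i)) (nn (d - Suc j))"
| "code d (Imp p q) = cimp (code d p) (code d q)"
| "code d (Forall p) = call (nn d) (code (Suc d) p)"

definition csep :: "'a \<Rightarrow> 'a \<Rightarrow> 'a" where
  "csep n p = call n (cex (sc n) (call (nn 0) (ciff (cvmem (nn 0) (sc n)) (cand (cvmem (nn 0) n) p))))"

definition crepl :: "'a \<Rightarrow> 'a \<Rightarrow> 'a" where
  "crepl n p = call n (cimp
     (call (nn 0) (cimp (cvmem (nn 0) n)
        (cex (sc (sc n)) (call (nn 1) (ciff p (cveq (nn 1) (sc (sc n))))))))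
     (cex (sc n) (call (nn 1) (ciff (cvmem (nn 1) (sc n)) (cex (nn 0) (cand (cvmem (nn 0) n) p))))))"

definition ZFAx :: "'a \<Rightarrow> bool" where
  "ZFAx c \<longleftrightarrow> (\<exists>p\<in>{extensionality, foundation, pairing, union, powerset, infinity, choice}. c = code 0 p) \<or>
     (\<exists>n p. Nat n \<and> nn 1 \<epsilon> n \<and> Form epsL n p \<and> (c = csep n p \<or> c = crepl n p))"

definition Model :: "'a \<Rightarrow> bool" where
  "Model M \<longleftrightarrow> trans_set M \<and> (\<exists>X. EpsStr M X \<and> (\<forall>c. ZFAx c \<longrightarrow> Valid epsL X c))"

definition ElSub :: "'a \<Rightarrow> 'a \<Rightarrow> bool" where
  "ElSub M N \<longleftrightarrow> (\<exists>X Y j. EpsStr M X \<and> EpsStr N Y \<and>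
     (\<forall>x y. pr x y \<epsilon> j \<longleftrightarrow> x \<epsilon> M \<and> x = y) \<and> Elem epsL X Y j)"

definition Extd :: "'a \<Rightarrow> bool" where
  "Extd M \<longleftrightarrow> Model M \<and> (\<exists>N. Model N \<and> M \<epsilon> N \<and> ElSub M N)"

section \<open>Semantic reading of the formal vocabulary\<close>

abbreviation ev :: "(nat \<Rightarrow> 'a) \<Rightarrow> frag \<Rightarrow> nat \<Rightarrow> (nat \<Rightarrow> 'a) \<Rightarrow> bool" where
  "ev \<equiv> tr (\<epsilon>) UNIV"

text \<open>Descriptions are composed under further binders. Hence the quantification over all
  greater depths and over all assignments that agree with \<open>v\<close> on the levels below
  \<open>d\<close>.\<close>

definition den :: "(nat \<Rightarrow> 'a) \<Rightarrow> desc \<Rightarrow> nat \<Rightarrow> (nat \<Rightarrow> 'a) \<Rightarrow> 'a \<Rightarrow> bool" where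
  "den u A d v a \<longleftrightarrow> (\<forall>x d' v'. d \<le> d' \<longrightarrow> (\<forall>i<d. v' i = v i) \<longrightarrow> x < d' \<longrightarrow> (ev u (A x) d' v' \<longleftrightarrow> v' x = a))"

lemma ev_den: "den u A d v a \<Longrightarrow> x < d \<Longrightarrow> ev u (A x) d v \<longleftrightarrow> v x = a"
  unfolding den_def by blast

lemma ev_subset [simp]: "x < d \<Longrightarrow> y < d \<Longrightarrow> ev u (subset x y) d v \<longleftrightarrow> sub (v x) (v y)"
  by (simp add: subset_def sub_def)

lemma ev_transitive [simp]: "x < d \<Longrightarrow> ev u (transitive x) d v \<longleftrightarrow> trans_set (v x)"
  by (simp add: transitive_def trans_set_def)

lemma ev_is_empty [simp]: "x < d \<Longrightarrow> ev u (is_empty x) d v \<longleftrightarrow> v x = emp"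
  by (simp add: is_empty_def set_eq_iff)

lemma ev_is_upair [simp]:
  "x < d \<Longrightarrow> y < d \<Longrightarrow> z < d \<Longrightarrow> ev u (is_upair x y z) d v \<longleftrightarrow> v z = upr (v x) (v y)"
  by (simp add: is_upair_def set_eq_iff)

lemma ev_is_pair [simp]:
  "x < d \<Longrightarrow> y < d \<Longrightarrow> z < d \<Longrightarrow> ev u (is_pair x y z) d v \<longleftrightarrow> v z = pr (v x) (v y)"
  by (simp add: is_pair_def pr_def set_eq_iff[of "v z"])

lemma ev_is_suc [simp]: "x < d \<Longrightarrow> z < d \<Longrightarrow> ev u (is_suc x z) d v \<longleftrightarrow> v z = sc (v x)"
  by (simp add: is_suc_def set_eq_iff)

lemma den_var: "k < d \<Longrightarrow> den u (the_var k) d v (v k)"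
  by (simp add: den_def the_var_def)

lemma den_empty: "den u is_empty d v emp"
  by (simp add: den_def)

lemma den_upair: "den u A d v a \<Longrightarrow> den u B d v b \<Longrightarrow> den u (upair A B) d v (upr a b)"
  by (simp add: den_def upair_def)

lemma den_pair: "den u A d v a \<Longrightarrow> den u B d v b \<Longrightarrow> den u (pair A B) d v (pr a b)"
  by (simp add: den_def pair_def)

lemma den_suc: "den u A d v a \<Longrightarrow> den u (suc A) d v (sc a)"
  by (simp add: den_def suc_def)

lemma den_num: "den u (num k) d v (nn k)"
  by (induction k) (simp_all add: den_suc den_empty nn.simps num.simps)

lemmas den_basic = den_var den_empty den_upair den_pair den_suc den_num

lemma ev_num [simp]: "x < d \<Longrightarrow> ev u (num k x) d v \<longleftrightarrow> v x = nn k"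
  by (rule ev_den[OF den_num])

lemma ev_is_inductive [simp]: "x < d \<Longrightarrow> ev u (is_inductive x) d v \<longleftrightarrow> Ind (v x)"
  by (simp add: is_inductive_def Ind_def)

lemma ev_is_omega [simp]: "x < d \<Longrightarrow> ev u (is_omega x) d v \<longleftrightarrow> Om (v x)"
  by (simp add: is_omega_def Om_def)

lemma ev_natural [simp]: "x < d \<Longrightarrow> ev u (natural x) d v \<longleftrightarrow> Nat (v x)"
  by (simp add: natural_def Nat_def)

lemma ev_app [simp]: "f < d \<Longrightarrow> x < d \<Longrightarrow> y < d \<Longrightarrow> ev u (app f x y) d v \<longleftrightarrow> pr (v x) (v y) \<epsilon> v f"
  by (simp add: app_def)

lemma ev_is_function [simp]:
  "f < d \<Longrightarrow> a < d \<Longrightarrow> b < d \<Longrightarrow> ev u (is_function f a b) d v \<longleftrightarrow> Func (v f) (v a) (v b)"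
  by (simp add: is_function_def function_on_def Func_def FunOn_def)

lemma ev_is_language [simp]: "x < d \<Longrightarrow> ev u (is_language x) d v \<longleftrightarrow> Lang (v x)"
  by (simp add: is_language_def Lang_def)

lemma ev_rel_symbol [simp]:
  "l < d \<Longrightarrow> r < d \<Longrightarrow> m < d \<Longrightarrow> ev u (rel_symbol l r m) d v \<longleftrightarrow> RelSym (v l) (v r) (v m)"
  by (simp add: rel_symbol_def RelSym_def)

lemma ev_fun_symbol [simp]:
  "l < d \<Longrightarrow> f < d \<Longrightarrow> m < d \<Longrightarrow> ev u (fun_symbol l f m) d v \<longleftrightarrow> FunSym (v l) (v f) (v m)"
  by (simp add: fun_symbol_def FunSym_def)

lemma ev_is_triple [simp]:
  "a < d \<Longrightarrow> i < d \<Longrightarrow> j < d \<Longrightarrow> x < d \<Longrightarrow>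
    ev u (is_triple a i j x) d v \<longleftrightarrow> v x = pr (v a) (pr (v i) (v j))"
  by (auto simp: is_triple_def intro!: ev_den den_basic)

lemma ev_struct_dom [simp]: "x < d \<Longrightarrow> a < d \<Longrightarrow> ev u (struct_dom x a) d v \<longleftrightarrow> StrDom (v x) (v a)"
  by (simp add: struct_dom_def StrDom_def)

lemma ev_struct_rel [simp]:
  "x < d \<Longrightarrow> r < d \<Longrightarrow> e < d \<Longrightarrow> ev u (struct_rel x r e) d v \<longleftrightarrow> StrRel (v x) (v r) (v e)"
  by (simp add: struct_rel_def StrRel_def)

lemma ev_struct_fun [simp]:
  "x < d \<Longrightarrow> f < d \<Longrightarrow> h < d \<Longrightarrow> ev u (struct_fun x f h) d v \<longleftrightarrow> StrFun (v x) (v f) (v h)"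
  by (simp add: struct_fun_def StrFun_def)

lemma ev_is_structure [simp]:
  "l < d \<Longrightarrow> x < d \<Longrightarrow> ev u (is_structure l x) d v \<longleftrightarrow> Struct (v l) (v x)"
  by (simp add: is_structure_def function_on_def Struct_def FunOn_def)

lemma den_codes:
  "den u A d v a \<Longrightarrow> den u (c_var A) d v (cvar a)"
  "den u A d v a \<Longrightarrow> den u B d v b \<Longrightarrow> den u (c_app A B) d v (capp a b)"
  "den u A d v a \<Longrightarrow> den u B d v b \<Longrightarrow> den u (c_eq A B) d v (ceq a b)"
  "den u A d v a \<Longrightarrow> den u B d v b \<Longrightarrow> den u (c_rel A B) d v (crel a b)"
  "den u c_bot d v cbot"
  "den u A d v a \<Longrightarrow> den u B d v b \<Longrightarrow> den u (c_imp A B) d v (cimp a b)"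
  "den u A d v a \<Longrightarrow> den u B d v b \<Longrightarrow> den u (c_all A B) d v (call a b)"
  unfolding c_var_def c_app_def c_eq_def c_rel_def c_bot_def c_imp_def c_all_def
    cvar_def capp_def ceq_def crel_def cbot_def cimp_def call_def
  by (intro den_basic; assumption)+

lemma ev_codes [simp]:
  "k < d \<Longrightarrow> x < d \<Longrightarrow> ev u (c_var (the_var k) x) d v \<longleftrightarrow> v x = cvar (v k)"
  "k < d \<Longrightarrow> l < d \<Longrightarrow> x < d \<Longrightarrow> ev u (c_app (the_var k) (the_var l) x) d v \<longleftrightarrow> v x = capp (v k) (v l)"
  "k < d \<Longrightarrow> l < d \<Longrightarrow> x < d \<Longrightarrow> ev u (c_eq (the_var k) (the_var l) x) d v \<longleftrightarrow> v x = ceq (v k) (v l)"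
  "k < d \<Longrightarrow> l < d \<Longrightarrow> x < d \<Longrightarrow> ev u (c_rel (the_var k) (the_var l) x) d v \<longleftrightarrow> v x = crel (v k) (v l)"
  "x < d \<Longrightarrow> ev u (c_bot x) d v \<longleftrightarrow> v x = cbot"
  "k < d \<Longrightarrow> l < d \<Longrightarrow> x < d \<Longrightarrow> ev u (c_imp (the_var k) (the_var l) x) d v \<longleftrightarrow> v x = cimp (v k) (v l)"
  "k < d \<Longrightarrow> l < d \<Longrightarrow> x < d \<Longrightarrow> ev u (c_all (the_var k) (the_var l) x) d v \<longleftrightarrow> v x = call (v k) (v l)"
  by (auto intro!: ev_den den_codes den_var)

lemma ev_is_term [simp]:
  "l < d \<Longrightarrow> n < d \<Longrightarrow> x < d \<Longrightarrow> ev u (is_term l n x) d v \<longleftrightarrow> Term (v l) (v n) (v x)"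
  by (simp add: is_term_def generated_def function_on_def Term_def Gen_def term_step_def FunOn_def)

lemma ev_is_formula [simp]:
  "l < d \<Longrightarrow> n < d \<Longrightarrow> x < d \<Longrightarrow> ev u (is_formula l n x) d v \<longleftrightarrow> Form (v l) (v n) (v x)"
  by (simp add: is_formula_def generated_def function_on_def Form_def Gen_def form_step_def FunOn_def)

lemma ev_is_comp [simp]:
  "g < d \<Longrightarrow> t < d \<Longrightarrow> b < d \<Longrightarrow> ev u (is_comp g t b) d v \<longleftrightarrow> Comp (v g) (v t) (v b)"
  by (simp add: is_comp_def function_on_def Comp_def FunOn_def)

lemma ev_partial_eval [simp]:
  "x < d \<Longrightarrow> a < d \<Longrightarrow> g < d \<Longrightarrow> ev u (partial_eval x a g) d v \<longleftrightarrow> PEval (v x) (v a) (v g)"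
  by (simp add: partial_eval_def PEval_def)

lemma ev_term_value [simp]:
  "x < d \<Longrightarrow> a < d \<Longrightarrow> t < d \<Longrightarrow> b < d \<Longrightarrow>
    ev u (term_value x a t b) d v \<longleftrightarrow> TVal (v x) (v a) (v t) (v b)"
  by (simp add: term_value_def TVal_def)

lemma ev_term_values [simp]:
  "x < d \<Longrightarrow> a < d \<Longrightarrow> t < d \<Longrightarrow> b < d \<Longrightarrow>
    ev u (term_values x a t b) d v \<longleftrightarrow> TVals (v x) (v a) (v t) (v b)"
  by (simp add: term_values_def function_on_def TVals_def FunOn_def)

lemma ev_sat_relation [simp]:
  "x < d \<Longrightarrow> n < d \<Longrightarrow> D < d \<Longrightarrow> S < d \<Longrightarrow>
    ev u (sat_relation x n D S) d v \<longleftrightarrow> SatRel (v x) (v n) (v D) (v S)"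
  by (simp add: sat_relation_def SatRel_def variant_def)

lemma ev_sat [simp]:
  "x < d \<Longrightarrow> n < d \<Longrightarrow> p < d \<Longrightarrow> a < d \<Longrightarrow> ev u (sat x n p a) d v \<longleftrightarrow> Sat (v x) (v n) (v p) (v a)"
  by (simp add: sat_def Sat_def)

lemma ev_valid_in [simp]:
  "l < d \<Longrightarrow> x < d \<Longrightarrow> p < d \<Longrightarrow> ev u (valid_in l x p) d v \<longleftrightarrow> Valid (v l) (v x) (v p)"
  by (simp add: valid_in_def Valid_def)

lemma ev_elementary_embedding [simp]:
  "l < d \<Longrightarrow> x < d \<Longrightarrow> y < d \<Longrightarrow> j < d \<Longrightarrow>
    ev u (elementary_embedding l x y j) d v \<longleftrightarrow> Elem (v l) (v x) (v y) (v j)"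
  by (simp add: elementary_embedding_def Elem_def)

lemma ev_eps_language [simp]: "x < d \<Longrightarrow> ev u (eps_language x) d v \<longleftrightarrow> v x = epsL"
  unfolding eps_language_def epsL_def by (intro ev_den den_basic)

lemma ev_eps_structure [simp]:
  "m < d \<Longrightarrow> x < d \<Longrightarrow> ev u (eps_structure m x) d v \<longleftrightarrow> EpsStr (v m) (v x)"
proof -
  assume "m < d" "x < d"
  have *: "ev u (pair (the_var m)
          (pair (upair (pair (num 0) (the_var e)) (pair (num 0) (the_var e))) (num 0)) x) d' v'
     \<longleftrightarrow> v' x = pr (v' m) (pr (upr (pr (nn 0) (v' e)) (pr (nn 0) (v' e))) (nn 0))"
    if "m < d'" "x < d'" "e < d'" for d' v' e
    using that by (intro ev_den den_basic)
  show ?thesis using \<open>m < d\<close> \<open>x < d\<close> by (simp add: eps_structure_def EpsStr_def *)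
qed

lemma den_codes2:
  "den u A d v a \<Longrightarrow> den u B d v b \<Longrightarrow> den u (c_veq A B) d v (cveq a b)"
  "den u A d v a \<Longrightarrow> den u B d v b \<Longrightarrow> den u (c_vmem A B) d v (cvmem a b)"
  "den u A d v a \<Longrightarrow> den u (c_not A) d v (cnot a)"
  "den u A d v a \<Longrightarrow> den u B d v b \<Longrightarrow> den u (c_and A B) d v (cand a b)"
  "den u A d v a \<Longrightarrow> den u B d v b \<Longrightarrow> den u (c_iff A B) d v (ciff a b)"
  "den u A d v a \<Longrightarrow> den u B d v b \<Longrightarrow> den u (c_ex A B) d v (cex a b)"
  unfolding c_veq_def c_vmem_def c_not_def c_and_def c_iff_def c_ex_def
    cveq_def cvmem_def cnot_def cand_def ciff_def cex_def
  by (intro den_codes den_basic; assumption)+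

lemma den_quote: "den u (quote k p) d v (code k p)"
  by (induction p arbitrary: k) (simp_all add: den_codes den_codes2 den_num)

lemma ev_quote [simp]: "x < d \<Longrightarrow> ev u (quote k p x) d v \<longleftrightarrow> v x = code k p"
  by (rule ev_den[OF den_quote])

lemma ev_c_separation [simp]:
  "n < d \<Longrightarrow> p < d \<Longrightarrow> x < d \<Longrightarrow>
    ev u (c_separation (the_var n) (the_var p) x) d v \<longleftrightarrow> v x = csep (v n) (v p)"
  unfolding c_separation_def csep_def by (intro ev_den den_codes den_codes2 den_basic)

lemma ev_c_replacement [simp]:
  "n < d \<Longrightarrow> p < d \<Longrightarrow> x < d \<Longrightarrow>
    ev u (c_replacement (the_var n) (the_var p) x) d v \<longleftrightarrow> v x = crepl (v n) (v p)"
  unfolding c_replacement_def crepl_def by (intro ev_den den_codes den_codes2 den_basic)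

lemma ev_zfc_axiom [simp]: "x < d \<Longrightarrow> ev u (zfc_axiom x) d v \<longleftrightarrow> ZFAx (v x)"
  by (simp add: zfc_axiom_def ZFAx_def)

lemma ev_model [simp]: "x < d \<Longrightarrow> ev u (model x) d v \<longleftrightarrow> Model (v x)"
  by (simp add: model_def Model_def)

lemma ev_elementary_submodel [simp]:
  "x < d \<Longrightarrow> y < d \<Longrightarrow> ev u (elementary_submodel x y) d v \<longleftrightarrow> ElSub (v x) (v y)"
  by (simp add: elementary_submodel_def ElSub_def)

lemma ev_extendible [simp]: "x < d \<Longrightarrow> ev u (extendible x) d v \<longleftrightarrow> Extd (v x)"
  by (simp add: extendible_def Extd_def)

end

section \<open>Definable predicates\<close>

declare One_nat_def [simp del]

context set_universe
begin

text \<open>A free index of a formula is either an argument, looked up in \<open>e\<close>, or a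
  parameter fixed in advance. Several indices may stand for the same argument, which makes formulas
  easy to combine.\<close>

definition slot :: "(nat \<Rightarrow> nat + 'a) \<Rightarrow> (nat \<Rightarrow> 'a) \<Rightarrow> nat \<Rightarrow> 'a" where
  "slot g e i = (case g i of Inl k \<Rightarrow> e k | Inr c \<Rightarrow> c)"

text \<open>Definability with parameters, as a property of HOL predicates. Separation, induction and
  Vopenka's Principle can then be applied to predicates written in HOL, with closure rules in place
  of explicit formulas.\<close>

definition Dfn :: "((nat \<Rightarrow> 'a) \<Rightarrow> bool) \<Rightarrow> bool" where
  "Dfn P \<longleftrightarrow> (\<exists>p g. \<forall>e. P e \<longleftrightarrow> holds (\<epsilon>) UNIV (slot g e) p)"

definition Dfn_term :: "((nat \<Rightarrow> 'a) \<Rightarrow> 'a) \<Rightarrow> bool" where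
  "Dfn_term t \<longleftrightarrow> Dfn (\<lambda>e. e 0 = t (\<lambda>i. e (Suc i)))"

lemma DfnI: "(\<And>e. P e \<longleftrightarrow> holds (\<epsilon>) UNIV (slot g e) p) \<Longrightarrow> Dfn P"
  unfolding Dfn_def by blast

lemma Dfn_ev: "Dfn (\<lambda>e. ev u F d e)"
  by (rule DfnI[of _ "\<lambda>i. if i < d then Inl (d - Suc i) else Inr (u (i - d))" "F d"])
    (auto simp: tr_def level_env_def slot_def intro!: arg_cong2[where f = "holds (\<epsilon>) UNIV"])

lemma Dfn_imp:
  assumes "Dfn P" "Dfn Q"
  shows "Dfn (\<lambda>e. P e \<longrightarrow> Q e)"
proof -
  obtain p g q h where p: "\<And>e. P e \<longleftrightarrow> holds (\<epsilon>) UNIV (slot g e) p"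
    and q: "\<And>e. Q e \<longleftrightarrow> holds (\<epsilon>) UNIV (slot h e) q"
    using assms unfolding Dfn_def by blast
  \<comment> \<open>The two formulas come with unrelated tables of arguments and parameters: even
    indices are reserved for \<open>p\<close>, odd ones for \<open>q\<close>.\<close>
  let ?k = "\<lambda>i. if even i then g (i div 2) else h (i div 2)"
  show ?thesis
    by (rule DfnI[of _ ?k "Imp (rename (\<lambda>i. 2 * i) p) (rename (\<lambda>i. Suc (2 * i)) q)"])
      (simp add: p q holds_rename slot_def[abs_def])
qed

lemma Dfn_False: "Dfn (\<lambda>e. False)"
  by (rule DfnI[of _ undefined Bot]) simp

lemma Dfn_all:
  assumes "Dfn (\<lambda>e. P (e 0) (\<lambda>i. e (Suc i)))"
  shows "Dfn (\<lambda>e. \<forall>x. P x e)"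
proof -
  obtain p g where p: "\<And>e. P (e 0) (\<lambda>i. e (Suc i)) \<longleftrightarrow> holds (\<epsilon>) UNIV (slot g e) p"
    using assms unfolding Dfn_def by blast
  \<comment> \<open>All indices that stand for argument 0 become the newly bound variable. So the
    value of \<open>?g\<close> at such an index is never looked up.\<close>
  let ?f = "\<lambda>i. if g i = Inl 0 then 0 else Suc i"
  let ?g = "\<lambda>i. case g i of Inl k \<Rightarrow> Inl (k - 1) | Inr c \<Rightarrow> Inr c"
  have "(\<lambda>i. case_nat x (slot ?g e) (?f i)) = slot g (case_nat x e)" for x e
    by (auto simp: slot_def fun_eq_iff split: nat.split sum.split)
  moreover have "P x e \<longleftrightarrow> holds (\<epsilon>) UNIV (slot g (case_nat x e)) p" for x e
    using p[of "case_nat x e"] by simp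
  ultimately show ?thesis
    by (intro DfnI[of _ ?g "Forall (rename ?f p)"]) (simp add: holds_rename)
qed

lemma Dfn_map: "Dfn P \<Longrightarrow> Dfn (\<lambda>e. P (\<lambda>i. e (f i)))"
proof -
  assume "Dfn P"
  then obtain p g where p: "\<And>e. P e \<longleftrightarrow> holds (\<epsilon>) UNIV (slot g e) p"
    unfolding Dfn_def by blast
  have "slot g (\<lambda>i. e (f i)) = slot (\<lambda>i. case g i of Inl k \<Rightarrow> Inl (f k) | Inr c \<Rightarrow> Inr c) e" for e
    by (auto simp: slot_def fun_eq_iff split: sum.split)
  then show ?thesis by (intro DfnI) (simp add: p)
qed

lemma Dfn_not: "Dfn P \<Longrightarrow> Dfn (\<lambda>e. \<not> P e)"
  using Dfn_imp[OF _ Dfn_False] by simp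

lemma Dfn_conj: "Dfn P \<Longrightarrow> Dfn Q \<Longrightarrow> Dfn (\<lambda>e. P e \<and> Q e)"
  using Dfn_not[OF Dfn_imp[of P "\<lambda>e. \<not> Q e"]] Dfn_not by simp

lemma Dfn_disj: "Dfn P \<Longrightarrow> Dfn Q \<Longrightarrow> Dfn (\<lambda>e. P e \<or> Q e)"
  using Dfn_imp[of "\<lambda>e. \<not> P e" Q] Dfn_not by (simp add: disj_imp)

lemma Dfn_iff: "Dfn P \<Longrightarrow> Dfn Q \<Longrightarrow> Dfn (\<lambda>e. P e \<longleftrightarrow> Q e)"
  using Dfn_conj[OF Dfn_imp[of P Q] Dfn_imp[of Q P]] by (simp add: iff_conv_conj_imp)

lemma Dfn_ex: "Dfn (\<lambda>e. P (e 0) (\<lambda>i. e (Suc i))) \<Longrightarrow> Dfn (\<lambda>e. \<exists>x. P x e)"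
  using Dfn_not[OF Dfn_all[of "\<lambda>x e. \<not> P x e", OF Dfn_not]] by simp

lemma Dfn_const: "Dfn (\<lambda>e. b)"
  using Dfn_False Dfn_not[OF Dfn_False] by (cases b) simp_all

lemma Dfn_term_shift: "Dfn_term t \<Longrightarrow> Dfn_term (\<lambda>e. t (\<lambda>i. e (Suc i)))"
  unfolding Dfn_term_def
  by (drule Dfn_map[of _ "case_nat 0 (\<lambda>i. Suc (Suc i))"]) simp

lemma Dfn_subst1:
  assumes "Dfn (\<lambda>e. Q (e 0))" "Dfn_term t"
  shows "Dfn (\<lambda>e. Q (t e))"
proof -
  have "Dfn (\<lambda>e. \<exists>x. x = t e \<and> Q x)"
    using assms by (intro Dfn_ex Dfn_conj) (auto simp: Dfn_term_def)
  then show ?thesis by simp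
qed

lemma Dfn_subst2:
  assumes "Dfn (\<lambda>e. Q (e 0) (e 1))" "Dfn_term t" "Dfn_term s"
  shows "Dfn (\<lambda>e. Q (t e) (s e))"
proof -
  \<comment> \<open>The value of \<open>t\<close> is bound by the outer quantifier and that of
    \<open>s\<close> by the inner one, so they reach \<open>Q\<close> in reverse order.\<close>
  have "Dfn (\<lambda>e. Q (e 1) (e 0))"
    using Dfn_map[OF assms(1), of "\<lambda>i. 1 - i"] by (simp add: One_nat_def)
  then have "Dfn (\<lambda>e. \<exists>x. x = t e \<and> (\<exists>y. y = s e \<and> Q x y))"
    using assms(2) Dfn_term_shift[OF assms(3)]
    by (intro Dfn_ex Dfn_conj) (simp_all add: Dfn_term_def One_nat_def)
  then show ?thesis by simp
qed

lemma Dfn_subst3: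
  assumes "Dfn (\<lambda>e. Q (e 0) (e 1) (e 2))" "Dfn_term t" "Dfn_term s" "Dfn_term r"
  shows "Dfn (\<lambda>e. Q (t e) (s e) (r e))"
proof -
  have "Dfn (\<lambda>e. Q (e 2) (e 1) (e 0))"
    using Dfn_map[OF assms(1), of "\<lambda>i. 2 - i"] by (simp add: One_nat_def)
  then have "Dfn (\<lambda>e. \<exists>x. x = t e \<and> (\<exists>y. y = s e \<and> (\<exists>z. z = r e \<and> Q x y z)))"
    using assms(2) Dfn_term_shift[OF assms(3)] Dfn_term_shift[OF Dfn_term_shift[OF assms(4)]]
    by (intro Dfn_ex Dfn_conj) (simp_all add: Dfn_term_def One_nat_def numeral_2_eq_2)
  then show ?thesis by simp
qed

lemma Dfn_subst4:
  assumes "Dfn (\<lambda>e. Q (e 0) (e 1) (e 2) (e 3))" "Dfn_term t" "Dfn_term s" "Dfn_term r" "Dfn_term q"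
  shows "Dfn (\<lambda>e. Q (t e) (s e) (r e) (q e))"
proof -
  have "Dfn (\<lambda>e. Q (e 3) (e 2) (e 1) (e 0))"
    using Dfn_map[OF assms(1), of "\<lambda>i. 3 - i"] by (simp add: One_nat_def)
  then have "Dfn (\<lambda>e. \<exists>x. x = t e \<and> (\<exists>y. y = s e \<and> (\<exists>z. z = r e \<and> (\<exists>w. w = q e \<and> Q x y z w))))"
    using assms(2) Dfn_term_shift[OF assms(3)] Dfn_term_shift[OF Dfn_term_shift[OF assms(4)]]
      Dfn_term_shift[OF Dfn_term_shift[OF Dfn_term_shift[OF assms(5)]]]
    by (intro Dfn_ex Dfn_conj) (simp_all add: Dfn_term_def One_nat_def numeral_2_eq_2 numeral_3_eq_3)
  then show ?thesis by simp
qed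

lemma Dfn_term_var: "Dfn_term (\<lambda>e. e i)"
  unfolding Dfn_term_def
  by (rule DfnI[of _ "\<lambda>j. if j = 0 then Inl 0 else Inl (Suc i)" "Eq 0 1"]) (simp add: slot_def)

lemma Dfn_term_const: "Dfn_term (\<lambda>e. c)"
  unfolding Dfn_term_def
  by (rule DfnI[of _ "\<lambda>j. if j = 0 then Inl 0 else Inr c" "Eq 0 1"]) (simp add: slot_def)

lemma Dfn_mem: "Dfn_term t \<Longrightarrow> Dfn_term s \<Longrightarrow> Dfn (\<lambda>e. t e \<epsilon> s e)"
  by (rule Dfn_subst2) (auto intro: DfnI[of _ "Inl" "Mem 0 1"] simp: slot_def)

lemma Dfn_eq: "Dfn_term t \<Longrightarrow> Dfn_term s \<Longrightarrow> Dfn (\<lambda>e. t e = s e)"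
  by (rule Dfn_subst2) (auto intro: DfnI[of _ "Inl" "Eq 0 1"] simp: slot_def)

lemma Dfn_termI: "Dfn (\<lambda>e. e 0 = t (\<lambda>i. e (Suc i))) \<Longrightarrow> Dfn_term t"
  by (simp add: Dfn_term_def)

lemma Dfn_term_pr: "Dfn_term t \<Longrightarrow> Dfn_term s \<Longrightarrow> Dfn_term (\<lambda>e. pr (t e) (s e))"
  using Dfn_ev[of undefined "is_pair 1 2 0" 3]
  by - (rule Dfn_termI, rule Dfn_subst3[of "\<lambda>x y z. x = pr y z"], simp_all add: Dfn_term_var Dfn_term_shift)

lemma Dfn_term_upr: "Dfn_term t \<Longrightarrow> Dfn_term s \<Longrightarrow> Dfn_term (\<lambda>e. upr (t e) (s e))"
  using Dfn_ev[of undefined "is_upair 1 2 0" 3]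
  by - (rule Dfn_termI, rule Dfn_subst3[of "\<lambda>x y z. x = upr y z"], simp_all add: Dfn_term_var Dfn_term_shift)

lemma Dfn_term_sc: "Dfn_term t \<Longrightarrow> Dfn_term (\<lambda>e. sc (t e))"
  using Dfn_ev[of undefined "is_suc 1 0" 2]
  by - (rule Dfn_termI, rule Dfn_subst2[of "\<lambda>x y. x = sc y"], simp_all add: Dfn_term_var Dfn_term_shift)

lemmas Dfn_logic = Dfn_const Dfn_imp Dfn_conj Dfn_disj Dfn_not Dfn_iff Dfn_all Dfn_ex Dfn_mem Dfn_eq
  Dfn_term_var Dfn_term_const Dfn_term_pr Dfn_term_upr Dfn_term_sc

lemma Dfn_sub: "Dfn_term t \<Longrightarrow> Dfn_term s \<Longrightarrow> Dfn (\<lambda>e. sub (t e) (s e))"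
  using Dfn_ev[of undefined "subset 0 1" 2] by - (rule Dfn_subst2[of sub], simp_all)

lemma Dfn_Nat: "Dfn_term t \<Longrightarrow> Dfn (\<lambda>e. Nat (t e))"
  using Dfn_ev[of undefined "natural 0" 1] by - (rule Dfn_subst1[of Nat], simp_all)

lemma Dfn_Func: "Dfn_term t \<Longrightarrow> Dfn_term s \<Longrightarrow> Dfn_term r \<Longrightarrow> Dfn (\<lambda>e. Func (t e) (s e) (r e))"
  using Dfn_ev[of undefined "is_function 0 1 2" 3] by - (rule Dfn_subst3[of Func], simp_all)

lemma Dfn_TVal:
  "Dfn_term t \<Longrightarrow> Dfn_term s \<Longrightarrow> Dfn_term r \<Longrightarrow> Dfn_term q \<Longrightarrow> Dfn (\<lambda>e. TVal (t e) (s e) (r e) (q e))"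
  using Dfn_ev[of undefined "term_value 0 1 2 3" 4] by - (rule Dfn_subst4[of TVal], simp_all)

lemma Dfn_TVals:
  "Dfn_term t \<Longrightarrow> Dfn_term s \<Longrightarrow> Dfn_term r \<Longrightarrow> Dfn_term q \<Longrightarrow> Dfn (\<lambda>e. TVals (t e) (s e) (r e) (q e))"
  using Dfn_ev[of undefined "term_values 0 1 2 3" 4] by - (rule Dfn_subst4[of TVals], simp_all)

lemma Dfn_StrRel:
  "Dfn_term t \<Longrightarrow> Dfn_term s \<Longrightarrow> Dfn_term r \<Longrightarrow> Dfn (\<lambda>e. StrRel (t e) (s e) (r e))"
  using Dfn_ev[of undefined "struct_rel 0 1 2" 3] by - (rule Dfn_subst3[of StrRel], simp_all)

lemma Dfn_SatRel:
  "Dfn_term t \<Longrightarrow> Dfn_term s \<Longrightarrow> Dfn_term r \<Longrightarrow> Dfn_term q \<Longrightarrow> Dfn (\<lambda>e. SatRel (t e) (s e) (r e) (q e))"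
  using Dfn_ev[of undefined "sat_relation 0 1 2 3" 4] by - (rule Dfn_subst4[of SatRel], simp_all)

lemma Dfn_Sat:
  "Dfn_term t \<Longrightarrow> Dfn_term s \<Longrightarrow> Dfn_term r \<Longrightarrow> Dfn_term q \<Longrightarrow> Dfn (\<lambda>e. Sat (t e) (s e) (r e) (q e))"
  using Dfn_ev[of undefined "sat 0 1 2 3" 4] by - (rule Dfn_subst4[of Sat], simp_all)

lemma Dfn_EpsStr: "Dfn_term t \<Longrightarrow> Dfn_term s \<Longrightarrow> Dfn (\<lambda>e. EpsStr (t e) (s e))"
  using Dfn_ev[of undefined "eps_structure 0 1" 2] by - (rule Dfn_subst2[of EpsStr], simp_all)

lemma Dfn_Model: "Dfn_term t \<Longrightarrow> Dfn (\<lambda>e. Model (t e))"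
  using Dfn_ev[of undefined "model 0" 1] by - (rule Dfn_subst1[of Model], simp_all)

lemmas Dfn_intros = Dfn_logic Dfn_sub Dfn_Nat Dfn_Func Dfn_TVal Dfn_TVals Dfn_StrRel
  Dfn_SatRel Dfn_Sat Dfn_EpsStr Dfn_Model

text \<open>The form demanded by the schemata: index 0 is the argument and the others are
  parameters. Since the predicate depends on \<open>e 0\<close> alone, the remaining argument slots
  may be filled with any value.\<close>

lemma Dfn_formula:
  assumes "Dfn (\<lambda>e. P (e 0))"
  obtains n p v where "closed_at (Suc n) p" "\<And>x. P x \<longleftrightarrow> holds (\<epsilon>) UNIV (case_nat x v) p"
proof -
  obtain p g where p: "\<And>e. P (e 0) \<longleftrightarrow> holds (\<epsilon>) UNIV (slot g e) p"
    using assms unfolding Dfn_def by blast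
  let ?f = "\<lambda>i. if g i = Inl 0 then 0 else Suc i"
  let ?v = "\<lambda>i. case g i of Inl k \<Rightarrow> undefined | Inr c \<Rightarrow> c"
  have "(\<lambda>i. case_nat x ?v (?f i)) = slot g (case_nat x (\<lambda>i. undefined))" for x
    by (auto simp: slot_def fun_eq_iff split: nat.split sum.split)
  then have "P x \<longleftrightarrow> holds (\<epsilon>) UNIV (case_nat x ?v) (rename ?f p)" for x
    using p[of "case_nat x (\<lambda>i. undefined)"] by (simp add: holds_rename)
  moreover obtain n where "closed_at (Suc n) (rename ?f p)" using ex_closed_at by blast
  ultimately show ?thesis using that by blast
qed

section \<open>Numerals, codes and finite sets\<close>

lemma nn_mem_iff: "x \<epsilon> nn k \<longleftrightarrow> (\<exists>i<k. x = nn i)"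
  by (induction k) (auto simp: nn.simps less_Suc_eq)

text \<open>Foundation is not yet available, but for standard numerals induction in HOL suffices: if
  \<open>nn k\<close> were an element of itself, it would equal some \<open>nn i\<close> with
  \<open>i < k\<close>, which would then be an element of itself.\<close>

lemma nn_irrefl: "\<not> nn k \<epsilon> nn k"
proof (induction k rule: less_induct)
  case (less k)
  show ?case using less by (metis nn_mem_iff)
qed

lemma nn_eq_iff [simp]: "nn i = nn j \<longleftrightarrow> i = j"
  by (metis nn_irrefl nn_mem_iff nat_neq_iff)

lemma codes_distinct [simp]:
  "ceq t u \<noteq> crel r ts" "ceq t u \<noteq> cbot" "ceq t u \<noteq> cimp p q" "ceq t u \<noteq> call k p"
  "crel r ts \<noteq> ceq t u" "crel r ts \<noteq> cbot" "crel r ts \<noteq> cimp p q" "crel r ts \<noteq> call k p"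
  "cbot \<noteq> ceq t u" "cbot \<noteq> crel r ts" "cbot \<noteq> cimp p q" "cbot \<noteq> call k p"
  "cimp p q \<noteq> ceq t u" "cimp p q \<noteq> crel r ts" "cimp p q \<noteq> cbot" "cimp p q \<noteq> call k p'"
  "call k p \<noteq> ceq t u" "call k p \<noteq> crel r ts" "call k p \<noteq> cbot" "call k p \<noteq> cimp p' q"
  "cvar k \<noteq> capp f ts" "capp f ts \<noteq> cvar k"
  by (simp_all add: ceq_def crel_def cbot_def cimp_def call_def cvar_def capp_def)

lemma codes_inject [simp]:
  "ceq t u = ceq t' u' \<longleftrightarrow> t = t' \<and> u = u'"
  "crel r ts = crel r' ts' \<longleftrightarrow> r = r' \<and> ts = ts'"
  "cimp p q = cimp p' q' \<longleftrightarrow> p = p' \<and> q = q'"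
  "call k p = call k' p' \<longleftrightarrow> k = k' \<and> p = p'"
  "cvar k = cvar k' \<longleftrightarrow> k = k'"
  by (simp_all add: ceq_def crel_def cimp_def call_def cvar_def)

lemma ex_finite_set: "\<exists>s. \<forall>z. z \<epsilon> s \<longleftrightarrow> z \<in> set zs"
proof (induction zs)
  case Nil
  show ?case by (intro exI[of _ emp]) simp
next
  case (Cons a zs)
  then obtain s where "\<forall>z. z \<epsilon> s \<longleftrightarrow> z \<in> set zs" by blast
  then show ?case by (intro exI[of _ "un (upr s (upr a a))"]) auto
qed

end

section \<open>Separation and powerset from Vopenka's Principle\<close>

locale lzfc_vp = set_universe +
  assumes ex_prod: "\<exists>c. \<forall>z. z \<epsilon> c \<longleftrightarrow> (\<exists>x y. x \<epsilon> a \<and> y \<epsilon> b \<and> z = pr x y)"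
    and ex_omega: "\<exists>w. Om w"
    and delta0_separation: "delta0 p \<Longrightarrow> \<exists>b. \<forall>x. x \<epsilon> b \<longleftrightarrow> x \<epsilon> a \<and> holds E UNIV (case_nat x v) p"
    and ex_model: "\<exists>M. Model M \<and> x \<epsilon> M"
    and vopenka_principle: "Dfn (\<lambda>e. P (e 0)) \<Longrightarrow> Lang L \<Longrightarrow> (\<And>x. P x \<Longrightarrow> Struct L x) \<Longrightarrow>
      \<not> (\<exists>s. \<forall>x. x \<epsilon> s \<longleftrightarrow> P x) \<Longrightarrow> \<exists>x y j. P x \<and> P y \<and> x \<noteq> y \<and> Elem L x y j"
begin

definition prod :: "'a \<Rightarrow> 'a \<Rightarrow> 'a" where
  "prod a b = (THE c. \<forall>z. z \<epsilon> c \<longleftrightarrow> (\<exists>x y. x \<epsilon> a \<and> y \<epsilon> b \<and> z = pr x y))"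

lemma mem_prod [simp]: "z \<epsilon> prod a b \<longleftrightarrow> (\<exists>x y. x \<epsilon> a \<and> y \<epsilon> b \<and> z = pr x y)"
  unfolding prod_def by (rule the_set[OF ex_prod])

lemma Om_nn: "Om w \<Longrightarrow> nn k \<epsilon> w"
  by (induction k) (simp_all add: Om_def Ind_def nn.simps)

lemma Nat_nn: "Nat (nn k)"
  using ex_omega Om_nn unfolding Nat_def by blast

text \<open>The positions in a HOL list are standard, so its graph is a set by pairing and union.
  Concrete formulas can thus be given formation sequences as lists.\<close>

lemma Gen_list:
  assumes mono: "\<And>P Q y. step P y \<Longrightarrow> (\<And>z. P z \<Longrightarrow> Q z) \<Longrightarrow> step Q y"
    and "xs \<noteq> []" and step: "\<And>i. i < length xs \<Longrightarrow> step (\<lambda>z. z \<in> set (take i xs)) (xs ! i)"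
  shows "Gen step (last xs)"
proof -
  obtain s where "\<forall>z. z \<epsilon> s \<longleftrightarrow> z \<in> set (map (\<lambda>i. pr (nn i) (xs ! i)) [0..<length xs])"
    using ex_finite_set by blast
  then have s: "z \<epsilon> s \<longleftrightarrow> (\<exists>i<length xs. z = pr (nn i) (xs ! i))" for z by auto
  obtain m where m: "length xs = Suc m" using \<open>xs \<noteq> []\<close> by (cases xs) auto
  have k: "i \<epsilon> sc (nn m) \<longleftrightarrow> (\<exists>j<length xs. i = nn j)" for i
    using nn_mem_iff[of i "Suc m"] m by (simp add: nn.simps)
  show ?thesis
    unfolding Gen_def
  proof (intro exI conjI allI impI)
    show "Nat (nn m)" by (rule Nat_nn)
    show "FunOn (\<lambda>i. i \<epsilon> sc (nn m)) s" unfolding FunOn_def s k by auto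
    show "pr (nn m) (last xs) \<epsilon> s"
      using m \<open>xs \<noteq> []\<close> by (auto simp: s last_conv_nth)
    fix i y assume "pr i y \<epsilon> s"
    then obtain j where j: "j < length xs" "i = nn j" "y = xs ! j" by (auto simp: s)
    show "step (\<lambda>z. \<exists>j. j \<epsilon> i \<and> pr j z \<epsilon> s) y"
      unfolding j(3)
    proof (rule mono[OF step[OF j(1)]])
      fix z assume "z \<in> set (take j xs)"
      then obtain l where "l < j" "z = xs ! l" using j(1) by (auto simp: in_set_conv_nth)
      then have "nn l \<epsilon> i \<and> pr (nn l) z \<epsilon> s" using j by (auto simp: s nn_mem_iff)
      then show "\<exists>j. j \<epsilon> i \<and> pr j z \<epsilon> s" ..
    qed
  qed
qed

lemma Gen_base:
  assumes "\<And>P. step P x"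
  shows "Gen step x"
proof -
  \<comment> \<open>\<open>Gen_list\<close> asks for a monotone step. The constant one qualifies and
    supplies the sequence of length 1, whose entry is then justified by \<open>step\<close>
    itself.\<close>
  have "Gen (\<lambda>P y. y = x) (last [x])" by (rule Gen_list) auto
  then have "Gen (\<lambda>P y. y = x) x" by simp
  then obtain m s where "Nat m" "FunOn (\<lambda>i. i \<epsilon> sc m) s" "\<And>i y. pr i y \<epsilon> s \<Longrightarrow> y = x" "pr m x \<epsilon> s"
    unfolding Gen_def by blast
  then show ?thesis
    unfolding Gen_def using assms by (intro exI[of _ m] exI[of _ s] conjI allI impI) blast+
qed

lemma FunOn_elem: "FunOn D f \<Longrightarrow> p \<epsilon> f \<Longrightarrow> \<exists>x y. D x \<and> p = pr x y"
  unfolding FunOn_def by blast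

lemma FunOn_value: "FunOn D f \<Longrightarrow> D x \<Longrightarrow> \<exists>y. \<forall>z. pr x z \<epsilon> f \<longleftrightarrow> z = y"
  unfolding FunOn_def by blast

lemma FunOn_mem: "FunOn D f \<Longrightarrow> pr x y \<epsilon> f \<Longrightarrow> D x"
  using FunOn_elem[of D f "pr x y"] by auto

lemma FunOn_unique: "FunOn D f \<Longrightarrow> pr x y \<epsilon> f \<Longrightarrow> pr x z \<epsilon> f \<Longrightarrow> y = z"
  using FunOn_value[of D f x] FunOn_mem[of D f x y] by auto

lemma FunOn_dom: "FunOn D f \<Longrightarrow> D x \<longleftrightarrow> (\<exists>y. pr x y \<epsilon> f)"
  using FunOn_value[of D f x] FunOn_mem[of D f x] by auto

lemma FunOnI:
  assumes "\<And>p. p \<epsilon> f \<Longrightarrow> \<exists>x y. p = pr x y" "\<And>x. D x \<longleftrightarrow> (\<exists>y. pr x y \<epsilon> f)"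
    "\<And>x y z. pr x y \<epsilon> f \<Longrightarrow> pr x z \<epsilon> f \<Longrightarrow> y = z"
  shows "FunOn D f"
  unfolding FunOn_def
proof (intro conjI allI impI)
  show "\<exists>x y. D x \<and> p = pr x y" if "p \<epsilon> f" for p using that assms(1)[OF that] assms(2) by blast
  show "\<exists>y. \<forall>z. pr x z \<epsilon> f \<longleftrightarrow> z = y" if "D x" for x using that assms(2,3) by blast
qed

lemma FunOn_ext:
  assumes f: "FunOn D f" and g: "FunOn D g" and sub: "\<And>x y. pr x y \<epsilon> f \<Longrightarrow> pr x y \<epsilon> g"
  shows "f = g"
proof (rule extensional)
  fix z
  show "z \<epsilon> f \<longleftrightarrow> z \<epsilon> g"
  proof
    assume "z \<epsilon> f"
    then obtain x y where "z = pr x y" using FunOn_elem[OF f] by blast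
    then show "z \<epsilon> g" using \<open>z \<epsilon> f\<close> sub by simp
  next
    assume "z \<epsilon> g"
    then obtain x y where xy: "D x" "z = pr x y" using FunOn_elem[OF g] by blast
    then obtain y' where y': "pr x y' \<epsilon> f" using FunOn_dom[OF f] by blast
    then have "y' = y" using FunOn_unique[OF g sub[OF y']] xy(2) \<open>z \<epsilon> g\<close> by simp
    then show "z \<epsilon> f" using y' xy by simp
  qed
qed

text \<open>The ordered pair as a function on 2, which is the form of assignments to two variables
  and of argument tuples of binary relations. It differs from the Kuratowski pair
  \<open>pr\<close>.\<close>

definition tup :: "'a \<Rightarrow> 'a \<Rightarrow> 'a" where "tup x y = upr (pr (nn 0) x) (pr (nn 1) y)"

lemma mem_tup: "pr i z \<epsilon> tup x y \<longleftrightarrow> i = nn 0 \<and> z = x \<or> i = nn 1 \<and> z = y"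
  by (auto simp: tup_def)

lemma mem_nn2: "i \<epsilon> nn 2 \<longleftrightarrow> i = nn 0 \<or> i = nn 1"
  by (auto simp: nn_mem_iff less_2_cases_iff)

lemma tup_eq_iff [simp]: "tup x y = tup x' y' \<longleftrightarrow> x = x' \<and> y = y'"
  by (auto simp: tup_def upr_eq_iff)

lemma FunOn_tup: "FunOn (\<lambda>i. i \<epsilon> nn 2) (tup x y)"
  unfolding FunOn_def mem_nn2 mem_tup by (auto simp: tup_def)

lemma Func_tup: "Func (tup x y) (nn 2) A \<longleftrightarrow> x \<epsilon> A \<and> y \<epsilon> A"
  unfolding Func_def using FunOn_tup by (auto simp: mem_tup)

lemma FunOn_2E:
  assumes "FunOn (\<lambda>i. i \<epsilon> nn 2) a"
  obtains x y where "a = tup x y"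
proof -
  obtain x y where "pr (nn 0) x \<epsilon> a" "pr (nn 1) y \<epsilon> a"
    using assms FunOn_dom[OF assms] mem_nn2 by metis
  then have "tup x y = a" using FunOn_ext[OF FunOn_tup assms] by (auto simp: mem_tup)
  then show ?thesis using that by blast
qed

lemma cvmem_eq: "cvmem k l = crel (nn 0) (tup (cvar k) (cvar l))"
  by (simp add: cvmem_def tup_def)

lemma StrDom_iff [simp]: "StrDom (pr A (pr I J)) B \<longleftrightarrow> B = A"
  by (auto simp: StrDom_def)

lemma StrRel_iff [simp]: "StrRel (pr A (pr I J)) r e \<longleftrightarrow> pr r e \<epsilon> I"
  by (auto simp: StrRel_def)

lemma StrFun_iff [simp]: "StrFun (pr A (pr I J)) f h \<longleftrightarrow> pr f h \<epsilon> J"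
  by (auto simp: StrFun_def)

lemma TVal_cvar: "TVal (pr A (pr I emp)) a (cvar k) b \<longleftrightarrow> pr k b \<epsilon> a"
proof
  assume "pr k b \<epsilon> a"
  then have "PEval (pr A (pr I emp)) a (upr (pr (cvar k) b) (pr (cvar k) b))"
    by (simp add: PEval_def)
  then show "TVal (pr A (pr I emp)) a (cvar k) b" unfolding TVal_def by force
next
  assume "TVal (pr A (pr I emp)) a (cvar k) b"
  then obtain g where g: "PEval (pr A (pr I emp)) a g" "pr (cvar k) b \<epsilon> g" unfolding TVal_def by blast
  then show "pr k b \<epsilon> a" using g(1)[unfolded PEval_def, rule_format, OF g(2)] by auto
qed

lemma TVals_tup:
  assumes "FunOn (\<lambda>i. i \<epsilon> n) a" "k \<epsilon> n" "l \<epsilon> n"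
  shows "TVals (pr A (pr I emp)) a (tup (cvar k) (cvar l)) bs \<longleftrightarrow>
    (\<exists>x y. pr k x \<epsilon> a \<and> pr l y \<epsilon> a \<and> bs = tup x y)"
proof -
  have dom: "(\<exists>u. pr i u \<epsilon> tup t t') \<longleftrightarrow> i \<epsilon> nn 2" for i t t' by (auto simp: mem_tup mem_nn2)
  show ?thesis
  proof
    assume *: "TVals (pr A (pr I emp)) a (tup (cvar k) (cvar l)) bs"
    then obtain x y where "bs = tup x y" unfolding TVals_def dom by (auto elim: FunOn_2E)
    moreover have "TVal (pr A (pr I emp)) a t b" if "pr i t \<epsilon> tup (cvar k) (cvar l)" "pr i b \<epsilon> bs" for i t b
      using * that unfolding TVals_def by blast
    from this[of "nn 0" "cvar k" x] this[of "nn 1" "cvar l" y] \<open>bs = tup x y\<close>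
    have "TVal (pr A (pr I emp)) a (cvar k) x" "TVal (pr A (pr I emp)) a (cvar l) y"
      by (simp_all add: mem_tup)
    ultimately show "\<exists>x y. pr k x \<epsilon> a \<and> pr l y \<epsilon> a \<and> bs = tup x y"
      unfolding TVal_cvar by blast
  qed (unfold TVals_def dom, auto simp: FunOn_tup mem_tup TVal_cvar)
qed

text \<open>All structures given to Vopenka's Principle have binary relations indexed by
  \<open>R\<close> and no functions. Their terms are variables, so that evaluation of terms is
  lookup in the assignment.\<close>

definition rel_structure :: "'a \<Rightarrow> 'a \<Rightarrow> 'a \<Rightarrow> bool" where
  "rel_structure R A I \<longleftrightarrow> (\<exists>x. x \<epsilon> A) \<and> FunOn (\<lambda>r. r \<epsilon> R) I \<and>
     (\<forall>r e s. pr r e \<epsilon> I \<longrightarrow> s \<epsilon> e \<longrightarrow> Func s (nn 2) A)"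

definition rel_lang :: "'a \<Rightarrow> 'a" where "rel_lang R = pr (prod R (upr (nn 2) (nn 2))) emp"

lemma RelSym_rel_lang: "RelSym (rel_lang R) r m \<longleftrightarrow> r \<epsilon> R \<and> m = nn 2"
  by (auto simp: RelSym_def rel_lang_def)

lemma FunSym_rel_lang: "\<not> FunSym (rel_lang R) r m"
  by (auto simp: FunSym_def rel_lang_def)

lemma Lang_rel_lang: "Lang (rel_lang R)"
proof -
  obtain w where w: "Om w" using ex_omega by blast
  have "Func (prod R (upr (nn 2) (nn 2))) R w" "Func emp emp w"
    using Om_nn[OF w] by (auto simp: Func_def FunOn_def)
  then show ?thesis using w unfolding Lang_def rel_lang_def by blast
qed

lemma Struct_rel_lang: "rel_structure R A I \<Longrightarrow> Struct (rel_lang R) (pr A (pr I emp))"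
  unfolding Struct_def RelSym_rel_lang
  by (intro exI[of _ A] exI[of _ I] exI[of _ emp])
    (auto simp: rel_structure_def FunSym_rel_lang FunOn_def)

lemma epsL_eq: "epsL = rel_lang (upr (nn 0) (nn 0))"
proof -
  have "prod (upr (nn 0) (nn 0)) (upr (nn 2) (nn 2)) = upr (pr (nn 0) (nn 2)) (pr (nn 0) (nn 2))"
    by (rule extensional) auto
  then show ?thesis by (simp add: epsL_def rel_lang_def nn.simps(1))
qed

lemma Gen_last: "Gen step x \<Longrightarrow> \<exists>P. step P x"
  unfolding Gen_def by blast

lemma Term_rel_lang: "Term (rel_lang R) n t \<longleftrightarrow> (\<exists>k. k \<epsilon> n \<and> t = cvar k)"
proof
  assume "Term (rel_lang R) n t"
  then show "\<exists>k. k \<epsilon> n \<and> t = cvar k"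
    unfolding Term_def by (auto dest: Gen_last simp: term_step_def FunSym_rel_lang)
next
  assume "\<exists>k. k \<epsilon> n \<and> t = cvar k"
  then show "Term (rel_lang R) n t"
    unfolding Term_def by (intro Gen_base) (auto simp: term_step_def)
qed

lemma Form_crel: "r \<epsilon> R \<Longrightarrow> k \<epsilon> n \<Longrightarrow> l \<epsilon> n \<Longrightarrow> Form (rel_lang R) n (crel r (tup (cvar k) (cvar l)))"
  unfolding Form_def
proof (rule Gen_base)
  fix P assume "r \<epsilon> R" "k \<epsilon> n" "l \<epsilon> n"
  then have "RelSym (rel_lang R) r (nn 2) \<and> FunOn (\<lambda>i. i \<epsilon> nn 2) (tup (cvar k) (cvar l)) \<and>
      (\<forall>i u. pr i u \<epsilon> tup (cvar k) (cvar l) \<longrightarrow> Term (rel_lang R) n u)"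
    by (auto simp: RelSym_rel_lang FunOn_tup mem_tup Term_rel_lang)
  then show "form_step (rel_lang R) n P (crel r (tup (cvar k) (cvar l)))"
    unfolding form_step_def by blast
qed

text \<open>Full separation is not yet available, so the satisfaction relation has to come from
  pairing and products: the set of formulas is the singleton of \<open>p\<close>, and the relation
  is its product with the interpretation \<open>e\<close>.\<close>

lemma Sat_atomic:
  assumes X: "X = pr A (pr I emp)" and I: "FunOn D I" "pr r e \<epsilon> I" and xy: "x \<epsilon> A" "y \<epsilon> A"
  defines "p \<equiv> crel r (tup (cvar (nn 0)) (cvar (nn 1)))"
  shows "Sat X (nn 2) p (tup x y) \<longleftrightarrow> tup x y \<epsilon> e"
proof -
  have val: "TVals X a (tup (cvar (nn 0)) (cvar (nn 1))) bs \<longleftrightarrow> bs = a"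
    if "Func a (nn 2) A" for a bs
  proof -
    have "FunOn (\<lambda>i. i \<epsilon> nn 2) a" using that by (simp add: Func_def)
    moreover from this obtain x y where "a = tup x y" by (rule FunOn_2E)
    ultimately show ?thesis unfolding X by (subst TVals_tup[of "nn 2"]) (auto simp: mem_nn2 mem_tup)
  qed
  have rel: "StrRel X r e' \<longleftrightarrow> e' = e" for e' using I X FunOn_unique by auto
  have xy': "Func (tup x y) (nn 2) A" using xy by (simp add: Func_tup)
  show ?thesis
  proof
    assume "Sat X (nn 2) p (tup x y)"
    then obtain D S where "SatRel X (nn 2) D S" "p \<epsilon> D" "pr p (tup x y) \<epsilon> S"
      unfolding Sat_def by blast
    then have "\<exists>e bs. StrRel X r e \<and> TVals X (tup x y) (tup (cvar (nn 0)) (cvar (nn 1))) bs \<and> bs \<epsilon> e"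
      using xy' unfolding SatRel_def p_def X StrDom_iff by blast
    then show "tup x y \<epsilon> e" using val[OF xy'] rel by auto
  next
    assume e: "tup x y \<epsilon> e"
    have "SatRel X (nn 2) (upr p p) (prod (upr p p) e)"
      unfolding SatRel_def by (intro exI[of _ A]) (auto simp: val[unfolded X] rel[unfolded X StrRel_iff] p_def X)
    then show "Sat X (nn 2) p (tup x y)" using e unfolding Sat_def by force
  qed
qed

text \<open>Elementarity is applied to the formulas \<open>r(v0,v1)\<close>. Whatever else an
  embedding should preserve can be built into the structures as a further relation.\<close>

lemma vopenka_rel:
  assumes "Dfn (\<lambda>e. P (e 0))" and str: "\<And>X. P X \<Longrightarrow> \<exists>A I. X = pr A (pr I emp) \<and> rel_structure R A I"
    and "\<not> (\<exists>s. \<forall>X. X \<epsilon> s \<longleftrightarrow> P X)"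
  obtains A I B J j where "P (pr A (pr I emp))" "P (pr B (pr J emp))" "pr A (pr I emp) \<noteq> pr B (pr J emp)"
    "Func j A B"
    "\<forall>r e e' x y x' y'. pr r e \<epsilon> I \<and> pr r e' \<epsilon> J \<and> pr x x' \<epsilon> j \<and> pr y y' \<epsilon> j \<longrightarrow>
      (tup x y \<epsilon> e \<longleftrightarrow> tup x' y' \<epsilon> e')"
proof -
  obtain X Y j where XY: "P X" "P Y" "X \<noteq> Y" "Elem (rel_lang R) X Y j"
    using vopenka_principle[OF assms(1) Lang_rel_lang[of R]] assms(3) str Struct_rel_lang by metis
  obtain A I B J where AI: "X = pr A (pr I emp)" "rel_structure R A I"
    "Y = pr B (pr J emp)" "rel_structure R B J"
    using str XY by metis
  have j: "Func j A B" and el: "\<And>n p a b. Nat n \<Longrightarrow> Form (rel_lang R) n p \<Longrightarrow> Func a n A \<Longrightarrow> Comp j a b \<Longrightarrow>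
      Sat X n p a \<longleftrightarrow> Sat Y n p b"
    using XY(4) unfolding Elem_def AI(1,3) StrDom_iff by blast+
  have "tup x y \<epsilon> e \<longleftrightarrow> tup x' y' \<epsilon> e'"
    if r: "pr r e \<epsilon> I" "pr r e' \<epsilon> J" and x: "pr x x' \<epsilon> j" "pr y y' \<epsilon> j" for r e e' x y x' y'
  proof -
    let ?p = "crel r (tup (cvar (nn 0)) (cvar (nn 1)))"
    have in_dom: "x \<epsilon> A" "y \<epsilon> A" "x' \<epsilon> B" "y' \<epsilon> B"
      using j x FunOn_dom[of "\<lambda>x. x \<epsilon> A" j] unfolding Func_def by blast+
    have "(\<exists>u. pr i u \<epsilon> tup x y) \<longleftrightarrow> i \<epsilon> nn 2" for i by (auto simp: mem_tup mem_nn2)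
    then have "Comp j (tup x y) (tup x' y')"
      using x by (auto simp: Comp_def FunOn_tup mem_tup)
    moreover have "Form (rel_lang R) (nn 2) ?p"
      using r AI(2) FunOn_dom by (intro Form_crel) (auto simp: rel_structure_def mem_nn2)
    ultimately have "Sat X (nn 2) ?p (tup x y) \<longleftrightarrow> Sat Y (nn 2) ?p (tup x' y')"
      using in_dom by (intro el) (simp_all add: Nat_nn Func_tup)
    then show ?thesis
      using Sat_atomic[OF AI(1) _ r(1) in_dom(1,2)] Sat_atomic[OF AI(3) _ r(2) in_dom(3,4)] AI(2,4)
      unfolding rel_structure_def by blast
  qed
  then show ?thesis by (intro that[of A I B J j]) (use XY AI j in auto)
qed

lemma ex_structure_relations:
  "\<exists>I. \<forall>q. q \<epsilon> I \<longleftrightarrow> (\<exists>r e. r \<epsilon> a \<and> q = pr r e \<and> (r \<epsilon> z \<and> e = c \<or> \<not> r \<epsilon> z \<and> e = emp))"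
proof -
  \<comment> \<open>The symbols inside and outside \<open>z\<close> are separated by an atomic
    formula with parameter \<open>z\<close> and by its negation. The interpretation is then a union
    of two products.\<close>
  have "delta0 (Mem 0 1)" "delta0 (Imp (Mem 0 1) Bot)" by (intro delta0.intros)+
  from delta0_separation[OF this(1), of a "\<lambda>_. z"] delta0_separation[OF this(2), of a "\<lambda>_. z"]
  obtain b b' where "\<forall>x. x \<epsilon> b \<longleftrightarrow> x \<epsilon> a \<and> x \<epsilon> z" "\<forall>x. x \<epsilon> b' \<longleftrightarrow> x \<epsilon> a \<and> \<not> x \<epsilon> z"
    by (auto simp: One_nat_def)
  then show ?thesis
    by (intro exI[of _ "un (upr (prod b (upr c c)) (prod b' (upr emp emp)))"]) auto
qed

text \<open>Each subset \<open>z\<close> of \<open>a\<close> is coded by a structure on the singleton of its image, in which the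
  relation with symbol \<open>r \<in> a\<close> is full if \<open>r \<in> z\<close> and empty otherwise. An elementary embedding between
  two such structures preserves \<open>z\<close>, hence these structures do not form a proper class.\<close>

lemma subset_replacement:
  assumes \<phi>: "Dfn (\<lambda>e. \<phi> (e 0) (e 1))" and func: "\<And>z y y'. \<phi> z y \<Longrightarrow> \<phi> z y' \<Longrightarrow> y = y'"
  obtains s where "\<And>y. y \<epsilon> s \<longleftrightarrow> (\<exists>z. sub z a \<and> \<phi> z y)"
proof -
  define rels where "rels y z I \<longleftrightarrow> (\<forall>q. q \<epsilon> I \<longleftrightarrow> (\<exists>r e. r \<epsilon> a \<and> q = pr r e \<and>
      (r \<epsilon> z \<and> e = upr (tup y y) (tup y y) \<or> \<not> r \<epsilon> z \<and> e = emp)))" for y z I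
  define P where "P X \<longleftrightarrow> (\<exists>z y I. sub z a \<and> \<phi> z y \<and> rels y z I \<and> X = pr (upr y y) (pr I emp))" for X
  have rels_iff: "pr r e \<epsilon> I \<longleftrightarrow> r \<epsilon> a \<and> (r \<epsilon> z \<and> e = upr (tup y y) (tup y y) \<or> \<not> r \<epsilon> z \<and> e = emp)"
    if "rels y z I" for y z I r e
    using that unfolding rels_def by auto
  have rels_str: "rel_structure a (upr y y) I" if "rels y z I" for y z I
  proof -
    have "FunOn (\<lambda>r. r \<epsilon> a) I"
    proof (rule FunOnI)
      show "\<exists>x y. p = pr x y" if "p \<epsilon> I" for p using \<open>rels y z I\<close> that unfolding rels_def by blast
    qed (auto simp: rels_iff[OF that])
    then show ?thesis by (auto simp: rel_structure_def rels_iff[OF that] Func_tup)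
  qed
  have "\<exists>s. \<forall>X. X \<epsilon> s \<longleftrightarrow> P X"
  proof (rule ccontr)
    assume not_set: "\<not> (\<exists>s. \<forall>X. X \<epsilon> s \<longleftrightarrow> P X)"
    have "Dfn (\<lambda>e. \<phi> (e i) (e j))" for i j
      using \<phi> by (rule Dfn_subst2[of \<phi>]) (rule Dfn_term_var)+
    then have P: "Dfn (\<lambda>e. P (e 0))"
      unfolding P_def rels_def tup_def by (intro Dfn_intros)
    have str: "\<exists>A I. X = pr A (pr I emp) \<and> rel_structure a A I" if "P X" for X
      using that rels_str unfolding P_def by blast
    obtain A I B J j where *: "P (pr A (pr I emp))" "P (pr B (pr J emp))" "pr A (pr I emp) \<noteq> pr B (pr J emp)"
      "Func j A B"
      "\<forall>r e e' x y x' y'. pr r e \<epsilon> I \<and> pr r e' \<epsilon> J \<and> pr x x' \<epsilon> j \<and> pr y y' \<epsilon> j \<longrightarrow>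
        (tup x y \<epsilon> e \<longleftrightarrow> tup x' y' \<epsilon> e')"
      by (rule vopenka_rel[OF P str not_set])
    from *(1) obtain z y where z: "sub z a" "\<phi> z y" "rels y z I" "A = upr y y" unfolding P_def by auto
    from *(2) obtain z' y' where z': "sub z' a" "\<phi> z' y'" "rels y' z' J" "B = upr y' y'"
      unfolding P_def by auto
    have "\<exists>x. pr y x \<epsilon> j" using *(4) z(4) FunOn_dom[of "\<lambda>x. x \<epsilon> A" j y] by (simp add: Func_def)
    then have j: "pr y y' \<epsilon> j" using *(4) z'(4) by (auto simp: Func_def)
    have "r \<epsilon> z \<longleftrightarrow> r \<epsilon> z'" if "r \<epsilon> a" for r
    proof -
      define e where "e = (if r \<epsilon> z then upr (tup y y) (tup y y) else emp)"
      define e' where "e' = (if r \<epsilon> z' then upr (tup y' y') (tup y' y') else emp)"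
      have e: "pr r e \<epsilon> I" "pr r e' \<epsilon> J"
        using that by (simp_all add: rels_iff[OF z(3)] rels_iff[OF z'(3)] e_def e'_def)
      have "tup y y \<epsilon> e \<longleftrightarrow> r \<epsilon> z" "tup y' y' \<epsilon> e' \<longleftrightarrow> r \<epsilon> z'" by (simp_all add: e_def e'_def)
      then show ?thesis using *(5)[rule_format, of r e e' y y' y y'] e j by simp
    qed
    then have "z = z'" using z(1) z'(1) by (intro extensional) (auto simp: sub_def)
    \<comment> \<open>Functionality makes the whole structure depend on \<open>z\<close> alone, so
      the two structures would be equal.\<close>
    moreover from this have "y = y'" using func z(2) z'(2) by blast
    moreover have "I = J" if "z = z'" "y = y'"
      using z(3) z'(3) that unfolding rels_def by (intro extensional) simp
    ultimately show False using *(3) z(4) z'(4) by simp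
  qed
  then obtain s where s: "\<And>X. X \<epsilon> s \<longleftrightarrow> P X" by blast
  \<comment> \<open>The first component of a Kuratowski pair is the common element of all members of
    the pair; here it is the singleton of \<open>y\<close>. So \<open>?p\<close> says: for some
    \<open>X\<close> in \<open>s\<close> and some \<open>A\<close> in \<open>?W\<close>,
    \<open>A\<close> belongs to every member of \<open>X\<close> and \<open>y\<close> to
    \<open>A\<close>. Index 0 is \<open>y\<close>, index 1 is \<open>s\<close>, and the higher ones
    are \<open>?W\<close>; the bound \<open>un ?W\<close> replaces an appeal to replacement.\<close>
  let ?W = "un (un s)"
  let ?p = "Imp (Forall (Imp (Mem 0 (Suc 1)) (Imp
      (Imp (Forall (Imp (Mem 0 (Suc 3)) (Imp
        (Imp (Imp (Forall (Imp (Mem 0 (Suc 1)) (Mem 1 0))) (Imp (Mem 2 0) Bot)) Bot) Bot))) Bot) Bot))) Bot"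
  have "delta0 ?p" by (intro delta0.intros)
  from delta0_separation[OF this, of "un ?W" "case_nat s (\<lambda>_. ?W)"]
  obtain b where b: "\<And>y. y \<epsilon> b \<longleftrightarrow> y \<epsilon> un ?W \<and> (\<exists>X. X \<epsilon> s \<and> (\<exists>A. A \<epsilon> ?W \<and> (\<forall>u. u \<epsilon> X \<longrightarrow> A \<epsilon> u) \<and> y \<epsilon> A))"
    by (auto simp: One_nat_def numeral_2_eq_2 numeral_3_eq_3)
  have "y \<epsilon> b \<longleftrightarrow> (\<exists>z. sub z a \<and> \<phi> z y)" for y
  proof
    assume "y \<epsilon> b"
    then obtain X A where X: "P X" "\<forall>u. u \<epsilon> X \<longrightarrow> A \<epsilon> u" "y \<epsilon> A" using b s by blast
    from X(1) obtain z y' I where z: "sub z a" "\<phi> z y'" "X = pr (upr y' y') (pr I emp)" unfolding P_def by blast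
    then have "A = upr y' y'" using X(2) by (simp add: pr_def)
    then show "\<exists>z. sub z a \<and> \<phi> z y" using X(3) z by auto
  next
    assume "\<exists>z. sub z a \<and> \<phi> z y"
    then obtain z where z: "sub z a" "\<phi> z y" by blast
    obtain I where "rels y z I" using ex_structure_relations unfolding rels_def by blast
    then have X: "pr (upr y y) (pr I emp) \<epsilon> s" using s z unfolding P_def by blast
    moreover have "upr (upr y y) (upr y y) \<epsilon> pr (upr y y) (pr I emp)"
      by (simp add: pr_def[of "upr y y"])
    ultimately have W: "upr y y \<epsilon> ?W" by auto
    have "u \<epsilon> pr (upr y y) (pr I emp) \<Longrightarrow> upr y y \<epsilon> u" for u by (auto simp: pr_def[of "upr y y"])
    moreover have "y \<epsilon> upr y y" by simp
    ultimately show "y \<epsilon> b" unfolding b mem_un[of _ ?W] using X W by blast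
  qed
  then show ?thesis by (rule that)
qed

text \<open>The partial map that sends the singleton of \<open>y\<close> to \<open>y\<close>,
  defined if \<open>P y\<close>, has the desired set as its image on the subsets of
  \<open>a\<close>.\<close>

lemma ex_separation:
  assumes "Dfn (\<lambda>e. P (e 0))"
  shows "\<exists>b. \<forall>x. x \<epsilon> b \<longleftrightarrow> x \<epsilon> a \<and> P x"
proof -
  have P: "Dfn (\<lambda>e. P (e i))" for i using assms by (rule Dfn_subst1) (rule Dfn_term_var)
  have "Dfn (\<lambda>e. e 0 = upr (e 1) (e 1) \<and> P (e 1))" by (intro Dfn_intros P)
  from subset_replacement[OF this, of a] obtain s
    where "\<And>y. y \<epsilon> s \<longleftrightarrow> (\<exists>z. sub z a \<and> z = upr y y \<and> P y)"
    by (auto simp: upr_eq_iff)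
  then show ?thesis by (intro exI[of _ s]) (auto simp: sub_def)
qed

definition Collect_in :: "'a \<Rightarrow> ('a \<Rightarrow> bool) \<Rightarrow> 'a" where
  "Collect_in a P = (THE b. \<forall>x. x \<epsilon> b \<longleftrightarrow> x \<epsilon> a \<and> P x)"

lemma mem_Collect_in: "Dfn (\<lambda>e. P (e 0)) \<Longrightarrow> x \<epsilon> Collect_in a P \<longleftrightarrow> x \<epsilon> a \<and> P x"
  unfolding Collect_in_def by (rule the_set[OF ex_separation])

text \<open>The image of the subsets of \<open>a\<close> under the identity.\<close>

lemma ex_powerset: "\<exists>b. \<forall>x. x \<epsilon> b \<longleftrightarrow> sub x a"
proof -
  have "Dfn (\<lambda>e. e 0 = e 1)" by (intro Dfn_intros)
  from subset_replacement[OF this, of a] show ?thesis by auto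
qed

definition pow :: "'a \<Rightarrow> 'a" where
  "pow a = (THE b. \<forall>x. x \<epsilon> b \<longleftrightarrow> sub x a)"

lemma mem_pow [simp]: "x \<epsilon> pow a \<longleftrightarrow> sub x a"
  unfolding pow_def by (rule the_set[OF ex_powerset])

end

section \<open>Natural numbers and generated sets of codes\<close>

context lzfc_vp
begin

lemma Dfn_apply_var: "Dfn (\<lambda>e. P (e 0)) \<Longrightarrow> Dfn (\<lambda>e. P (e i))"
  by (erule Dfn_subst1[of P]) (rule Dfn_term_var)

text \<open>The natural numbers of the universe may be nonstandard, where induction in HOL does not
  reach. Separation from \<omega> gives induction for definable predicates.\<close>

lemma Nat_induct [consumes 2, case_names zero suc]:
  assumes P: "Dfn (\<lambda>e. P (e 0))" and n: "Nat n"
    and zero: "P (nn 0)" and suc: "\<And>m. Nat m \<Longrightarrow> P m \<Longrightarrow> P (sc m)"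
  shows "P n"
proof -
  obtain w where w: "Om w" "n \<epsilon> w" using n unfolding Nat_def by blast
  have "Ind (Collect_in w P)"
    using w(1) zero suc unfolding Ind_def mem_Collect_in[OF P]
    by (auto simp: Om_def Ind_def nn.simps Nat_def)
  then have "sub w (Collect_in w P)" using w(1) by (simp add: Om_def)
  then show ?thesis using w(2) by (simp add: sub_def mem_Collect_in[OF P])
qed

text \<open>Proved in one induction, because irreflexivity at \<open>sc m\<close> rests on
  transitivity of \<open>m\<close>: from \<open>sc m\<close> in \<open>m\<close> it would follow
  that \<open>m\<close> is in \<open>m\<close>.\<close>

lemma Nat_trans_irrefl:
  assumes "Nat n"
  shows "(\<forall>m. m \<epsilon> n \<longrightarrow> Nat m \<and> sub m n) \<and> \<not> n \<epsilon> n"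
  using _ assms
proof (rule Nat_induct)
  show "Dfn (\<lambda>e. (\<forall>m. m \<epsilon> e 0 \<longrightarrow> Nat m \<and> sub m (e 0)) \<and> \<not> e 0 \<epsilon> e 0)"
    by (intro Dfn_intros)
next
  fix m assume m: "Nat m" "(\<forall>i. i \<epsilon> m \<longrightarrow> Nat i \<and> sub i m) \<and> \<not> m \<epsilon> m"
  have "\<not> sc m \<epsilon> m"
  proof
    assume "sc m \<epsilon> m"
    then have "sub (sc m) m" using m(2) by blast
    then show False using m(2) by (simp add: sub_def)
  qed
  moreover have "m \<epsilon> sc m" by simp
  then have "sc m \<noteq> m" using m(2) by metis
  moreover have "Nat i \<and> sub i (sc m)" if "i \<epsilon> sc m" for i
  proof (cases "i = m")
    case False
    then have "Nat i" "sub i m" using that m(2) by simp_all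
    then show ?thesis by (simp add: sub_def)
  qed (use m(1) in \<open>simp add: sub_def\<close>)
  ultimately show "(\<forall>i. i \<epsilon> sc m \<longrightarrow> Nat i \<and> sub i (sc m)) \<and> \<not> sc m \<epsilon> sc m" by simp
qed (simp add: nn.simps)

lemma Nat_mem: "Nat n \<Longrightarrow> m \<epsilon> n \<Longrightarrow> Nat m"
  and Nat_mem_sub: "Nat n \<Longrightarrow> m \<epsilon> n \<Longrightarrow> sub m n"
  using Nat_trans_irrefl by blast+

lemma Nat_sc: "Nat n \<Longrightarrow> Nat (sc n)"
  unfolding Nat_def Om_def Ind_def by blast

lemma Nat_less_induct [consumes 2, case_names less]:
  assumes P: "Dfn (\<lambda>e. P (e 0))" and n: "Nat n"
    and less: "\<And>m. Nat m \<Longrightarrow> (\<And>j. j \<epsilon> m \<Longrightarrow> P j) \<Longrightarrow> P m"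
  shows "P n"
proof -
  have "Dfn (\<lambda>e. \<forall>j. j \<epsilon> e 0 \<longrightarrow> P j)" by (intro Dfn_intros Dfn_apply_var[OF P])
  from this Nat_sc[OF n] have "\<forall>j. j \<epsilon> sc n \<longrightarrow> P j"
    by (rule Nat_induct) (use less in \<open>auto simp: nn.simps\<close>)
  then show ?thesis by simp
qed

lemma Gen_induct:
  assumes "Gen step x" and P: "Dfn (\<lambda>e. P (e 0))"
    and mono: "\<And>P Q y. step P y \<Longrightarrow> (\<And>z. P z \<Longrightarrow> Q z) \<Longrightarrow> step Q y"
    and closed: "\<And>y. step P y \<Longrightarrow> P y"
  shows "P x"
proof -
  obtain m s where s: "Nat m" "\<And>i y. pr i y \<epsilon> s \<Longrightarrow> step (\<lambda>z. \<exists>j. j \<epsilon> i \<and> pr j z \<epsilon> s) y" "pr m x \<epsilon> s"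
    using assms(1) unfolding Gen_def by blast
  have "Dfn (\<lambda>e. \<forall>y. pr (e 0) y \<epsilon> s \<longrightarrow> P y)" by (intro Dfn_intros Dfn_apply_var[OF P])
  from this s(1) have "\<forall>y. pr m y \<epsilon> s \<longrightarrow> P y"
  proof (rule Nat_less_induct)
    fix i assume "Nat i" and IH: "\<And>j. j \<epsilon> i \<Longrightarrow> \<forall>y. pr j y \<epsilon> s \<longrightarrow> P y"
    show "\<forall>y. pr i y \<epsilon> s \<longrightarrow> P y"
    proof (intro allI impI)
      fix y assume "pr i y \<epsilon> s"
      from s(2)[OF this] show "P y" by (rule closed[OF mono]) (use IH in blast)
    qed
  qed
  then show ?thesis using s(3) by blast
qed

text \<open>An earlier entry, at position \<open>j\<close>, is itself generated: the initial segment
  \<open>t\<close> of the sequence up to \<open>j\<close> is a generating sequence for it.\<close>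

lemma Gen_unfold:
  assumes "Gen step x" and mono: "\<And>P Q y. step P y \<Longrightarrow> (\<And>z. P z \<Longrightarrow> Q z) \<Longrightarrow> step Q y"
  shows "step (Gen step) x"
proof -
  obtain m s where s: "Nat m" "FunOn (\<lambda>i. i \<epsilon> sc m) s"
    "\<And>i y. pr i y \<epsilon> s \<Longrightarrow> step (\<lambda>z. \<exists>j. j \<epsilon> i \<and> pr j z \<epsilon> s) y" "pr m x \<epsilon> s"
    using assms(1) unfolding Gen_def by blast
  show ?thesis
  proof (rule mono[OF s(3)[OF s(4)]])
    fix z assume "\<exists>j. j \<epsilon> m \<and> pr j z \<epsilon> s"
    then obtain j where j: "j \<epsilon> m" "pr j z \<epsilon> s" by blast
    have "Nat j" using Nat_mem s(1) j(1) by blast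
    have "sub j m" using Nat_mem_sub s(1) j(1) by blast
    define t where "t = Collect_in s (\<lambda>p. \<exists>i y. i \<epsilon> sc j \<and> p = pr i y)"
    have "Dfn (\<lambda>e. \<exists>i y. i \<epsilon> sc j \<and> e 0 = pr i y)" by (intro Dfn_intros)
    then have t: "p \<epsilon> t \<longleftrightarrow> p \<epsilon> s \<and> (\<exists>i y. i \<epsilon> sc j \<and> p = pr i y)" for p
      unfolding t_def by (rule mem_Collect_in)
    then have t': "pr i y \<epsilon> t \<longleftrightarrow> pr i y \<epsilon> s \<and> i \<epsilon> sc j" for i y by auto
    have dom: "i \<epsilon> sc m" if "i \<epsilon> sc j" for i
      using that j(1) \<open>sub j m\<close> by (auto simp: sub_def)
    have "FunOn (\<lambda>i. i \<epsilon> sc j) t"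
    proof (rule FunOnI)
      show "\<exists>x y. p = pr x y" if "p \<epsilon> t" for p using that t by blast
      show "i \<epsilon> sc j \<longleftrightarrow> (\<exists>y. pr i y \<epsilon> t)" for i
        unfolding t' using dom FunOn_dom[OF s(2), of i] by blast
      show "y = z" if "pr i y \<epsilon> t" "pr i z \<epsilon> t" for i y z
        using that FunOn_unique[OF s(2)] by (simp only: t') blast
    qed
    moreover have "step (\<lambda>z. \<exists>l. l \<epsilon> i \<and> pr l z \<epsilon> t) y" if "pr i y \<epsilon> t" for i y
    proof -
      have i: "i \<epsilon> sc j" "pr i y \<epsilon> s" using that by (simp_all only: t')
      show ?thesis
      proof (rule mono[OF s(3)[OF i(2)]])
        fix z assume "\<exists>l. l \<epsilon> i \<and> pr l z \<epsilon> s"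
        then obtain l where l: "l \<epsilon> i" "pr l z \<epsilon> s" by blast
        have "l \<epsilon> sc j" using l(1) i(1) Nat_mem_sub[OF \<open>Nat j\<close>] by (auto simp: sub_def)
        then show "\<exists>l. l \<epsilon> i \<and> pr l z \<epsilon> t" using l t' by blast
      qed
    qed
    moreover have "pr j z \<epsilon> t" using j t' by simp
    ultimately show "Gen step z" using \<open>Nat j\<close> unfolding Gen_def by blast
  qed
qed

lemma form_step_mono: "form_step L n P p \<Longrightarrow> (\<And>z. P z \<Longrightarrow> Q z) \<Longrightarrow> form_step L n Q p"
  unfolding form_step_def by (elim disj_forward ex_forward conj_forward) auto

lemma Form_induct:
  assumes "Form L n p" "Dfn (\<lambda>e. P (e 0))" "\<And>p. form_step L n P p \<Longrightarrow> P p"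
  shows "P p"
  using assms(1) unfolding Form_def
  by (rule Gen_induct[OF _ assms(2) _ assms(3)]) (rule form_step_mono)

lemma Form_unfold: "Form L n p \<Longrightarrow> form_step L n (Form L n) p"
  unfolding Form_def by (erule Gen_unfold) (rule form_step_mono)

lemma Form_cimp: "Form L n (cimp p q) \<Longrightarrow> Form L n p \<and> Form L n q"
  by (drule Form_unfold) (auto simp: form_step_def)

lemma Form_call: "Form L n (call k p) \<Longrightarrow> k \<epsilon> n \<and> Form L n p"
  by (drule Form_unfold) (auto simp: form_step_def)

lemma Form_cveq: "Form epsL n (cveq k l) \<Longrightarrow> k \<epsilon> n \<and> l \<epsilon> n"
  by (drule Form_unfold) (auto simp: form_step_def cveq_def epsL_eq Term_rel_lang)

lemma Form_cvmem:
  assumes "Form epsL n (cvmem k l)"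
  shows "k \<epsilon> n \<and> l \<epsilon> n"
proof -
  obtain ts where "ts = tup (cvar k) (cvar l)" "\<And>i u. pr i u \<epsilon> ts \<Longrightarrow> Term epsL n u"
    using Form_unfold[OF assms] unfolding form_step_def cvmem_eq by auto
  then have "Term epsL n (cvar k)" "Term epsL n (cvar l)" by (auto simp: mem_tup)
  then show ?thesis by (auto simp: epsL_eq Term_rel_lang)
qed

lemma Form_derived:
  "Form L n (cnot p) \<Longrightarrow> Form L n p"
  "Form L n (cand p q) \<Longrightarrow> Form L n p \<and> Form L n q"
  "Form L n (ciff p q) \<Longrightarrow> Form L n p \<and> Form L n q"
  "Form L n (cex k p) \<Longrightarrow> k \<epsilon> n \<and> Form L n p"
  unfolding cnot_def cand_def ciff_def cex_def by (auto dest!: Form_cimp Form_call)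

section \<open>Formation sequences for codes of concrete formulas\<close>

primrec quantifier_depth :: "fm \<Rightarrow> nat" where
  "quantifier_depth Bot = 0"
| "quantifier_depth (Mem i j) = 0"
| "quantifier_depth (Eq i j) = 0"
| "quantifier_depth (Imp p q) = max (quantifier_depth p) (quantifier_depth q)"
| "quantifier_depth (Forall p) = Suc (quantifier_depth p)"

definition form_list :: "'a \<Rightarrow> 'a list \<Rightarrow> bool" where
  "form_list n xs \<longleftrightarrow> (\<forall>i<length xs. form_step epsL n (\<lambda>z. z \<in> set (take i xs)) (xs ! i))"

lemma form_list_snoc:
  "form_list n xs \<Longrightarrow> form_step epsL n (\<lambda>z. z \<in> set xs) y \<Longrightarrow> form_list n (xs @ [y])"
  by (auto simp: form_list_def nth_append less_Suc_eq)

lemma form_list_append: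
  assumes "form_list n xs" "form_list n ys"
  shows "form_list n (xs @ ys)"
  unfolding form_list_def
proof (intro allI impI)
  fix i assume i: "i < length (xs @ ys)"
  show "form_step epsL n (\<lambda>z. z \<in> set (take i (xs @ ys))) ((xs @ ys) ! i)"
  proof (cases "i < length xs")
    case True
    then show ?thesis using assms(1) by (simp add: form_list_def nth_append)
  next
    case False
    then have "form_step epsL n (\<lambda>z. z \<in> set (take (i - length xs) ys)) (ys ! (i - length xs))"
      using assms(2) i by (simp add: form_list_def)
    then show ?thesis using False by (auto simp: nth_append elim: form_step_mono)
  qed
qed

text \<open>\<open>code\<close> uses the variable with number \<open>d\<close> for a quantifier at
  depth \<open>d\<close>. The variables of \<open>p\<close>, free or bound, therefore stay below
  \<open>d + quantifier_depth p\<close>, which explains the bound on \<open>N\<close>.\<close>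

lemma ex_form_list:
  "closed_at d p \<Longrightarrow> d + quantifier_depth p \<le> N \<Longrightarrow> \<exists>xs. form_list (nn N) xs \<and> xs \<noteq> [] \<and> last xs = code d p"
proof (induction p arbitrary: d)
  case Bot
  show ?case by (intro exI[of _ "[cbot]"]) (simp add: form_list_def form_step_def)
next
  case (Mem i j)
  then have "Form epsL (nn N) (cvmem (nn (d - Suc i)) (nn (d - Suc j)))"
    unfolding cvmem_eq epsL_eq by (intro Form_crel) (auto simp: nn_mem_iff)
  from Gen_last[OF this[unfolded Form_def]] obtain P where
    "form_step epsL (nn N) P (cvmem (nn (d - Suc i)) (nn (d - Suc j)))" by blast
  then show ?case
    by (intro exI[of _ "[code d (Mem i j)]"]) (simp add: form_list_def form_step_def cvmem_eq)
next
  case (Eq i j)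
  then have "Term epsL (nn N) (cvar (nn (d - Suc i)))" "Term epsL (nn N) (cvar (nn (d - Suc j)))"
    by (auto simp: nn_mem_iff epsL_eq Term_rel_lang)
  then show ?case
    by (intro exI[of _ "[code d (Eq i j)]"]) (simp add: form_list_def form_step_def cveq_def)
next
  case (Imp p q)
  obtain xs ys where xs: "form_list (nn N) xs" "xs \<noteq> []" "last xs = code d p"
    and ys: "form_list (nn N) ys" "ys \<noteq> []" "last ys = code d q"
    using Imp.IH(1)[of d] Imp.IH(2)[of d] Imp.prems by (auto simp: nat_add_max_right)
  then have "code d p \<in> set (xs @ ys)" "code d q \<in> set (xs @ ys)" by (auto dest: last_in_set)
  then have "form_step epsL (nn N) (\<lambda>z. z \<in> set (xs @ ys)) (cimp (code d p) (code d q))"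
    unfolding form_step_def by blast
  with form_list_append[OF xs(1) ys(1)] have "form_list (nn N) ((xs @ ys) @ [code d (Imp p q)])"
    unfolding code.simps by (rule form_list_snoc)
  then show ?case by (intro exI[of _ "(xs @ ys) @ [code d (Imp p q)]"]) simp
next
  case (Forall p)
  then have "closed_at (Suc d) p" "Suc d + quantifier_depth p \<le> N" by simp_all
  from Forall.IH[OF this] obtain xs
    where xs: "form_list (nn N) xs" "xs \<noteq> []" "last xs = code (Suc d) p"
    by blast
  then have "code (Suc d) p \<in> set xs" by (auto dest: last_in_set)
  moreover have "nn d \<epsilon> nn N" using Forall.prems(2) by (auto simp: nn_mem_iff)
  ultimately have "form_step epsL (nn N) (\<lambda>z. z \<in> set xs) (call (nn d) (code (Suc d) p))"
    unfolding form_step_def by blast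
  with xs(1) have "form_list (nn N) (xs @ [code d (Forall p)])"
    unfolding code.simps by (rule form_list_snoc)
  then show ?case by (intro exI[of _ "xs @ [code d (Forall p)]"]) simp
qed

lemma Form_code:
  assumes "closed_at d p" "d + quantifier_depth p \<le> N"
  shows "Form epsL (nn N) (code d p)"
proof -
  obtain xs where xs: "form_list (nn N) xs" "xs \<noteq> []" "last xs = code d p"
    using ex_form_list[OF assms] by blast
  have "Gen (form_step epsL (nn N)) (last xs)"
  proof (rule Gen_list)
    fix P Q y assume "form_step epsL (nn N) P y" "\<And>z. P z \<Longrightarrow> Q z"
    then show "form_step epsL (nn N) Q y" by (rule form_step_mono)
  qed (use xs(1,2) in \<open>simp_all add: form_list_def\<close>)
  then show ?thesis by (simp add: Form_def xs(3))
qed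


section \<open>Satisfaction\<close>

definition ap :: "'a \<Rightarrow> 'a \<Rightarrow> 'a" where
  "ap a k = (THE y. pr k y \<epsilon> a)"

definition upd :: "'a \<Rightarrow> 'a \<Rightarrow> 'a \<Rightarrow> 'a" where
  "upd a k x = un (upr (Collect_in a (\<lambda>q. \<exists>i y. q = pr i y \<and> i \<noteq> k)) (upr (pr k x) (pr k x)))"

lemma mem_upd: "q \<epsilon> upd a k x \<longleftrightarrow> q \<epsilon> a \<and> (\<exists>i y. q = pr i y \<and> i \<noteq> k) \<or> q = pr k x"
proof -
  have "Dfn (\<lambda>e. \<exists>i y. e 0 = pr i y \<and> i \<noteq> k)" by (intro Dfn_intros)
  then show ?thesis by (auto simp: upd_def mem_Collect_in)
qed

lemma pr_mem_upd: "pr i y \<epsilon> upd a k x \<longleftrightarrow> (if i = k then y = x else pr i y \<epsilon> a)"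
  by (auto simp: mem_upd)

lemma Func_FunOn: "Func a n A \<Longrightarrow> FunOn (\<lambda>i. i \<epsilon> n) a"
  by (simp add: Func_def)

lemmas Func_dom = FunOn_dom[OF Func_FunOn]
  and Func_unique = FunOn_unique[OF Func_FunOn]

lemma Func_val: "Func a n A \<Longrightarrow> pr i y \<epsilon> a \<Longrightarrow> y \<epsilon> A"
  by (simp add: Func_def)

lemma Func_elem: "Func a n A \<Longrightarrow> q \<epsilon> a \<Longrightarrow> \<exists>i y. q = pr i y"
  using FunOn_elem[OF Func_FunOn] by blast

lemma FuncI:
  assumes "\<And>p. p \<epsilon> f \<Longrightarrow> \<exists>x y. p = pr x y" "\<And>x. x \<epsilon> n \<longleftrightarrow> (\<exists>y. pr x y \<epsilon> f)"
    "\<And>x y z. pr x y \<epsilon> f \<Longrightarrow> pr x z \<epsilon> f \<Longrightarrow> y = z" "\<And>x y. pr x y \<epsilon> f \<Longrightarrow> y \<epsilon> A"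
  shows "Func f n A"
  unfolding Func_def
proof (intro conjI allI impI)
  show "FunOn (\<lambda>x. x \<epsilon> n) f" by (rule FunOnI[OF assms(1-3)])
qed (rule assms(4))

lemma Func_ext:
  "Func a n A \<Longrightarrow> Func b n B \<Longrightarrow> (\<And>i y. pr i y \<epsilon> a \<Longrightarrow> pr i y \<epsilon> b) \<Longrightarrow> a = b"
  by (rule FunOn_ext[OF Func_FunOn Func_FunOn])

lemma Func_in_pow:
  assumes "Func a n A"
  shows "a \<epsilon> pow (prod n A)"
  unfolding mem_pow sub_def
proof (intro allI impI)
  fix q assume "q \<epsilon> a"
  with Func_elem[OF assms this] obtain i y where "q = pr i y" "pr i y \<epsilon> a" by auto
  then show "q \<epsilon> prod n A" using Func_dom[OF assms, of i] Func_val[OF assms, of i y] by auto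
qed

lemma pr_mem_iff:
  assumes "Func a n A" "i \<epsilon> n"
  shows "pr i y \<epsilon> a \<longleftrightarrow> y = ap a i"
proof -
  obtain z where z: "pr i z \<epsilon> a" using assms Func_dom by blast
  have *: "pr i y \<epsilon> a \<longleftrightarrow> y = z" for y using z Func_unique[OF assms(1), of i y z] by blast
  then show ?thesis by (simp add: ap_def)
qed

lemma ap_in: "Func a n A \<Longrightarrow> i \<epsilon> n \<Longrightarrow> ap a i \<epsilon> A"
  using pr_mem_iff[of a n A i "ap a i"] Func_val by blast

lemma Func_upd:
  assumes "Func a n A" "k \<epsilon> n" "x \<epsilon> A"
  shows "Func (upd a k x) n A"
proof (rule FuncI)
  show "\<exists>x y. p = pr x y" if "p \<epsilon> upd a k x" for p using that by (auto simp: mem_upd)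
  show "i \<epsilon> n \<longleftrightarrow> (\<exists>y. pr i y \<epsilon> upd a k x)" for i
    using assms(2) Func_dom[OF assms(1), of i] by (auto simp: pr_mem_upd)
  show "y = z" if "pr i y \<epsilon> upd a k x" "pr i z \<epsilon> upd a k x" for i y z
    using that Func_unique[OF assms(1), of i y z] by (simp add: pr_mem_upd split: if_splits)
  show "y \<epsilon> A" if "pr i y \<epsilon> upd a k x" for i y
    using that assms(3) Func_val[OF assms(1), of i y] by (simp add: pr_mem_upd split: if_splits)
qed

lemma ap_upd: "ap (upd a k x) i = (if i = k then x else ap a i)"
  by (simp add: ap_def pr_mem_upd)

lemma variant_upd: "variant k a (upd a k x)"
  by (simp add: variant_def pr_mem_upd)

lemma variant_eq_upd:
  assumes "Func a n A" "Func a' n A" "k \<epsilon> n" "variant k a a'"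
  shows "a' = upd a k (ap a' k)"
proof (rule Func_ext[OF assms(2) Func_upd[OF assms(1,3) ap_in[OF assms(2,3)]]])
  fix i y assume "pr i y \<epsilon> a'"
  then show "pr i y \<epsilon> upd a k (ap a' k)"
    using assms(4) pr_mem_iff[OF assms(2,3), of y] by (auto simp: pr_mem_upd variant_def)
qed

text \<open>A variant at \<open>k\<close> is determined by its value there, so quantification over
  assignments in the clause for \<open>call\<close> becomes quantification over the domain.\<close>

lemma all_variants:
  assumes "Func a n A" "k \<epsilon> n"
  shows "(\<forall>a'. Func a' n A \<and> variant k a a' \<longrightarrow> Q a') \<longleftrightarrow> (\<forall>x. x \<epsilon> A \<longrightarrow> Q (upd a k x))"
proof (intro iffI allI impI)
  fix x assume "\<forall>a'. Func a' n A \<and> variant k a a' \<longrightarrow> Q a'" "x \<epsilon> A"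
  then show "Q (upd a k x)" using Func_upd[OF assms] variant_upd by simp
next
  fix a' assume *: "\<forall>x. x \<epsilon> A \<longrightarrow> Q (upd a k x)" "Func a' n A \<and> variant k a a'"
  then have "a' = upd a k (ap a' k)" "ap a' k \<epsilon> A"
    using variant_eq_upd[OF assms(1) _ assms(2)] ap_in[OF _ assms(2)] by simp_all
  then show "Q a'" using * by metis
qed

section \<open>Existence and uniqueness of satisfaction relations\<close>

definition atomic_value :: "'a \<Rightarrow> 'a \<Rightarrow> 'a \<Rightarrow> bool" where
  "atomic_value X p a \<longleftrightarrow> (\<exists>t u b. p = ceq t u \<and> TVal X a t b \<and> TVal X a u b) \<or>
     (\<exists>r ts e bs. p = crel r ts \<and> StrRel X r e \<and> TVals X a ts bs \<and> bs \<epsilon> e)"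

lemma SatRel_iff:
  assumes "StrDom X A"
  shows "SatRel X n D S \<longleftrightarrow> (\<forall>p a. p \<epsilon> D \<and> Func a n A \<longrightarrow>
     ((\<exists>t u. p = ceq t u) \<or> (\<exists>r ts. p = crel r ts) \<longrightarrow> (pr p a \<epsilon> S \<longleftrightarrow> atomic_value X p a)) \<and>
     (p = cbot \<longrightarrow> \<not> pr p a \<epsilon> S) \<and>
     (\<forall>q r. p = cimp q r \<longrightarrow> q \<epsilon> D \<and> r \<epsilon> D \<and> (pr p a \<epsilon> S \<longleftrightarrow> (pr q a \<epsilon> S \<longrightarrow> pr r a \<epsilon> S))) \<and>
     (\<forall>k q. p = call k q \<longrightarrow> q \<epsilon> D \<and>
        (pr p a \<epsilon> S \<longleftrightarrow> (\<forall>a'. Func a' n A \<and> variant k a a' \<longrightarrow> pr q a' \<epsilon> S))))"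
proof -
  have A: "StrDom X B \<longleftrightarrow> B = A" for B using assms by (auto simp: StrDom_def)
  have *: "((\<forall>t u. p = ceq t u \<longrightarrow> (z \<longleftrightarrow> (\<exists>b. TVal X a t b \<and> TVal X a u b))) \<and>
      (\<forall>r ts. p = crel r ts \<longrightarrow> (z \<longleftrightarrow> (\<exists>e bs. StrRel X r e \<and> TVals X a ts bs \<and> bs \<epsilon> e)))) \<longleftrightarrow>
      ((\<exists>t u. p = ceq t u) \<or> (\<exists>r ts. p = crel r ts) \<longrightarrow> (z \<longleftrightarrow> atomic_value X p a))" for z p a
    unfolding atomic_value_def by (auto; blast)
  show ?thesis unfolding SatRel_def A *[symmetric] by (simp add: conj_assoc)
qed

lemma Dfn_atomic_value:
  "Dfn_term t \<Longrightarrow> Dfn_term s \<Longrightarrow> Dfn_term r \<Longrightarrow> Dfn (\<lambda>e. atomic_value (t e) (s e) (r e))"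
  by (rule Dfn_subst3[of atomic_value])
    (unfold atomic_value_def ceq_def crel_def, intro Dfn_intros)

lemma Dfn_variant:
  "Dfn_term t \<Longrightarrow> Dfn_term s \<Longrightarrow> Dfn_term r \<Longrightarrow> Dfn (\<lambda>e. variant (t e) (s e) (r e))"
  by (rule Dfn_subst3[of variant]) (unfold variant_def, intro Dfn_intros)

definition sat_step :: "'a \<Rightarrow> 'a \<Rightarrow> 'a \<Rightarrow> 'a \<Rightarrow> 'a \<Rightarrow> 'a \<Rightarrow> bool" where
  "sat_step X A n S p a \<longleftrightarrow> atomic_value X p a \<or>
     (\<exists>q r. p = cimp q r \<and> (pr q a \<epsilon> S \<longrightarrow> pr r a \<epsilon> S)) \<or>
     (\<exists>k q. p = call k q \<and> (\<forall>a'. Func a' n A \<and> variant k a a' \<longrightarrow> pr q a' \<epsilon> S))"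

lemma atomic_value_codes:
  "\<not> atomic_value X cbot a" "\<not> atomic_value X (cimp q r) a" "\<not> atomic_value X (call k q) a"
  by (simp_all add: atomic_value_def)

text \<open>The immediate subformulas of \<open>p\<close> are in \<open>D\<close>, so
  \<open>sat_step\<close> reads its truth off \<open>S\<close>; as \<open>p\<close> is new, the
  values of the old formulas are unchanged. Assignments are subsets of \<open>prod n A\<close>,
  hence powerset and separation provide the new relation.\<close>

lemma SatRel_extend:
  assumes X: "StrDom X A" and S: "SatRel X n D S" and p: "\<not> p \<epsilon> D"
    and step: "form_step L m (\<lambda>z. z \<epsilon> D) p"
  shows "\<exists>S'. SatRel X n (un (upr D (upr p p))) S'"
proof -
  let ?D = "un (upr D (upr p p))"
  let ?Q = "\<lambda>w. \<exists>z a. w = pr z a \<and> (z \<epsilon> D \<and> pr z a \<epsilon> S \<or> z = p \<and> sat_step X A n S p a)"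
  define S' where "S' = Collect_in (prod ?D (pow (prod n A))) ?Q"
  have "Dfn (\<lambda>e. ?Q (e 0))"
    unfolding sat_step_def cimp_def call_def by (intro Dfn_intros Dfn_atomic_value Dfn_variant)
  then have S': "w \<epsilon> S' \<longleftrightarrow> w \<epsilon> prod ?D (pow (prod n A)) \<and> ?Q w" for w
    unfolding S'_def by (rule mem_Collect_in)
  have old: "pr z a \<epsilon> S' \<longleftrightarrow> pr z a \<epsilon> S" if "z \<epsilon> D" "Func a n A" for z a
    using that p Func_in_pow[OF that(2)] by (auto simp: S')
  have new: "pr p a \<epsilon> S' \<longleftrightarrow> sat_step X A n S p a" if "Func a n A" for a
    using p Func_in_pow[OF that] by (auto simp: S')
  have sub1: "q \<epsilon> D" "r \<epsilon> D" if "p = cimp q r" for q r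
    using step that unfolding form_step_def by auto
  have sub2: "q \<epsilon> D" if "p = call k q" for k q
    using step that unfolding form_step_def by auto
  note S = S[unfolded SatRel_iff[OF X], rule_format, OF conjI]
  have "SatRel X n ?D S'"
    unfolding SatRel_iff[OF X]
  proof (intro allI impI)
    fix z a assume za: "z \<epsilon> ?D \<and> Func a n A"
    show "((\<exists>t u. z = ceq t u) \<or> (\<exists>r ts. z = crel r ts) \<longrightarrow> (pr z a \<epsilon> S' \<longleftrightarrow> atomic_value X z a)) \<and>
     (z = cbot \<longrightarrow> \<not> pr z a \<epsilon> S') \<and>
     (\<forall>q r. z = cimp q r \<longrightarrow> q \<epsilon> ?D \<and> r \<epsilon> ?D \<and> (pr z a \<epsilon> S' \<longleftrightarrow> (pr q a \<epsilon> S' \<longrightarrow> pr r a \<epsilon> S'))) \<and>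
     (\<forall>k q. z = call k q \<longrightarrow> q \<epsilon> ?D \<and>
        (pr z a \<epsilon> S' \<longleftrightarrow> (\<forall>a'. Func a' n A \<and> variant k a a' \<longrightarrow> pr q a' \<epsilon> S')))"
    proof (cases "z \<epsilon> D")
      case True
      have a: "Func a n A" using za by blast
      have *: "pr z a \<epsilon> S' \<longleftrightarrow> pr z a \<epsilon> S" using old[OF True a] .
      have D: "q \<epsilon> ?D" if "q \<epsilon> D" for q using that by auto
      have imp: "q \<epsilon> D \<and> r \<epsilon> D \<and> (pr z a \<epsilon> S \<longleftrightarrow> (pr q a \<epsilon> S \<longrightarrow> pr r a \<epsilon> S))" if "z = cimp q r" for q r
        using S[OF True a] that by blast
      have all: "q \<epsilon> D \<and> (pr z a \<epsilon> S \<longleftrightarrow> (\<forall>a'. Func a' n A \<and> variant k a a' \<longrightarrow> pr q a' \<epsilon> S))"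
        if "z = call k q" for k q
        using S[OF True a] that by blast
      show ?thesis
        unfolding *
      proof (intro conjI allI impI)
        assume "(\<exists>t u. z = ceq t u) \<or> (\<exists>r ts. z = crel r ts)"
        then show "pr z a \<epsilon> S \<longleftrightarrow> atomic_value X z a" using S[OF True a] by blast
      next
        assume "z = cbot"
        then show "\<not> pr z a \<epsilon> S" using S[OF True a] by blast
      next
        fix q r assume zq: "z = cimp q r"
        show "q \<epsilon> ?D" "r \<epsilon> ?D" using imp[OF zq] D by blast+
        show "pr z a \<epsilon> S \<longleftrightarrow> (pr q a \<epsilon> S' \<longrightarrow> pr r a \<epsilon> S')"
          using imp[OF zq] old[of q, OF _ a] old[of r, OF _ a] by blast
      next
        fix k q assume zq: "z = call k q"
        show "q \<epsilon> ?D" using all[OF zq] D by blast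
        show "pr z a \<epsilon> S \<longleftrightarrow> (\<forall>a'. Func a' n A \<and> variant k a a' \<longrightarrow> pr q a' \<epsilon> S')"
          using all[OF zq] old[of q] by blast
      qed
    next
      case False
      then have z: "z = p" and a: "Func a n A" using za by auto
      have *: "pr z a \<epsilon> S' \<longleftrightarrow> sat_step X A n S p a" using new[OF a] z by simp
      show ?thesis
      proof (intro conjI allI impI)
        assume "(\<exists>t u. z = ceq t u) \<or> (\<exists>r ts. z = crel r ts)"
        then show "pr z a \<epsilon> S' \<longleftrightarrow> atomic_value X z a"
          unfolding * unfolding z sat_step_def by auto
      next
        assume "z = cbot"
        then show "\<not> pr z a \<epsilon> S'" unfolding * using z by (auto simp: sat_step_def atomic_value_codes)
      next
        fix q r assume zq: "z = cimp q r"
        show "q \<epsilon> ?D" "r \<epsilon> ?D" using sub1 zq z by auto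
        show "pr z a \<epsilon> S' \<longleftrightarrow> (pr q a \<epsilon> S' \<longrightarrow> pr r a \<epsilon> S')"
          unfolding * using sub1[of q r] zq z old[OF _ a]
          by (auto simp: sat_step_def atomic_value_codes)
      next
        fix k q assume zq: "z = call k q"
        show "q \<epsilon> ?D" using sub2 zq z by auto
        have "q \<epsilon> D" using sub2 zq z by simp
        then show "pr z a \<epsilon> S' \<longleftrightarrow> (\<forall>a'. Func a' n A \<and> variant k a a' \<longrightarrow> pr q a' \<epsilon> S')"
          unfolding * using zq z old[of q] by (auto simp: sat_step_def atomic_value_codes)
      qed
    qed
  qed
  then show ?thesis by blast
qed

text \<open>A formation sequence of \<open>p\<close> is processed entry by entry, by induction
  inside the universe since its length may be nonstandard. The set of formulas at step
  \<open>i\<close> consists exactly of the entries before \<open>i\<close>, so a repeated entry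
  changes nothing.\<close>

lemma SatRel_exists:
  assumes X: "StrDom X A" and p: "Form L m p"
  obtains D S where "SatRel X n D S" "p \<epsilon> D"
proof -
  obtain l s where s: "Nat l" "FunOn (\<lambda>i. i \<epsilon> sc l) s"
    "\<And>i y. pr i y \<epsilon> s \<Longrightarrow> form_step L m (\<lambda>z. \<exists>j. j \<epsilon> i \<and> pr j z \<epsilon> s) y" "pr l p \<epsilon> s"
    using p unfolding Form_def Gen_def by blast
  let ?P = "\<lambda>i. sub i (sc l) \<longrightarrow> (\<exists>D S. (\<forall>z. z \<epsilon> D \<longleftrightarrow> (\<exists>j. j \<epsilon> i \<and> pr j z \<epsilon> s)) \<and> SatRel X n D S)"
  have "Dfn (\<lambda>e. ?P (e 0))" by (intro Dfn_intros)
  from this Nat_sc[OF s(1)] have "?P (sc l)"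
  proof (rule Nat_induct)
    have "SatRel X n emp emp" using X by (simp add: SatRel_iff)
    moreover have "\<forall>z. z \<epsilon> emp \<longleftrightarrow> (\<exists>j. j \<epsilon> nn 0 \<and> pr j z \<epsilon> s)" by (simp add: nn.simps)
    ultimately show "?P (nn 0)" by blast
  next
    fix i assume "Nat i" and IH: "?P i"
    show "?P (sc i)"
    proof
      assume i: "sub (sc i) (sc l)"
      then have "sub i (sc l)" "i \<epsilon> sc l" unfolding sub_def mem_sc by blast+
      then obtain D S where D: "\<And>z. z \<epsilon> D \<longleftrightarrow> (\<exists>j. j \<epsilon> i \<and> pr j z \<epsilon> s)" "SatRel X n D S"
        using IH by blast
      obtain q where q: "pr i q \<epsilon> s" using \<open>i \<epsilon> sc l\<close> FunOn_dom[OF s(2)] by blast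
      have q': "pr i z \<epsilon> s \<longleftrightarrow> z = q" for z using q FunOn_unique[OF s(2) q] by blast
      let ?D = "un (upr D (upr q q))"
      have mem: "\<forall>z. z \<epsilon> ?D \<longleftrightarrow> (\<exists>j. j \<epsilon> sc i \<and> pr j z \<epsilon> s)"
        unfolding mem_sc using D(1) q' by auto
      have "\<exists>S. SatRel X n ?D S"
      proof (cases "q \<epsilon> D")
        case True
        then have "?D = D" by (intro extensional) auto
        then show ?thesis using D(2) by auto
      next
        case False
        have "form_step L m (\<lambda>z. z \<epsilon> D) q" unfolding D(1) by (rule s(3)[OF q])
        then show ?thesis by (rule SatRel_extend[OF X D(2) False])
      qed
      then show "\<exists>D S. (\<forall>z. z \<epsilon> D \<longleftrightarrow> (\<exists>j. j \<epsilon> sc i \<and> pr j z \<epsilon> s)) \<and> SatRel X n D S"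
        using mem by blast
    qed
  qed
  then obtain D S where "\<forall>z. z \<epsilon> D \<longleftrightarrow> (\<exists>j. j \<epsilon> sc l \<and> pr j z \<epsilon> s)" "SatRel X n D S"
    by (auto simp: sub_def)
  moreover from this have "p \<epsilon> D" using s(4) mem_sc by blast
  ultimately show ?thesis using that by blast
qed

definition agree :: "'a \<Rightarrow> 'a \<Rightarrow> 'a \<Rightarrow> bool" where
  "agree n a b \<longleftrightarrow> (\<forall>i y. i \<epsilon> n \<longrightarrow> (pr i y \<epsilon> a \<longleftrightarrow> pr i y \<epsilon> b))"

lemma agree_upd: "agree n a b \<Longrightarrow> agree n (upd a k x) (upd b k x)"
  by (simp add: agree_def pr_mem_upd)

lemma atomic_value_agree:
  assumes "agree n a b" "form_step (rel_lang R) n P p" "(\<exists>t u. p = ceq t u) \<or> (\<exists>r ts. p = crel r ts)"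
  shows "atomic_value (pr A (pr I emp)) p a \<longleftrightarrow> atomic_value (pr A (pr I emp)) p b"
proof -
  let ?X = "pr A (pr I emp)"
  have val: "TVal ?X a t y \<longleftrightarrow> TVal ?X b t y" if "Term (rel_lang R) n t" for t y
    using that assms(1) by (auto simp: Term_rel_lang TVal_cvar agree_def)
  from assms(3) show ?thesis
  proof (elim disjE exE)
    fix t u assume p: "p = ceq t u"
    then have "Term (rel_lang R) n t" "Term (rel_lang R) n u"
      using assms(2) by (auto simp: form_step_def)
    then show ?thesis by (simp add: atomic_value_def p val)
  next
    fix r ts assume p: "p = crel r ts"
    then have "Term (rel_lang R) n u" if "pr i u \<epsilon> ts" for i u
      using assms(2) that unfolding form_step_def by auto
    then have "TVals ?X a ts bs \<longleftrightarrow> TVals ?X b ts bs" for bs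
      unfolding TVals_def using val by blast
    then show ?thesis by (simp add: atomic_value_def p)
  qed
qed

lemma form_step_cases:
  assumes "form_step L n P p"
  obtains (atomic) "(\<exists>t u. p = ceq t u) \<or> (\<exists>r ts. p = crel r ts)" | (bot) "p = cbot"
  | (imp) q r where "P q" "P r" "p = cimp q r" | (all) k q where "k \<epsilon> n" "P q" "p = call k q"
  using assms unfolding form_step_def by (elim disjE exE conjE) (simp_all add: that)

text \<open>Uniqueness of satisfaction and independence of the variables outside \<open>n\<close> are proved together,
  as both are inductions over the formula.\<close>

lemma SatRel_coincidence:
  assumes p: "Form (rel_lang R) n p" and nl: "sub n l" and X: "X = pr A (pr I emp)"
    and S1: "SatRel X l D1 S1" "p \<epsilon> D1" and S2: "SatRel X l D2 S2" "p \<epsilon> D2"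
    and a: "Func a l A" "Func b l A" "agree n a b"
  shows "pr p a \<epsilon> S1 \<longleftrightarrow> pr p b \<epsilon> S2"
proof -
  have dom: "StrDom X A" by (simp add: X)
  note S1' = S1(1)[unfolded SatRel_iff[OF dom], rule_format, OF conjI]
  note S2' = S2(1)[unfolded SatRel_iff[OF dom], rule_format, OF conjI]
  let ?P = "\<lambda>p. \<forall>a b. p \<epsilon> D1 \<and> p \<epsilon> D2 \<and> Func a l A \<and> Func b l A \<and> agree n a b \<longrightarrow>
      (pr p a \<epsilon> S1 \<longleftrightarrow> pr p b \<epsilon> S2)"
  have "Dfn (\<lambda>e. ?P (e 0))" unfolding agree_def by (intro Dfn_intros)
  with p have "?P p"
  proof (rule Form_induct)
    fix p assume step: "form_step (rel_lang R) n ?P p"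
    show "?P p"
    proof (intro allI impI)
      fix a b assume *: "p \<epsilon> D1 \<and> p \<epsilon> D2 \<and> Func a l A \<and> Func b l A \<and> agree n a b"
      then have p1: "p \<epsilon> D1" and p2: "p \<epsilon> D2" and a: "Func a l A" and b: "Func b l A" and ab: "agree n a b"
        by blast+
      from step show "pr p a \<epsilon> S1 \<longleftrightarrow> pr p b \<epsilon> S2"
      proof (cases rule: form_step_cases)
        case atomic
        then show ?thesis
          using S1'[OF p1 a] S2'[OF p2 b] atomic_value_agree[OF ab step atomic] unfolding X by blast
      next
        case bot
        then show ?thesis using S1'[OF p1 a] S2'[OF p2 b] by blast
      next
        case (imp q r)
        have "q \<epsilon> D1 \<and> r \<epsilon> D1 \<and> (pr p a \<epsilon> S1 \<longleftrightarrow> (pr q a \<epsilon> S1 \<longrightarrow> pr r a \<epsilon> S1))"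
          "q \<epsilon> D2 \<and> r \<epsilon> D2 \<and> (pr p b \<epsilon> S2 \<longleftrightarrow> (pr q b \<epsilon> S2 \<longrightarrow> pr r b \<epsilon> S2))"
          using S1'[OF p1 a] S2'[OF p2 b] imp(3) by blast+
        then show ?thesis using imp(1,2) a b ab by blast
      next
        case (all k q)
        then have k: "k \<epsilon> l" using nl by (simp add: sub_def)
        have 1: "q \<epsilon> D1 \<and> (pr p a \<epsilon> S1 \<longleftrightarrow> (\<forall>x. x \<epsilon> A \<longrightarrow> pr q (upd a k x) \<epsilon> S1))"
          using S1'[OF p1 a] all(3) unfolding all_variants[OF a k, of "\<lambda>a. pr q a \<epsilon> S1", symmetric] by blast
        have 2: "q \<epsilon> D2 \<and> (pr p b \<epsilon> S2 \<longleftrightarrow> (\<forall>x. x \<epsilon> A \<longrightarrow> pr q (upd b k x) \<epsilon> S2))"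
          using S2'[OF p2 b] all(3) unfolding all_variants[OF b k, of "\<lambda>b. pr q b \<epsilon> S2", symmetric] by blast
        have "pr q (upd a k x) \<epsilon> S1 \<longleftrightarrow> pr q (upd b k x) \<epsilon> S2" if "x \<epsilon> A" for x
          using all(2) 1 2 Func_upd[OF a k that] Func_upd[OF b k that] agree_upd[OF ab] by blast
        then show ?thesis using 1 2 by blast
      qed
    qed
  qed
  then show ?thesis using S1(2) S2(2) a by blast
qed

lemma agree_refl: "agree n a a"
  by (simp add: agree_def)

text \<open>By uniqueness any single satisfaction relation decides \<open>Sat\<close>. The recursion
  clauses below are read off one relation that contains the formula together with its
  subformulas.\<close>

lemma Sat_iff:
  assumes "Form (rel_lang R) n p" "sub n l" "SatRel (pr A (pr I emp)) l D S" "p \<epsilon> D" "Func a l A"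
  shows "Sat (pr A (pr I emp)) l p a \<longleftrightarrow> pr p a \<epsilon> S"
proof
  assume "Sat (pr A (pr I emp)) l p a"
  then obtain D' S' where "SatRel (pr A (pr I emp)) l D' S'" "p \<epsilon> D'" "pr p a \<epsilon> S'"
    unfolding Sat_def by blast
  then show "pr p a \<epsilon> S"
    using SatRel_coincidence[OF assms(1,2) refl _ _ assms(3,4,5,5) agree_refl] by blast
next
  assume "pr p a \<epsilon> S"
  then show "Sat (pr A (pr I emp)) l p a" using assms(3,4) unfolding Sat_def by blast
qed

text \<open>Needed for the schemata, where \<open>p\<close> has its variables below \<open>n\<close>
  but is evaluated under longer assignments that also cover the fresh variables of the
  axiom.\<close>

lemma Sat_coincidence:
  assumes p: "Form (rel_lang R) n p" and l: "sub n l" and a: "Func a l A" "Func b l A" "agree n a b"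
  shows "Sat (pr A (pr I emp)) l p a \<longleftrightarrow> Sat (pr A (pr I emp)) l p b"
proof -
  let ?X = "pr A (pr I emp)"
  have "StrDom ?X A" by simp
  then obtain D S where D: "SatRel ?X l D S" "p \<epsilon> D" using p by (rule SatRel_exists)
  show ?thesis
    unfolding Sat_iff[OF p l D a(1)] Sat_iff[OF p l D a(2)]
    by (rule SatRel_coincidence[OF p l refl D D a])
qed

lemma sub_refl: "sub n n"
  by (simp add: sub_def)

lemma Sat_atomic_value:
  assumes "Form (rel_lang R) n p" "Func a n A" "(\<exists>t u. p = ceq t u) \<or> (\<exists>r ts. p = crel r ts)"
  shows "Sat (pr A (pr I emp)) n p a \<longleftrightarrow> atomic_value (pr A (pr I emp)) p a"
proof -
  let ?X = "pr A (pr I emp)"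
  have dom: "StrDom ?X A" by simp
  then obtain D S where D: "SatRel ?X n D S" "p \<epsilon> D" using assms(1) by (rule SatRel_exists)
  show ?thesis
    unfolding Sat_iff[OF assms(1) sub_refl D assms(2)]
    using D(1)[unfolded SatRel_iff[OF dom], rule_format, OF conjI[OF D(2) assms(2)]] assms(3) by blast
qed

lemma Sat_cbot:
  assumes "Form (rel_lang R) n cbot" "Func a n A"
  shows "\<not> Sat (pr A (pr I emp)) n cbot a"
proof -
  let ?X = "pr A (pr I emp)"
  have dom: "StrDom ?X A" by simp
  then obtain D S where D: "SatRel ?X n D S" "cbot \<epsilon> D" using assms(1) by (rule SatRel_exists)
  show ?thesis
    unfolding Sat_iff[OF assms(1) sub_refl D assms(2)]
    using D(1)[unfolded SatRel_iff[OF dom], rule_format, OF conjI[OF D(2) assms(2)]] by blast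
qed

lemma Sat_cimp:
  assumes "Form (rel_lang R) n (cimp p q)" "Func a n A"
  shows "Sat (pr A (pr I emp)) n (cimp p q) a \<longleftrightarrow>
    (Sat (pr A (pr I emp)) n p a \<longrightarrow> Sat (pr A (pr I emp)) n q a)"
proof -
  let ?X = "pr A (pr I emp)"
  have dom: "StrDom ?X A" by simp
  then obtain D S where D: "SatRel ?X n D S" "cimp p q \<epsilon> D" using assms(1) by (rule SatRel_exists)
  have *: "p \<epsilon> D \<and> q \<epsilon> D \<and> (pr (cimp p q) a \<epsilon> S \<longleftrightarrow> (pr p a \<epsilon> S \<longrightarrow> pr q a \<epsilon> S))"
    using D(1)[unfolded SatRel_iff[OF dom], rule_format, OF conjI[OF D(2) assms(2)]] by blast
  then have pq: "p \<epsilon> D" "q \<epsilon> D" by blast+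
  have form: "Form (rel_lang R) n p" "Form (rel_lang R) n q" using Form_cimp[OF assms(1)] by blast+
  show ?thesis
    unfolding Sat_iff[OF assms(1) sub_refl D assms(2)] Sat_iff[OF form(1) sub_refl D(1) pq(1) assms(2)]
      Sat_iff[OF form(2) sub_refl D(1) pq(2) assms(2)]
    using * by blast
qed

lemma Sat_call:
  assumes "Form (rel_lang R) n (call k p)" "Func a n A"
  shows "Sat (pr A (pr I emp)) n (call k p) a \<longleftrightarrow>
    (\<forall>x. x \<epsilon> A \<longrightarrow> Sat (pr A (pr I emp)) n p (upd a k x))"
proof -
  let ?X = "pr A (pr I emp)"
  have dom: "StrDom ?X A" by simp
  then obtain D S where D: "SatRel ?X n D S" "call k p \<epsilon> D" using assms(1) by (rule SatRel_exists)
  have form: "k \<epsilon> n" "Form (rel_lang R) n p" using Form_call[OF assms(1)] by blast+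
  have *: "p \<epsilon> D \<and> (pr (call k p) a \<epsilon> S \<longleftrightarrow> (\<forall>x. x \<epsilon> A \<longrightarrow> pr p (upd a k x) \<epsilon> S))"
    using D(1)[unfolded SatRel_iff[OF dom], rule_format, OF conjI[OF D(2) assms(2)]]
    unfolding all_variants[OF assms(2) form(1), of "\<lambda>a. pr p a \<epsilon> S", symmetric] by blast
  then have p: "p \<epsilon> D" by blast
  show ?thesis
    unfolding Sat_iff[OF assms(1) sub_refl D assms(2)]
    using * Sat_iff[OF form(2) sub_refl D(1) p Func_upd[OF assms(2) form(1)]] by blast
qed


subsection \<open>Satisfaction in membership structures\<close>

definition eps_rel :: "'a \<Rightarrow> 'a" where
  "eps_rel A = Collect_in (pow (prod (nn 2) A)) (\<lambda>s. \<exists>x y. x \<epsilon> A \<and> y \<epsilon> A \<and> x \<epsilon> y \<and> s = tup x y)"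

definition eps_str :: "'a \<Rightarrow> 'a" where
  "eps_str A = pr A (pr (upr (pr (nn 0) (eps_rel A)) (pr (nn 0) (eps_rel A))) emp)"

lemma mem_eps_rel: "s \<epsilon> eps_rel A \<longleftrightarrow> (\<exists>x y. x \<epsilon> A \<and> y \<epsilon> A \<and> x \<epsilon> y \<and> s = tup x y)"
proof -
  have "Dfn (\<lambda>e. \<exists>x y. x \<epsilon> A \<and> y \<epsilon> A \<and> x \<epsilon> y \<and> e 0 = tup x y)"
    unfolding tup_def by (intro Dfn_intros)
  then have "s \<epsilon> eps_rel A \<longleftrightarrow>
      s \<epsilon> pow (prod (nn 2) A) \<and> (\<exists>x y. x \<epsilon> A \<and> y \<epsilon> A \<and> x \<epsilon> y \<and> s = tup x y)"
    unfolding eps_rel_def by (rule mem_Collect_in)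
  moreover have "tup x y \<epsilon> pow (prod (nn 2) A)" if "x \<epsilon> A" "y \<epsilon> A" for x y
    using that by (intro Func_in_pow) (simp add: Func_tup)
  ultimately show ?thesis by metis
qed

lemma EpsStr_iff: "EpsStr A X \<longleftrightarrow> (\<exists>x. x \<epsilon> A) \<and> X = eps_str A"
proof -
  have *: "Func s (nn 2) A \<and> (\<exists>x y. pr (nn 0) x \<epsilon> s \<and> pr (nn 1) y \<epsilon> s \<and> x \<epsilon> y) \<longleftrightarrow> s \<epsilon> eps_rel A" for s
  proof
    assume s: "Func s (nn 2) A \<and> (\<exists>x y. pr (nn 0) x \<epsilon> s \<and> pr (nn 1) y \<epsilon> s \<and> x \<epsilon> y)"
    then obtain x y where "s = tup x y" using FunOn_2E Func_FunOn by metis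
    then show "s \<epsilon> eps_rel A" using s by (auto simp: Func_tup mem_tup mem_eps_rel)
  qed (auto simp: mem_eps_rel Func_tup mem_tup)
  have "(\<forall>s. s \<epsilon> e \<longleftrightarrow> s \<epsilon> eps_rel A) \<longleftrightarrow> e = eps_rel A" for e
    by (auto simp: set_eq_iff)
  then show ?thesis unfolding EpsStr_def * eps_str_def by (simp add: nn.simps(1))
qed

lemma StrRel_eps_str: "StrRel (eps_str A) r e \<longleftrightarrow> r = nn 0 \<and> e = eps_rel A"
  by (simp add: eps_str_def)

abbreviation Tr :: "'a \<Rightarrow> 'a \<Rightarrow> 'a \<Rightarrow> 'a \<Rightarrow> bool" where
  "Tr A n p a \<equiv> Sat (eps_str A) n p a"

lemma Tr_simps:
  assumes a: "Func a n A"
  shows "Form epsL n cbot \<Longrightarrow> \<not> Tr A n cbot a"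
    and "Form epsL n (cimp p q) \<Longrightarrow> Tr A n (cimp p q) a \<longleftrightarrow> (Tr A n p a \<longrightarrow> Tr A n q a)"
    and "Form epsL n (call k p) \<Longrightarrow> Tr A n (call k p) a \<longleftrightarrow> (\<forall>x. x \<epsilon> A \<longrightarrow> Tr A n p (upd a k x))"
proof -
  show "Form epsL n cbot \<Longrightarrow> \<not> Tr A n cbot a"
    unfolding eps_str_def epsL_eq by (rule Sat_cbot[OF _ a])
  show "Form epsL n (cimp p q) \<Longrightarrow> Tr A n (cimp p q) a \<longleftrightarrow> (Tr A n p a \<longrightarrow> Tr A n q a)"
    unfolding eps_str_def epsL_eq by (rule Sat_cimp[OF _ a])
  show "Form epsL n (call k p) \<Longrightarrow> Tr A n (call k p) a \<longleftrightarrow> (\<forall>x. x \<epsilon> A \<longrightarrow> Tr A n p (upd a k x))"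
    unfolding eps_str_def epsL_eq by (rule Sat_call[OF _ a])
qed

lemma Tr_cveq:
  assumes a: "Func a n A" and p: "Form epsL n (cveq k l)"
  shows "Tr A n (cveq k l) a \<longleftrightarrow> ap a k = ap a l"
proof -
  have kl: "k \<epsilon> n" "l \<epsilon> n" using Form_cveq[OF p] by blast+
  have "Tr A n (cveq k l) a \<longleftrightarrow> atomic_value (eps_str A) (cveq k l) a"
    using p unfolding eps_str_def epsL_eq by (rule Sat_atomic_value[OF _ a]) (simp add: cveq_def)
  also have "\<dots> \<longleftrightarrow> (\<exists>b. b = ap a k \<and> b = ap a l)"
    by (auto simp: atomic_value_def cveq_def eps_str_def TVal_cvar pr_mem_iff[OF a kl(1)]
        pr_mem_iff[OF a kl(2)])
  finally show ?thesis by auto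
qed

lemma Tr_cvmem:
  assumes a: "Func a n A" and p: "Form epsL n (cvmem k l)"
  shows "Tr A n (cvmem k l) a \<longleftrightarrow> ap a k \<epsilon> ap a l"
proof -
  have kl: "k \<epsilon> n" "l \<epsilon> n" using Form_cvmem[OF p] by blast+
  have "Tr A n (cvmem k l) a \<longleftrightarrow> atomic_value (eps_str A) (cvmem k l) a"
    using p unfolding eps_str_def epsL_eq by (rule Sat_atomic_value[OF _ a]) (simp add: cvmem_eq)
  also have "\<dots> \<longleftrightarrow> (\<exists>bs. TVals (eps_str A) a (tup (cvar k) (cvar l)) bs \<and> bs \<epsilon> eps_rel A)"
    by (simp add: atomic_value_def cvmem_eq StrRel_eps_str)
  also have "\<dots> \<longleftrightarrow> tup (ap a k) (ap a l) \<epsilon> eps_rel A"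
    unfolding eps_str_def TVals_tup[OF Func_FunOn[OF a] kl]
    by (simp add: pr_mem_iff[OF a kl(1)] pr_mem_iff[OF a kl(2)])
  also have "\<dots> \<longleftrightarrow> ap a k \<epsilon> ap a l"
    using ap_in[OF a kl(1)] ap_in[OF a kl(2)] by (auto simp: mem_eps_rel)
  finally show ?thesis .
qed

lemma Form_cbot: "Form L n cbot"
  unfolding Form_def by (rule Gen_base) (simp add: form_step_def)

lemma Tr_cnot:
  assumes "Func a n A" "Form epsL n (cnot p)"
  shows "Tr A n (cnot p) a \<longleftrightarrow> \<not> Tr A n p a"
  using assms Tr_simps(1)[OF assms(1) Form_cbot] Tr_simps(2)[OF assms(1)] unfolding cnot_def by blast

lemma Tr_cand:
  assumes a: "Func a n A" and p: "Form epsL n (cand p q)"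
  shows "Tr A n (cand p q) a \<longleftrightarrow> Tr A n p a \<and> Tr A n q a"
proof -
  have form: "Form epsL n (cimp p (cnot q))" "Form epsL n (cnot q)"
    using p Form_derived(1) Form_cimp unfolding cand_def by blast+
  show ?thesis
    using p Tr_cnot[OF a] Tr_simps(2)[OF a form(1)] form(2) unfolding cand_def by blast
qed

lemma Tr_ciff:
  assumes a: "Func a n A" and p: "Form epsL n (ciff p q)"
  shows "Tr A n (ciff p q) a \<longleftrightarrow> (Tr A n p a \<longleftrightarrow> Tr A n q a)"
proof -
  have form: "Form epsL n (cimp p q)" "Form epsL n (cimp q p)"
    using p Form_derived(2) unfolding ciff_def by blast+
  show ?thesis
    using Tr_cand[OF a p[unfolded ciff_def]] Tr_simps(2)[OF a form(1)] Tr_simps(2)[OF a form(2)]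
    unfolding ciff_def by blast
qed

lemma Tr_cex:
  assumes a: "Func a n A" and p: "Form epsL n (cex k p)"
  shows "Tr A n (cex k p) a \<longleftrightarrow> (\<exists>x. x \<epsilon> A \<and> Tr A n p (upd a k x))"
proof -
  have form: "Form epsL n (call k (cnot p))" "Form epsL n (cnot p)" "k \<epsilon> n"
    using p Form_derived(1) Form_call unfolding cex_def by blast+
  have "Tr A n (cnot p) (upd a k x) \<longleftrightarrow> \<not> Tr A n p (upd a k x)" if "x \<epsilon> A" for x
    by (rule Tr_cnot[OF Func_upd[OF a form(3) that] form(2)])
  then show ?thesis
    using Tr_cnot[OF a p[unfolded cex_def]] Tr_simps(3)[OF a form(1)] unfolding cex_def by blast
qed

text \<open>Links satisfaction inside the universe with \<open>holds\<close>, so that the single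
  axioms of ZFC become relativized HOL statements. The schemata range over internal, possibly
  nonstandard formulas and are treated with \<open>Tr\<close> directly.\<close>

lemma Tr_code:
  assumes "closed_at d p" "Form epsL n (code d p)" "Func a n A"
  shows "Tr A n (code d p) a \<longleftrightarrow> holds (\<epsilon>) {x. x \<epsilon> A} (\<lambda>i. ap a (nn (d - Suc i))) p"
  using assms
proof (induction p arbitrary: d a)
  case Bot
  then show ?case using Tr_simps(1) by simp
next
  case (Mem i j)
  then show ?case using Tr_cvmem by simp
next
  case (Eq i j)
  then show ?case using Tr_cveq by simp
next
  case (Imp p q)
  then show ?case using Tr_simps(2)[OF Imp.prems(3)] Form_cimp[of epsL n "code d p" "code d q"] by simp
next
  case (Forall p)
  have form: "nn d \<epsilon> n" "Form epsL n (code (Suc d) p)"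
    using Form_call Forall.prems(2) unfolding code.simps by blast+
  have "Tr A n (code (Suc d) p) (upd a (nn d) x) \<longleftrightarrow>
      holds (\<epsilon>) {x. x \<epsilon> A} (case_nat x (\<lambda>i. ap a (nn (d - Suc i)))) p" if "x \<epsilon> A" for x
  proof -
    have "Tr A n (code (Suc d) p) (upd a (nn d) x) \<longleftrightarrow>
        holds (\<epsilon>) {x. x \<epsilon> A} (\<lambda>i. ap (upd a (nn d) x) (nn (Suc d - Suc i))) p"
      using Forall.prems(1) form(2) Func_upd[OF Forall.prems(3) form(1) that]
      by (intro Forall.IH) simp_all
    also have "\<dots> \<longleftrightarrow> holds (\<epsilon>) {x. x \<epsilon> A} (case_nat x (\<lambda>i. ap a (nn (d - Suc i)))) p"
      using Forall.prems(1) by (intro holds_cong[of "Suc d"]) (auto simp: ap_upd split: nat.split)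
    finally show ?thesis .
  qed
  then show ?case using Tr_simps(3)[OF Forall.prems(3)] Forall.prems(2) by simp
qed

end

section \<open>Foundation and choice\<close>

lemma holds_frag: "holds E C e (F 0) \<longleftrightarrow> tr E C e F 0 e"
proof -
  have "level_env e 0 e = e" by (simp add: level_env_def fun_eq_iff)
  then show ?thesis by (simp add: tr_def)
qed

lemma closed_axioms:
  assumes "p \<in> {extensionality, foundation, pairing, union, powerset, infinity, choice}"
  shows "closed_at 0 p"
  using assms
  by (auto simp: extensionality_def foundation_def pairing_def union_def powerset_def infinity_def
      choice_def f_all_def f_ex_def f_not_def f_imp_def f_and_def f_or_def f_iff_def f_mem_def f_eq_def
      f_bot_def subset_def is_upair_def is_inductive_def is_empty_def is_suc_def)

context lzfc_vp
begin

lemma Model_trans: "Model M \<Longrightarrow> trans_set M"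
  by (simp add: Model_def)

lemma Model_holds:
  assumes M: "Model M" and p: "p \<in> {extensionality, foundation, pairing, union, powerset, infinity, choice}"
  shows "holds (\<epsilon>) {x. x \<epsilon> M} e p"
proof -
  let ?N = "quantifier_depth p"
  obtain x where x: "x \<epsilon> M" and valid: "\<And>c. ZFAx c \<Longrightarrow> Valid epsL (eps_str M) c"
    using M unfolding Model_def EpsStr_iff by blast
  have "ZFAx (code 0 p)" using p unfolding ZFAx_def by blast
  then have "Valid epsL (eps_str M) (code 0 p)" by (rule valid)
  moreover have form: "Form epsL (nn ?N) (code 0 p)"
    by (rule Form_code[OF closed_axioms[OF p]]) simp
  \<comment> \<open>Validity is tested under assignments, so one must be exhibited: the constant
    assignment with value \<open>x\<close>.\<close>
  moreover have a: "Func (prod (nn ?N) (upr x x)) (nn ?N) M"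
    using x by (intro FuncI) auto
  ultimately have "Tr M (nn ?N) (code 0 p) (prod (nn ?N) (upr x x))"
    using Nat_nn unfolding Valid_def eps_str_def by (metis StrDom_iff)
  then have "holds (\<epsilon>) {x. x \<epsilon> M} (\<lambda>i. ap (prod (nn ?N) (upr x x)) (nn (0 - Suc i))) p"
    unfolding Tr_code[OF closed_axioms[OF p] form a] .
  then show ?thesis using holds_cong[OF closed_axioms[OF p]] by blast
qed

text \<open>All elements of \<open>x\<close> lie in a transitive model that contains
  \<open>x\<close>, so what is minimal in the sense of the model is minimal in the universe.\<close>

lemma foundation_set:
  assumes "y \<epsilon> x"
  obtains z where "z \<epsilon> x" "\<And>u. u \<epsilon> x \<Longrightarrow> \<not> u \<epsilon> z"
proof -
  obtain M where M: "Model M" "x \<epsilon> M" using ex_model by blast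
  have "x' \<epsilon> M" if "x' \<epsilon> x" for x'
    using Model_trans[OF M(1)] M(2) that unfolding trans_set_def sub_def by blast
  moreover have "holds (\<epsilon>) {x. x \<epsilon> M} undefined foundation" using M(1) by (rule Model_holds) simp
  then have "\<forall>x. x \<epsilon> M \<longrightarrow> (\<exists>y. y \<epsilon> M \<and> y \<epsilon> x) \<longrightarrow>
      (\<exists>y. y \<epsilon> M \<and> y \<epsilon> x \<and> (\<forall>z. z \<epsilon> M \<longrightarrow> z \<epsilon> x \<longrightarrow> \<not> z \<epsilon> y))"
    unfolding foundation_def holds_frag by simp
  ultimately show ?thesis using assms M(2) that by blast
qed

lemma mem_irrefl: "\<not> x \<epsilon> x"
proof
  assume "x \<epsilon> x"
  moreover have "x \<epsilon> upr x x" by simp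
  then obtain z where "z \<epsilon> upr x x" "\<And>u. u \<epsilon> upr x x \<Longrightarrow> \<not> u \<epsilon> z" by (rule foundation_set) blast
  ultimately show False by simp
qed

text \<open>The sets mentioned in the hypotheses, down to the elements of elements of
  \<open>x\<close>, lie in a transitive model that contains \<open>x\<close>, so a choice set found
  there is one in the universe.\<close>

lemma choice_set:
  assumes ne: "\<And>y. y \<epsilon> x \<Longrightarrow> \<exists>z. z \<epsilon> y"
    and disj: "\<And>y z u. y \<epsilon> x \<Longrightarrow> z \<epsilon> x \<Longrightarrow> u \<epsilon> y \<Longrightarrow> u \<epsilon> z \<Longrightarrow> y = z"
  shows "\<exists>c. \<forall>y. y \<epsilon> x \<longrightarrow> (\<exists>u. \<forall>z. z \<epsilon> y \<and> z \<epsilon> c \<longleftrightarrow> z = u)"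
proof -
  obtain M where M: "Model M" "x \<epsilon> M" using ex_model by blast
  have tr: "z \<epsilon> M" if "z \<epsilon> y" "y \<epsilon> M" for y z
    using Model_trans[OF M(1)] that unfolding trans_set_def sub_def by blast
  have "holds (\<epsilon>) {x. x \<epsilon> M} undefined choice" using M(1) by (rule Model_holds) simp
  then have "\<forall>x. x \<epsilon> M \<longrightarrow> (\<forall>y. y \<epsilon> M \<longrightarrow> y \<epsilon> x \<longrightarrow> (\<exists>z. z \<epsilon> M \<and> z \<epsilon> y)) \<and>
      (\<forall>y. y \<epsilon> M \<longrightarrow> (\<forall>z. z \<epsilon> M \<longrightarrow> y \<epsilon> x \<and> z \<epsilon> x \<and> (\<exists>u. u \<epsilon> M \<and> u \<epsilon> y \<and> u \<epsilon> z) \<longrightarrow> y = z)) \<longrightarrow>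
      (\<exists>c. c \<epsilon> M \<and> (\<forall>y. y \<epsilon> M \<longrightarrow> y \<epsilon> x \<longrightarrow>
        (\<exists>u. u \<epsilon> M \<and> (\<forall>z. z \<epsilon> M \<longrightarrow> (z \<epsilon> y \<and> z \<epsilon> c \<longleftrightarrow> z = u)))))"
    unfolding choice_def holds_frag by simp
  moreover have "\<forall>y. y \<epsilon> M \<longrightarrow> y \<epsilon> x \<longrightarrow> (\<exists>z. z \<epsilon> M \<and> z \<epsilon> y)" using ne tr by blast
  moreover have "\<forall>y. y \<epsilon> M \<longrightarrow> (\<forall>z. z \<epsilon> M \<longrightarrow> y \<epsilon> x \<and> z \<epsilon> x \<and> (\<exists>u. u \<epsilon> M \<and> u \<epsilon> y \<and> u \<epsilon> z) \<longrightarrow> y = z)"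
    using disj by blast
  ultimately obtain c where c: "\<forall>y. y \<epsilon> M \<longrightarrow> y \<epsilon> x \<longrightarrow>
      (\<exists>u. u \<epsilon> M \<and> (\<forall>z. z \<epsilon> M \<longrightarrow> (z \<epsilon> y \<and> z \<epsilon> c \<longleftrightarrow> z = u)))"
    using M(2) by blast
  have "\<exists>u. \<forall>z. z \<epsilon> y \<and> z \<epsilon> c \<longleftrightarrow> z = u" if y: "y \<epsilon> x" for y
  proof -
    have yM: "y \<epsilon> M" using tr[OF y M(2)] .
    then obtain u where u: "u \<epsilon> M" "\<forall>z. z \<epsilon> M \<longrightarrow> (z \<epsilon> y \<and> z \<epsilon> c \<longleftrightarrow> z = u)" using c y by blast
    then show ?thesis using tr[OF _ yM] by blast
  qed
  then show ?thesis by blast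
qed

lemma mem_adjoin: "z \<epsilon> un (upr x (upr y y)) \<longleftrightarrow> z \<epsilon> x \<or> z = y"
  by auto

lemma trans_setD: "trans_set s \<Longrightarrow> x \<epsilon> y \<Longrightarrow> y \<epsilon> s \<Longrightarrow> x \<epsilon> s"
  by (auto simp: trans_set_def sub_def)

lemma Dfn_trans_set: "Dfn_term t \<Longrightarrow> Dfn (\<lambda>e. trans_set (t e))"
  by (rule Dfn_subst1[of trans_set]) (unfold trans_set_def, intro Dfn_intros)

end


section \<open>The cumulative hierarchy over a transitive set\<close>

text \<open>The levels of the cumulative hierarchy starting with the transitive set \<open>b\<close> are defined without
  ordinals: a history is a set of levels that contains all the earlier levels of each of its
  elements, and each element is determined by these.\<close>

locale hierarchy = lzfc_vp +
  fixes b :: 'a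
  assumes base_trans: "trans_set b"
begin

definition History :: "'a \<Rightarrow> bool" where
  "History h \<longleftrightarrow> (\<forall>s. s \<epsilon> h \<longrightarrow> (\<forall>x. x \<epsilon> s \<longleftrightarrow> x \<epsilon> b \<or> (\<exists>c. c \<epsilon> h \<and> c \<epsilon> s \<and> sub x c)))"

text \<open>The Scott-Potter form of the hierarchy, with \<open>b\<close> added to every level: if
  the history \<open>h\<close> consists of the levels before \<alpha>, then \<open>s\<close> is
  \<open>V_\<alpha>(b)\<close>, the union of \<open>b\<close> and the powersets of the earlier
  levels. The empty history gives \<open>b\<close> itself.\<close>

definition Level :: "'a \<Rightarrow> bool" where
  "Level s \<longleftrightarrow> (\<exists>h. History h \<and> (\<forall>x. x \<epsilon> s \<longleftrightarrow> x \<epsilon> b \<or> (\<exists>c. c \<epsilon> h \<and> sub x c)))"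

lemma Dfn_Level: "Dfn_term t \<Longrightarrow> Dfn (\<lambda>e. Level (t e))"
  by (rule Dfn_subst1[of Level]) (unfold Level_def History_def, intro Dfn_intros)

lemma History_mem: "History h \<Longrightarrow> s \<epsilon> h \<Longrightarrow> x \<epsilon> s \<longleftrightarrow> x \<epsilon> b \<or> (\<exists>c. c \<epsilon> h \<and> c \<epsilon> s \<and> sub x c)"
  unfolding History_def by blast

lemma base_transD: "x \<epsilon> y \<Longrightarrow> y \<epsilon> b \<Longrightarrow> x \<epsilon> b"
  using base_trans by (rule trans_setD)

lemma sub_trans: "sub x y \<Longrightarrow> sub y z \<Longrightarrow> sub x z"
  by (simp add: sub_def)

lemma subD: "sub x y \<Longrightarrow> z \<epsilon> x \<Longrightarrow> z \<epsilon> y"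
  by (simp add: sub_def)

lemma trans_set_sub: "trans_set s \<Longrightarrow> x \<epsilon> s \<Longrightarrow> sub x s"
  by (simp add: trans_set_def)

lemma Level_trans:
  assumes "Level s"
  shows "trans_set s"
proof -
  obtain h where h: "History h" "\<And>x. x \<epsilon> s \<longleftrightarrow> x \<epsilon> b \<or> (\<exists>c. c \<epsilon> h \<and> sub x c)"
    using assms unfolding Level_def by blast
  have "x \<epsilon> s" if xy: "x \<epsilon> y" "y \<epsilon> s" for x y
  proof (cases "y \<epsilon> b")
    case True
    then show ?thesis using base_transD xy(1) h(2) by blast
  next
    case False
    then obtain c where c: "c \<epsilon> h" "sub y c" using h(2) xy(2) by blast
    then have "x \<epsilon> c" using xy(1) subD by blast
    then show ?thesis using History_mem[OF h(1) c(1)] h(2) by blast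
  qed
  then show ?thesis by (simp add: trans_set_def sub_def)
qed

lemma Level_base: "Level s \<Longrightarrow> x \<epsilon> b \<Longrightarrow> x \<epsilon> s"
  unfolding Level_def by blast

lemma Level_not_in_base: "Level s \<Longrightarrow> \<not> s \<epsilon> b"
  using Level_base mem_irrefl by blast

text \<open>An element of a minimal nontransitive member lies in \<open>b\<close> or is a subset of
  an earlier member \<open>c\<close>. As \<open>c\<close> is transitive, the elements of that
  element are again subsets of \<open>c\<close>, so the member is transitive after all.\<close>

lemma History_trans:
  assumes h: "History h" and "s \<epsilon> h"
  shows "trans_set s"
proof (rule ccontr)
  assume "\<not> trans_set s"
  define T where "T = Collect_in h (\<lambda>s. \<not> trans_set s)"
  have "Dfn (\<lambda>e. \<not> trans_set (e 0))" by (intro Dfn_intros Dfn_trans_set)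
  then have T: "t \<epsilon> T \<longleftrightarrow> t \<epsilon> h \<and> \<not> trans_set t" for t unfolding T_def by (rule mem_Collect_in)
  have "s \<epsilon> T" using T assms(2) \<open>\<not> trans_set s\<close> by blast
  then obtain t where t: "t \<epsilon> T" "\<And>u. u \<epsilon> T \<Longrightarrow> \<not> u \<epsilon> t" by (rule foundation_set) blast
  have th: "t \<epsilon> h" using t(1) T by blast
  have "x \<epsilon> t" if xy: "x \<epsilon> y" "y \<epsilon> t" for x y
  proof (cases "y \<epsilon> b")
    case True
    then show ?thesis using base_transD xy(1) History_mem[OF h th] by blast
  next
    case False
    then obtain c where c: "c \<epsilon> h" "c \<epsilon> t" "sub y c" using History_mem[OF h th] xy(2) by blast
    then have "trans_set c" using t(2) T by blast
    moreover have "x \<epsilon> c" using c(3) xy(1) subD by blast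
    ultimately have "sub x c" by (rule trans_set_sub)
    then show ?thesis using History_mem[OF h th] c by blast
  qed
  then have "trans_set t" by (simp add: trans_set_def sub_def)
  then show False using t(1) T by blast
qed

text \<open>The members of \<open>h\<close> that belong to \<open>s\<close> form a history for
  \<open>s\<close>.\<close>

lemma History_Level:
  assumes h: "History h" and s: "s \<epsilon> h"
  shows "Level s"
proof -
  define g where "g = Collect_in h (\<lambda>c. c \<epsilon> s)"
  have "Dfn (\<lambda>e. e 0 \<epsilon> s)" by (intro Dfn_intros)
  then have g: "c \<epsilon> g \<longleftrightarrow> c \<epsilon> h \<and> c \<epsilon> s" for c unfolding g_def by (rule mem_Collect_in)
  have "x \<epsilon> t \<longleftrightarrow> x \<epsilon> b \<or> (\<exists>c. c \<epsilon> g \<and> c \<epsilon> t \<and> sub x c)" if "t \<epsilon> g" for t x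
  proof -
    have t: "t \<epsilon> h" "t \<epsilon> s" using that g by blast+
    then have "c \<epsilon> s" if "c \<epsilon> t" for c using trans_setD[OF History_trans[OF h s] that] by blast
    then show ?thesis using History_mem[OF h t(1), of x] g by blast
  qed
  then have "History g" unfolding History_def by blast
  moreover have "x \<epsilon> s \<longleftrightarrow> x \<epsilon> b \<or> (\<exists>c. c \<epsilon> g \<and> sub x c)" for x
    using History_mem[OF h s, of x] g by blast
  ultimately show ?thesis unfolding Level_def by blast
qed

text \<open>Eliminates the history: the levels inside \<open>s\<close> may take the place of the
  members of \<open>h\<close>.\<close>

lemma Level_mem:
  assumes "Level s"
  shows "x \<epsilon> s \<longleftrightarrow> x \<epsilon> b \<or> (\<exists>c. Level c \<and> c \<epsilon> s \<and> sub x c)"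
proof -
  obtain h where h: "History h" "\<And>x. x \<epsilon> s \<longleftrightarrow> x \<epsilon> b \<or> (\<exists>c. c \<epsilon> h \<and> sub x c)"
    using assms unfolding Level_def by blast
  show ?thesis
  proof
    assume "x \<epsilon> s"
    moreover have "c \<epsilon> s" if "c \<epsilon> h" for c using h(2) that sub_refl by blast
    ultimately show "x \<epsilon> b \<or> (\<exists>c. Level c \<and> c \<epsilon> s \<and> sub x c)"
      using h(2) History_Level[OF h(1)] by blast
  next
    assume "x \<epsilon> b \<or> (\<exists>c. Level c \<and> c \<epsilon> s \<and> sub x c)"
    then show "x \<epsilon> s"
    proof (elim disjE exE conjE)
      fix c assume c: "Level c" "c \<epsilon> s" "sub x c"
      \<comment> \<open>The level \<open>c\<close> includes \<open>b\<close>, so by irreflexivity it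
        is not an element of \<open>b\<close>. Its membership in \<open>s\<close> must come from the
        history.\<close>
      then obtain c' where "c' \<epsilon> h" "sub c c'" using h(2) Level_not_in_base by blast
      then show ?thesis using h(2) sub_trans[OF c(3)] by blast
    qed (use h(2) in blast)
  qed
qed

text \<open>Foundation for a definable class of levels. Its members inside \<open>s\<close> form a
  set, and since \<open>s\<close> is transitive a minimal one among them is minimal in the
  class.\<close>

lemma Level_least:
  assumes P: "Dfn (\<lambda>e. P (e 0))" and s: "Level s" "P s"
  obtains t where "Level t" "P t" "\<And>r. Level r \<Longrightarrow> r \<epsilon> t \<Longrightarrow> \<not> P r"
proof (cases "\<exists>t. t \<epsilon> s \<and> Level t \<and> P t")
  case False
  then show ?thesis using that s by blast
next
  case True
  define T where "T = Collect_in s (\<lambda>t. Level t \<and> P t)"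
  have "Dfn (\<lambda>e. Level (e 0) \<and> P (e 0))" by (intro Dfn_intros Dfn_Level P)
  then have T: "t \<epsilon> T \<longleftrightarrow> t \<epsilon> s \<and> Level t \<and> P t" for t unfolding T_def by (rule mem_Collect_in)
  obtain u where "u \<epsilon> T" using True T by blast
  then obtain t where t: "t \<epsilon> T" "\<And>u. u \<epsilon> T \<Longrightarrow> \<not> u \<epsilon> t" by (rule foundation_set) blast
  moreover have "r \<epsilon> s" if "r \<epsilon> t" for r
    using trans_setD[OF Level_trans[OF s(1)] that] t(1) T by blast
  ultimately show ?thesis using that T by blast
qed

text \<open>Let \<open>p\<close> be a least level incomparable with some level and \<open>q\<close>
  a least level incomparable with \<open>p\<close>. A level inside one of them is comparable with
  the other and, by transitivity, can only be an element of it. So \<open>p\<close> and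
  \<open>q\<close> have the same elements.\<close>

lemma Level_linear:
  assumes "Level s" "Level t"
  shows "s \<epsilon> t \<or> s = t \<or> t \<epsilon> s"
proof (rule ccontr)
  define C where "C s t \<longleftrightarrow> s \<epsilon> t \<or> s = t \<or> t \<epsilon> s" for s t
  assume "\<not> (s \<epsilon> t \<or> s = t \<or> t \<epsilon> s)"
  then have "\<exists>t. Level t \<and> \<not> C s t" using assms(2) unfolding C_def by blast
  moreover have "Dfn (\<lambda>e. \<exists>t. Level t \<and> \<not> C (e 0) t)"
    unfolding C_def by (intro Dfn_intros Dfn_Level)
  ultimately obtain p where p: "Level p" "\<exists>t. Level t \<and> \<not> C p t"
    "\<And>r. Level r \<Longrightarrow> r \<epsilon> p \<Longrightarrow> \<not> (\<exists>t. Level t \<and> \<not> C r t)"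
    using Level_least[of "\<lambda>s. \<exists>t. Level t \<and> \<not> C s t" s] assms(1) by blast
  obtain t' where t': "Level t'" "\<not> C p t'" using p(2) by blast
  have "Dfn (\<lambda>e. \<not> C p (e 0))" unfolding C_def by (intro Dfn_intros)
  then obtain q where q: "Level q" "\<not> C p q" "\<And>r. Level r \<Longrightarrow> r \<epsilon> q \<Longrightarrow> \<not> \<not> C p r"
    using Level_least[of "\<lambda>q. \<not> C p q" t'] t' by blast
  have "x \<epsilon> q" if x: "x \<epsilon> p" for x
  proof (cases "x \<epsilon> b")
    case False
    then obtain r where r: "Level r" "r \<epsilon> p" "sub x r" using Level_mem[OF p(1), of x] x by blast
    have "C r q" using p(3)[OF r(1,2)] q(1) by blast
    moreover have "\<not> q \<epsilon> r" "r \<noteq> q"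
      using q(2) r(2) trans_setD[OF Level_trans[OF p(1)], of q r] unfolding C_def by blast+
    ultimately have "r \<epsilon> q" unfolding C_def by blast
    then show ?thesis using Level_mem[OF q(1), of x] r by blast
  qed (rule Level_base[OF q(1)])
  moreover have "x \<epsilon> p" if x: "x \<epsilon> q" for x
  proof (cases "x \<epsilon> b")
    case False
    then obtain r where r: "Level r" "r \<epsilon> q" "sub x r" using Level_mem[OF q(1), of x] x by blast
    have "C p r" using q(3)[OF r(1,2)] by blast
    moreover have "\<not> p \<epsilon> r" "p \<noteq> r"
      using q(2) r(2) trans_setD[OF Level_trans[OF q(1)], of p r] unfolding C_def by blast+
    ultimately have "r \<epsilon> p" unfolding C_def by blast
    then show ?thesis using Level_mem[OF p(1), of x] r by blast
  qed (rule Level_base[OF p(1)])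
  ultimately have "p = q" using extensional by blast
  then show False using q(2) unfolding C_def by blast
qed

lemma LevelI:
  assumes "History h"
  shows "\<exists>s. Level s \<and> (\<forall>x. x \<epsilon> s \<longleftrightarrow> x \<epsilon> b \<or> (\<exists>c. c \<epsilon> h \<and> sub x c))"
proof -
  define s where "s = Collect_in (un (upr b (pow (un h)))) (\<lambda>x. x \<epsilon> b \<or> (\<exists>c. c \<epsilon> h \<and> sub x c))"
  have "Dfn (\<lambda>e. e 0 \<epsilon> b \<or> (\<exists>c. c \<epsilon> h \<and> sub (e 0) c))" by (intro Dfn_intros)
  then have "x \<epsilon> s \<longleftrightarrow> x \<epsilon> un (upr b (pow (un h))) \<and> (x \<epsilon> b \<or> (\<exists>c. c \<epsilon> h \<and> sub x c))" for x
    unfolding s_def by (rule mem_Collect_in)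
  moreover have "x \<epsilon> pow (un h)" if "c \<epsilon> h" "sub x c" for x c
    using that by (auto simp: sub_def)
  ultimately have "x \<epsilon> s \<longleftrightarrow> x \<epsilon> b \<or> (\<exists>c. c \<epsilon> h \<and> sub x c)" for x
    unfolding mem_un mem_upr by blast
  then show ?thesis using assms unfolding Level_def by blast
qed

text \<open>Burali-Forti: a set of all levels would be a history, and the level obtained from it
  would be an element of itself.\<close>

lemma Levels_proper: "\<not> (\<exists>h. \<forall>s. s \<epsilon> h \<longleftrightarrow> Level s)"
proof
  assume "\<exists>h. \<forall>s. s \<epsilon> h \<longleftrightarrow> Level s"
  then obtain h where h: "\<And>s. s \<epsilon> h \<longleftrightarrow> Level s" by blast
  have "History h" unfolding History_def h using Level_mem by blast
  then obtain s where "Level s" "\<And>x. x \<epsilon> s \<longleftrightarrow> x \<epsilon> b \<or> (\<exists>c. c \<epsilon> h \<and> sub x c)" using LevelI by blast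
  then have "s \<epsilon> s" using h sub_refl by blast
  then show False using mem_irrefl by blast
qed

definition successor :: "'a \<Rightarrow> 'a \<Rightarrow> bool" where
  "successor s t \<longleftrightarrow> (\<forall>x. x \<epsilon> t \<longleftrightarrow> x \<epsilon> b \<or> sub x s)"

lemma Level_successor:
  assumes s: "Level s"
  obtains t where "Level t" "successor s t"
proof -
  define g where "g = Collect_in s Level"
  have "Dfn (\<lambda>e. Level (e 0))" by (intro Dfn_intros Dfn_Level)
  then have g: "c \<epsilon> g \<longleftrightarrow> c \<epsilon> s \<and> Level c" for c unfolding g_def by (rule mem_Collect_in)
  \<comment> \<open>The levels inside \<open>s\<close> together with \<open>s\<close> are the
    history of the next level. All of them are subsets of \<open>s\<close>, so their powersets add
    nothing to that of \<open>s\<close>.\<close>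
  let ?h = "un (upr g (upr s s))"
  have h: "c \<epsilon> ?h \<longleftrightarrow> c = s \<or> c \<epsilon> s \<and> Level c" for c
    unfolding mem_adjoin g by blast
  have "History ?h"
    unfolding History_def
  proof (intro allI impI)
    fix r x assume "r \<epsilon> ?h"
    then have "r = s \<or> r \<epsilon> s \<and> Level r" unfolding h .
    then have r: "Level r" "r = s \<or> r \<epsilon> s" using s by blast+
    have "c \<epsilon> ?h \<and> c \<epsilon> r \<longleftrightarrow> Level c \<and> c \<epsilon> r" for c
      using r(2) h[of c] s trans_setD[OF Level_trans[OF s], of c r] by blast
    then show "x \<epsilon> r \<longleftrightarrow> x \<epsilon> b \<or> (\<exists>c. c \<epsilon> ?h \<and> c \<epsilon> r \<and> sub x c)"
      unfolding Level_mem[OF r(1), of x] by blast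
  qed
  then obtain t where t: "Level t" "\<And>x. x \<epsilon> t \<longleftrightarrow> x \<epsilon> b \<or> (\<exists>c. c \<epsilon> ?h \<and> sub x c)" using LevelI by blast
  have "(\<exists>c. c \<epsilon> ?h \<and> sub x c) \<longleftrightarrow> sub x s" for x
    unfolding h using sub_trans[of x _ s] trans_set_sub[OF Level_trans[OF s]] by blast
  then show ?thesis using that t unfolding successor_def by blast
qed

lemma Level_base_set: "Level b"
proof -
  have "History emp" by (simp add: History_def)
  then show ?thesis unfolding Level_def by (intro exI[of _ emp]) simp
qed

end

section \<open>Models of ZFC among the limit levels\<close>

context lzfc_vp
begin

lemma Om_mem_Nat: "Om w \<Longrightarrow> Nat n \<Longrightarrow> n \<epsilon> w"
  unfolding Nat_def Om_def sub_def by blast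

lemma Dfn_term_upd:
  assumes "Dfn_term t" "Dfn_term s" "Dfn_term r"
  shows "Dfn_term (\<lambda>e. upd (t e) (s e) (r e))"
proof (rule Dfn_termI)
  have "Dfn (\<lambda>e. e 0 = upd (e 1) (e 2) (e 3))"
    unfolding set_eq_iff[of "_ 0"] mem_upd by (intro Dfn_intros)
  then show "Dfn (\<lambda>e. e 0 = upd (t (\<lambda>i. e (Suc i))) (s (\<lambda>i. e (Suc i))) (r (\<lambda>i. e (Suc i))))"
    by (rule Dfn_subst4[of "\<lambda>x y z w. x = upd y z w"]) (intro Dfn_term_var Dfn_term_shift assms)+
qed

text \<open>The code for unique existence as it occurs in the premise of replacement, with
  \<open>w\<close> holding the unique value of \<open>v\<close>.\<close>

lemma Tr_unique_value:
  assumes a: "Func a n A" and p: "Form epsL n (cex w (call v (ciff p (cveq v w))))" and "v \<noteq> w"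
  shows "Tr A n (cex w (call v (ciff p (cveq v w)))) a \<longleftrightarrow>
    (\<exists>x. x \<epsilon> A \<and> (\<forall>y. y \<epsilon> A \<longrightarrow> (Tr A n p (upd (upd a w x) v y) \<longleftrightarrow> y = x)))"
proof -
  have form: "w \<epsilon> n" "Form epsL n (call v (ciff p (cveq v w)))"
    using Form_derived(4)[OF p] by blast+
  then have form': "v \<epsilon> n" "Form epsL n (ciff p (cveq v w))" using Form_call by blast+
  then have form'': "Form epsL n (cveq v w)" using Form_derived(3) by blast
  have body: "Tr A n (ciff p (cveq v w)) (upd (upd a w x) v y) \<longleftrightarrow>
      (Tr A n p (upd (upd a w x) v y) \<longleftrightarrow> y = x)" if "x \<epsilon> A" "y \<epsilon> A" for x y
  proof -
    have "Func (upd (upd a w x) v y) n A" using that a form form' by (intro Func_upd)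
    then show ?thesis
      using Tr_ciff[OF _ form'(2)] Tr_cveq[OF _ form''] \<open>v \<noteq> w\<close> by (simp add: ap_upd)
  qed
  then show ?thesis
    unfolding Tr_cex[OF a p]
    by (simp add: Tr_simps(3)[OF Func_upd[OF a form(1)] form(2)] body cong: conj_cong imp_cong)
qed

text \<open>The conclusion of replacement: the image of \<open>m\<close> under \<open>p\<close> is a
  set \<open>s\<close>. The inequalities ensure that the values of \<open>m\<close> and
  \<open>s\<close> survive the later updates.\<close>

lemma Tr_image:
  assumes a: "Func a n A"
    and p: "Form epsL n (cex s (call v (ciff (cvmem v s) (cex u (cand (cvmem u m) p)))))"
    and "v \<noteq> s" "m \<noteq> s" "m \<noteq> v" "m \<noteq> u"
  shows "Tr A n (cex s (call v (ciff (cvmem v s) (cex u (cand (cvmem u m) p))))) a \<longleftrightarrow>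
    (\<exists>z. z \<epsilon> A \<and> (\<forall>y. y \<epsilon> A \<longrightarrow>
      (y \<epsilon> z \<longleftrightarrow> (\<exists>x. x \<epsilon> A \<and> x \<epsilon> ap a m \<and> Tr A n p (upd (upd (upd a s z) v y) u x)))))"
proof -
  have f1: "s \<epsilon> n" "Form epsL n (call v (ciff (cvmem v s) (cex u (cand (cvmem u m) p))))"
    using Form_derived(4)[OF p] by blast+
  then have f2: "v \<epsilon> n" "Form epsL n (ciff (cvmem v s) (cex u (cand (cvmem u m) p)))"
    using Form_call by blast+
  then have f3: "Form epsL n (cvmem v s)" "Form epsL n (cex u (cand (cvmem u m) p))"
    using Form_derived(3) by blast+
  then have f4: "u \<epsilon> n" "Form epsL n (cand (cvmem u m) p)" using Form_derived(4) by blast+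
  then have f5: "Form epsL n (cvmem u m)" using Form_derived(2) by blast
  have "Tr A n (ciff (cvmem v s) (cex u (cand (cvmem u m) p))) (upd (upd a s z) v y) \<longleftrightarrow>
      (y \<epsilon> z \<longleftrightarrow> (\<exists>x. x \<epsilon> A \<and> x \<epsilon> ap a m \<and> Tr A n p (upd (upd (upd a s z) v y) u x)))"
    if zy: "z \<epsilon> A" "y \<epsilon> A" for z y
  proof -
    have a': "Func (upd (upd a s z) v y) n A" using zy a f1 f2 by (intro Func_upd)
    have "Tr A n (cand (cvmem u m) p) (upd (upd (upd a s z) v y) u x) \<longleftrightarrow>
        x \<epsilon> ap a m \<and> Tr A n p (upd (upd (upd a s z) v y) u x)" if "x \<epsilon> A" for x
      using Tr_cand[OF Func_upd[OF a' f4(1) that] f4(2)] Tr_cvmem[OF Func_upd[OF a' f4(1) that] f5] assms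
      by (simp add: ap_upd)
    then have "Tr A n (cex u (cand (cvmem u m) p)) (upd (upd a s z) v y) \<longleftrightarrow>
        (\<exists>x. x \<epsilon> A \<and> x \<epsilon> ap a m \<and> Tr A n p (upd (upd (upd a s z) v y) u x))"
      unfolding Tr_cex[OF a' f3(2)] by blast
    then show ?thesis
      unfolding Tr_ciff[OF a' f2(2)] using Tr_cvmem[OF a' f3(1)] assms by (simp add: ap_upd)
  qed
  then show ?thesis
    unfolding Tr_cex[OF a p]
    by (simp add: Tr_simps(3)[OF Func_upd[OF a f1(1)] f1(2)] cong: conj_cong imp_cong)
qed

lemma Tr_csep:
  assumes a: "Func a n A" and c: "Form epsL n (csep m p)" and m: "Nat m" "nn 0 \<epsilon> m"
  shows "Tr A n (csep m p) a \<longleftrightarrow> (\<forall>x. x \<epsilon> A \<longrightarrow> (\<exists>y. y \<epsilon> A \<and> (\<forall>z. z \<epsilon> A \<longrightarrow>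
    (z \<epsilon> y \<longleftrightarrow> z \<epsilon> x \<and> Tr A n p (upd (upd (upd a m x) (sc m) y) (nn 0) z)))))"
proof -
  let ?r = "ciff (cvmem (nn 0) (sc m)) (cand (cvmem (nn 0) m) p)"
  have f1: "m \<epsilon> n" "Form epsL n (cex (sc m) (call (nn 0) ?r))"
    using Form_call[OF c[unfolded csep_def]] by blast+
  then have f2: "sc m \<epsilon> n" "Form epsL n (call (nn 0) ?r)" using Form_derived(4) by blast+
  then have f3: "nn 0 \<epsilon> n" "Form epsL n ?r" using Form_call by blast+
  then have f4: "Form epsL n (cvmem (nn 0) (sc m))" "Form epsL n (cand (cvmem (nn 0) m) p)"
    using Form_derived(3) by blast+
  then have f5: "Form epsL n (cvmem (nn 0) m)" using Form_derived(2) by blast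
  have ne: "m \<noteq> nn 0" "sc m \<noteq> nn 0" "m \<noteq> sc m"
    using m mem_irrefl mem_sc[of "nn 0" m] mem_sc[of m m] by metis+
  have body: "Tr A n ?r (upd (upd (upd a m x) (sc m) y) (nn 0) z) \<longleftrightarrow>
      (z \<epsilon> y \<longleftrightarrow> z \<epsilon> x \<and> Tr A n p (upd (upd (upd a m x) (sc m) y) (nn 0) z))"
    if "x \<epsilon> A" "y \<epsilon> A" "z \<epsilon> A" for x y z
  proof -
    have a': "Func (upd (upd (upd a m x) (sc m) y) (nn 0) z) n A"
      using that a f1 f2 f3 by (intro Func_upd)
    show ?thesis
      unfolding Tr_ciff[OF a' f3(2)] Tr_cand[OF a' f4(2)] Tr_cvmem[OF a' f4(1)] Tr_cvmem[OF a' f5]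
      using ne by (simp add: ap_upd)
  qed
  have all: "Tr A n (call (nn 0) ?r) (upd (upd a m x) (sc m) y) \<longleftrightarrow>
      (\<forall>z. z \<epsilon> A \<longrightarrow> Tr A n ?r (upd (upd (upd a m x) (sc m) y) (nn 0) z))" if "x \<epsilon> A" "y \<epsilon> A" for x y
    using that a f1 f2 by (intro Tr_simps(3) Func_upd)
  have ex: "Tr A n (cex (sc m) (call (nn 0) ?r)) (upd a m x) \<longleftrightarrow>
      (\<exists>y. y \<epsilon> A \<and> Tr A n (call (nn 0) ?r) (upd (upd a m x) (sc m) y))" if "x \<epsilon> A" for x
    using that a f1 by (intro Tr_cex Func_upd)
  show ?thesis
    using Tr_simps(3)[OF a c[unfolded csep_def]] unfolding csep_def
    by (simp add: ex all body cong: conj_cong imp_cong)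
qed

lemma eps_str_dom: "StrDom (eps_str A) B \<longleftrightarrow> B = A"
  by (simp add: eps_str_def)

lemma Tr_coincidence:
  "Form epsL m p \<Longrightarrow> sub m n \<Longrightarrow> Func a n A \<Longrightarrow> Func b n A \<Longrightarrow> agree m a b \<Longrightarrow> Tr A n p a \<longleftrightarrow> Tr A n p b"
  unfolding epsL_eq eps_str_def by (rule Sat_coincidence)

end

text \<open>\<open>base_mem\<close> excludes the bottom level. With \<omega> in \<open>b\<close>,
  all natural numbers, codes of formulas and finite assignments will be elements of
  \<open>K\<close>.\<close>

locale limit_level = hierarchy +
  fixes K :: 'a
  assumes K_Level: "Level K" and base_mem: "b \<epsilon> K"
    and K_limit: "\<And>r. Level r \<Longrightarrow> r \<epsilon> K \<Longrightarrow> \<exists>t. Level t \<and> successor r t \<and> t \<epsilon> K"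
    and base_omega: "\<exists>w. Om w \<and> w \<epsilon> b"
begin

lemma K_trans: "x \<epsilon> y \<Longrightarrow> y \<epsilon> K \<Longrightarrow> x \<epsilon> K"
  by (rule trans_setD[OF Level_trans[OF K_Level]])

text \<open>Elements of \<open>b\<close> are covered by \<open>b\<close>, which is itself a level
  inside \<open>K\<close>; the other elements of \<open>K\<close> are covered by definition of a
  level.\<close>

lemma K_cover:
  assumes "x \<epsilon> K"
  obtains r where "Level r" "r \<epsilon> K" "sub x r"
proof (cases "x \<epsilon> b")
  case True
  then show ?thesis using that Level_base_set base_mem trans_set_sub[OF base_trans] by blast
next
  case False
  then show ?thesis using that Level_mem[OF K_Level, of x] assms by blast
qed

lemma K_cover2:
  assumes "x \<epsilon> K" "y \<epsilon> K"
  obtains r where "Level r" "r \<epsilon> K" "sub x r" "sub y r"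
proof -
  obtain r s where r: "Level r" "r \<epsilon> K" "sub x r" and s: "Level s" "s \<epsilon> K" "sub y s"
    using K_cover assms by metis
  consider "sub r s" | "sub s r"
    using Level_linear[OF r(1) s(1)] trans_set_sub[OF Level_trans] r(1) s(1) sub_refl by blast
  then show ?thesis using that r s sub_trans by cases blast+
qed

lemma K_sub: "sub x r \<Longrightarrow> Level r \<Longrightarrow> r \<epsilon> K \<Longrightarrow> x \<epsilon> K"
  using Level_mem[OF K_Level, of x] by blast

text \<open>A set of subsets of \<open>r\<close> is a subset of the successor of \<open>r\<close>,
  which is still inside the limit \<open>K\<close>.\<close>

lemma K_set:
  assumes "\<And>z. z \<epsilon> x \<Longrightarrow> sub z r" "Level r" "r \<epsilon> K"
  shows "x \<epsilon> K"
proof -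
  obtain t where t: "Level t" "successor r t" "t \<epsilon> K" using K_limit assms(2,3) by blast
  then have "sub x t" using assms(1) unfolding successor_def sub_def[of x] by blast
  then show ?thesis using K_sub t by blast
qed

lemma K_subset: "sub y x \<Longrightarrow> x \<epsilon> K \<Longrightarrow> y \<epsilon> K"
  using K_cover K_sub sub_trans by metis

lemma K_upr: "x \<epsilon> K \<Longrightarrow> y \<epsilon> K \<Longrightarrow> upr x y \<epsilon> K"
proof -
  assume "x \<epsilon> K" "y \<epsilon> K"
  then obtain r where "Level r" "r \<epsilon> K" "sub x r" "sub y r" by (rule K_cover2)
  then show ?thesis by - (rule K_set[of _ r], auto)
qed

lemma K_pr: "x \<epsilon> K \<Longrightarrow> y \<epsilon> K \<Longrightarrow> pr x y \<epsilon> K"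
  by (simp add: pr_def K_upr)

lemma K_un: "x \<epsilon> K \<Longrightarrow> un x \<epsilon> K"
proof -
  assume "x \<epsilon> K"
  then obtain r where r: "Level r" "r \<epsilon> K" "sub x r" by (rule K_cover)
  then have "sub (un x) r"
    unfolding sub_def[of "un x"] mem_un using trans_setD[OF Level_trans[OF r(1)]] subD by blast
  then show ?thesis using K_sub r by blast
qed

lemma K_pow: "x \<epsilon> K \<Longrightarrow> pow x \<epsilon> K"
proof -
  assume "x \<epsilon> K"
  then obtain r where "Level r" "r \<epsilon> K" "sub x r" by (rule K_cover)
  then show ?thesis by - (rule K_set[of _ r], simp_all add: sub_trans[of _ x r])
qed

lemma K_omega: "\<exists>w. Om w \<and> w \<epsilon> K"
  using base_omega Level_base[OF K_Level] by blast

lemma K_Nat: "Nat n \<Longrightarrow> n \<epsilon> K"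
  using K_omega Om_mem_Nat K_trans by blast

lemma K_emp: "emp \<epsilon> K"
  using K_Nat[OF Nat_nn[of 0]] by (simp add: nn.simps)

text \<open>Assignments must be elements of \<open>K\<close> to occur as arguments of the
  satisfaction relation on levels. Their length may be nonstandard, hence an induction inside the
  universe that splits off the last entry.\<close>

lemma K_Func:
  assumes "Nat n" "Func a n K"
  shows "a \<epsilon> K"
proof -
  have "Dfn (\<lambda>e. \<forall>a. Func a (e 0) K \<longrightarrow> a \<epsilon> K)" by (intro Dfn_intros)
  from this assms(1) have "\<forall>a. Func a n K \<longrightarrow> a \<epsilon> K"
  proof (rule Nat_induct)
    show "\<forall>a. Func a (nn 0) K \<longrightarrow> a \<epsilon> K"
    proof (intro allI impI)
      fix a assume a: "Func a (nn 0) K"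
      have "a = emp"
      proof (rule extensional)
        fix z
        have "\<not> z \<epsilon> a"
        proof
          assume "z \<epsilon> a"
          moreover from Func_elem[OF a this] obtain i y where "z = pr i y" by blast
          ultimately show False using Func_dom[OF a, of i] by (auto simp: nn.simps)
        qed
        then show "z \<epsilon> a \<longleftrightarrow> z \<epsilon> emp" by simp
      qed
      then show "a \<epsilon> K" using K_emp by simp
    qed
  next
    fix m assume m: "Nat m" and IH: "\<forall>a. Func a m K \<longrightarrow> a \<epsilon> K"
    show "\<forall>a. Func a (sc m) K \<longrightarrow> a \<epsilon> K"
    proof (intro allI impI)
      fix a assume a: "Func a (sc m) K"
      define c where "c = Collect_in a (\<lambda>q. \<exists>i y. q = pr i y \<and> i \<epsilon> m)"
      have "Dfn (\<lambda>e. \<exists>i y. e 0 = pr i y \<and> i \<epsilon> m)" by (intro Dfn_intros)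
      then have c: "q \<epsilon> c \<longleftrightarrow> q \<epsilon> a \<and> (\<exists>i y. q = pr i y \<and> i \<epsilon> m)" for q
        unfolding c_def by (rule mem_Collect_in)
      then have c': "pr i y \<epsilon> c \<longleftrightarrow> pr i y \<epsilon> a \<and> i \<epsilon> m" for i y by auto
      have "Func c m K"
      proof (rule FuncI)
        show "\<exists>x y. p = pr x y" if "p \<epsilon> c" for p using that c by blast
        show "i \<epsilon> m \<longleftrightarrow> (\<exists>y. pr i y \<epsilon> c)" for i
          unfolding c' using Func_dom[OF a, of i] by auto
        show "y = z" if "pr i y \<epsilon> c" "pr i z \<epsilon> c" for i y z
          using that Func_unique[OF a, of i y z] unfolding c' by blast
        show "y \<epsilon> K" if "pr i y \<epsilon> c" for i y
          using that Func_val[OF a, of i y] unfolding c' by blast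
      qed
      then have "c \<epsilon> K" using IH by blast
      have m': "m \<epsilon> sc m" by simp
      have "a = un (upr c (upr (pr m (ap a m)) (pr m (ap a m))))"
      proof (rule extensional)
        fix q
        have last: "pr m y \<epsilon> a \<longleftrightarrow> y = ap a m" for y by (rule pr_mem_iff[OF a m'])
        show "q \<epsilon> a \<longleftrightarrow> q \<epsilon> un (upr c (upr (pr m (ap a m)) (pr m (ap a m))))"
          unfolding mem_adjoin
        proof
          assume q: "q \<epsilon> a"
          with Func_elem[OF a q] obtain i y where iy: "q = pr i y" "pr i y \<epsilon> a" by blast
          then have "i \<epsilon> sc m" using Func_dom[OF a] by blast
          then show "q \<epsilon> c \<or> q = pr m (ap a m)" using iy c' last by auto
        next
          assume "q \<epsilon> c \<or> q = pr m (ap a m)"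
          then show "q \<epsilon> a" using c last by blast
        qed
      qed
      moreover have "pr m (ap a m) \<epsilon> K" using K_pr K_Nat[OF m] ap_in[OF a m'] by blast
      ultimately show "a \<epsilon> K" using \<open>c \<epsilon> K\<close> K_un K_upr by metis
    qed
  qed
  then show ?thesis using assms(2) by blast
qed

lemma K_tup: "x \<epsilon> K \<Longrightarrow> y \<epsilon> K \<Longrightarrow> tup x y \<epsilon> K"
  by (simp add: tup_def K_upr K_pr K_Nat Nat_nn)

lemma K_Form:
  assumes "Nat n" "Form epsL n p"
  shows "p \<epsilon> K"
proof -
  have "Dfn (\<lambda>e. e 0 \<epsilon> K)" by (intro Dfn_intros)
  with assms(2) show ?thesis
  proof (rule Form_induct)
    have nat: "nn k \<epsilon> K" for k by (rule K_Nat[OF Nat_nn])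
    have "k \<epsilon> K" if "k \<epsilon> n" for k using that Nat_mem[OF assms(1)] K_Nat by blast
    then have "t \<epsilon> K" if "Term epsL n t" for t
      using that nat by (auto simp: epsL_eq Term_rel_lang cvar_def intro!: K_pr)
    fix p assume p: "form_step epsL n (\<lambda>p. p \<epsilon> K) p"
    show "p \<epsilon> K"
      using p unfolding form_step_def
    proof (elim disjE exE conjE)
      fix t u assume "Term epsL n t" "Term epsL n u" "p = ceq t u"
      then show ?thesis using \<open>\<And>t. Term epsL n t \<Longrightarrow> t \<epsilon> K\<close> nat by (simp add: ceq_def K_pr)
    next
      fix r m ts assume *: "RelSym epsL r m" "FunOn (\<lambda>i. i \<epsilon> m) ts"
        "\<forall>i u. pr i u \<epsilon> ts \<longrightarrow> Term epsL n u" "p = crel r ts"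
      then have "r = nn 0" "m = nn 2" by (simp_all add: epsL_eq RelSym_rel_lang)
      then obtain x y where ts: "ts = tup x y" using *(2) FunOn_2E by blast
      then have "Term epsL n x" "Term epsL n y" using *(3) by (auto simp: mem_tup)
      then show ?thesis
        using \<open>\<And>t. Term epsL n t \<Longrightarrow> t \<epsilon> K\<close> nat *(4) \<open>r = nn 0\<close> ts by (simp add: crel_def K_pr K_tup)
    next
      assume "p = cbot"
      then show ?thesis using nat by (simp add: cbot_def K_pr)
    next
      fix q r assume "q \<epsilon> K" "r \<epsilon> K" "p = cimp q r"
      then show ?thesis using nat by (simp add: cimp_def K_pr)
    next
      fix k q assume "k \<epsilon> n" "q \<epsilon> K" "p = call k q"
      then show ?thesis
        using nat \<open>\<And>k. k \<epsilon> n \<Longrightarrow> k \<epsilon> K\<close> by (simp add: call_def K_pr)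
    qed
  qed
qed

lemma K_finite_axioms:
  assumes "p \<in> {extensionality, foundation, pairing, union, powerset, infinity, choice}"
  shows "holds (\<epsilon>) {x. x \<epsilon> K} e p"
proof -
  let ?C = "{x. x \<epsilon> K}"
  have tr: "x \<epsilon> K" if "x \<epsilon> y" "y \<epsilon> K" for x y using K_trans that .
  have "holds (\<epsilon>) ?C e extensionality"
    unfolding extensionality_def holds_frag using tr by (auto intro!: extensional)
  moreover have "holds (\<epsilon>) ?C e foundation"
  proof -
    have "\<exists>y. y \<epsilon> K \<and> y \<epsilon> x \<and> (\<forall>z. z \<epsilon> K \<longrightarrow> z \<epsilon> x \<longrightarrow> \<not> z \<epsilon> y)"
      if x: "x \<epsilon> K" and y: "y \<epsilon> x" for x y
    proof -
      obtain z where "z \<epsilon> x" "\<And>u. u \<epsilon> x \<Longrightarrow> \<not> u \<epsilon> z" using y by (rule foundation_set) blast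
      then show ?thesis using tr[OF _ x] by blast
    qed
    then show ?thesis unfolding foundation_def holds_frag by simp blast
  qed
  moreover have "holds (\<epsilon>) ?C e pairing"
  proof -
    have "\<exists>z. z \<epsilon> K \<and> (\<forall>w. w \<epsilon> K \<longrightarrow> (w \<epsilon> z \<longleftrightarrow> w = x \<or> w = y))" if "x \<epsilon> K" "y \<epsilon> K" for x y
      using K_upr[OF that] by (intro exI[of _ "upr x y"]) simp
    then show ?thesis unfolding pairing_def is_upair_def holds_frag by simp
  qed
  moreover have "holds (\<epsilon>) ?C e union"
  proof -
    have "\<exists>y. y \<epsilon> K \<and> (\<forall>z. z \<epsilon> K \<longrightarrow> (z \<epsilon> y \<longleftrightarrow> (\<exists>u. u \<epsilon> K \<and> u \<epsilon> x \<and> z \<epsilon> u)))" if "x \<epsilon> K" for x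
      using K_un[OF that] tr[OF _ that] by (intro exI[of _ "un x"]) auto
    then show ?thesis unfolding union_def holds_frag by simp
  qed
  moreover have "holds (\<epsilon>) ?C e powerset"
  proof -
    have "\<exists>y. y \<epsilon> K \<and> (\<forall>z. z \<epsilon> K \<longrightarrow> (z \<epsilon> y \<longleftrightarrow> (\<forall>w. w \<epsilon> K \<longrightarrow> w \<epsilon> z \<longrightarrow> w \<epsilon> x)))" if "x \<epsilon> K" for x
    proof -
      have "sub z x \<longleftrightarrow> (\<forall>w. w \<epsilon> K \<longrightarrow> w \<epsilon> z \<longrightarrow> w \<epsilon> x)" if "z \<epsilon> K" for z
        unfolding sub_def using tr[OF _ that] by blast
      then show ?thesis using K_pow[OF that] by (intro exI[of _ "pow x"]) simp
    qed
    then show ?thesis unfolding powerset_def subset_def holds_frag by simp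
  qed
  moreover have "holds (\<epsilon>) ?C e infinity"
  proof -
    obtain w where w: "Om w" "w \<epsilon> K" using K_omega by blast
    then have "emp \<epsilon> w" "\<And>x. x \<epsilon> w \<Longrightarrow> sc x \<epsilon> w" unfolding Om_def Ind_def by blast+
    then have "\<exists>w. w \<epsilon> K \<and> (\<exists>e. e \<epsilon> K \<and> (\<forall>z. z \<epsilon> K \<longrightarrow> \<not> z \<epsilon> e) \<and> e \<epsilon> w) \<and>
        (\<forall>x. x \<epsilon> K \<longrightarrow> x \<epsilon> w \<longrightarrow> (\<exists>y. y \<epsilon> K \<and> (\<forall>z. z \<epsilon> K \<longrightarrow> (z \<epsilon> y \<longleftrightarrow> z \<epsilon> x \<or> z = x)) \<and> y \<epsilon> w))"
      using w(2) K_emp tr[OF _ w(2)] mem_emp mem_sc by blast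
    then show ?thesis
      unfolding infinity_def is_inductive_def is_empty_def is_suc_def holds_frag by simp
  qed
  moreover have "holds (\<epsilon>) ?C e choice"
  proof -
    have "\<exists>c. c \<epsilon> K \<and> (\<forall>y. y \<epsilon> K \<longrightarrow> y \<epsilon> x \<longrightarrow>
        (\<exists>u. u \<epsilon> K \<and> (\<forall>z. z \<epsilon> K \<longrightarrow> (z \<epsilon> y \<and> z \<epsilon> c \<longleftrightarrow> z = u))))"
      if x: "x \<epsilon> K" and ne: "\<forall>y. y \<epsilon> K \<longrightarrow> y \<epsilon> x \<longrightarrow> (\<exists>z. z \<epsilon> K \<and> z \<epsilon> y)"
        and disj: "\<forall>y. y \<epsilon> K \<longrightarrow> (\<forall>z. z \<epsilon> K \<longrightarrow>
          y \<epsilon> x \<and> z \<epsilon> x \<and> (\<exists>u. u \<epsilon> K \<and> u \<epsilon> y \<and> u \<epsilon> z) \<longrightarrow> y = z)" for x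
    proof -
      have "\<exists>c. \<forall>y. y \<epsilon> x \<longrightarrow> (\<exists>u. \<forall>z. z \<epsilon> y \<and> z \<epsilon> c \<longleftrightarrow> z = u)"
      proof (rule choice_set)
        show "\<exists>z. z \<epsilon> y" if "y \<epsilon> x" for y using ne that tr[OF that x] by blast
        show "y = z" if "y \<epsilon> x" "z \<epsilon> x" "u \<epsilon> y" "u \<epsilon> z" for y z u
          using disj that tr[OF that(1) x] tr[OF that(2) x] tr[OF that(3)] by blast
      qed
      then obtain c where c: "\<And>y. y \<epsilon> x \<Longrightarrow> \<exists>u. \<forall>z. z \<epsilon> y \<and> z \<epsilon> c \<longleftrightarrow> z = u" by blast
      \<comment> \<open>The choice set of the universe is cut down to \<open>un x\<close>, which
        makes it a subset of an element of \<open>K\<close>.\<close>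
      define d where "d = Collect_in (un x) (\<lambda>z. z \<epsilon> c)"
      have "Dfn (\<lambda>e. e 0 \<epsilon> c)" by (intro Dfn_intros)
      then have d: "z \<epsilon> d \<longleftrightarrow> z \<epsilon> un x \<and> z \<epsilon> c" for z unfolding d_def by (rule mem_Collect_in)
      have "d \<epsilon> K" by (rule K_subset[OF _ K_un[OF x]]) (simp add: sub_def d)
      moreover have "\<exists>u. u \<epsilon> K \<and> (\<forall>z. z \<epsilon> K \<longrightarrow> (z \<epsilon> y \<and> z \<epsilon> d \<longleftrightarrow> z = u))" if y: "y \<epsilon> x" for y
      proof -
        obtain u where u: "\<And>z. z \<epsilon> y \<and> z \<epsilon> c \<longleftrightarrow> z = u" using c[OF y] by blast
        have "u \<epsilon> y" using u by blast
        then have "u \<epsilon> K" using tr[OF _ tr[OF y x]] by blast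
        moreover have "z \<epsilon> y \<and> z \<epsilon> d \<longleftrightarrow> z = u" for z using u[of z] y d[of z] by auto
        ultimately show ?thesis by blast
      qed
      ultimately show ?thesis by blast
    qed
    then show ?thesis unfolding choice_def holds_frag by simp
  qed
  ultimately show ?thesis using assms by blast
qed

text \<open>\<open>Tr\<close> is definable, so separation in the universe provides the set, and
  \<open>K\<close> contains all subsets of its elements.\<close>

lemma K_separation:
  assumes "Nat n" and a: "Func a n K" and c: "Form epsL n (csep m p)" and m: "Nat m" "nn 1 \<epsilon> m"
    and p: "Form epsL m p"
  shows "Tr K n (csep m p) a"
proof -
  have m0: "nn 0 \<epsilon> m"
    using Nat_mem_sub[OF m] by (simp add: sub_def nn_mem_iff)
  have f: "m \<epsilon> n" "sc m \<epsilon> n" "nn 0 \<epsilon> n" using c unfolding csep_def by (blast dest: Form_call Form_derived(4))+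
  have mn: "sub m n" using Nat_mem_sub[OF assms(1) f(1)] .
  show ?thesis
    unfolding Tr_csep[OF a c m(1) m0]
  proof (intro allI impI)
    fix x assume x: "x \<epsilon> K"
    \<comment> \<open>The axiom evaluates \<open>p\<close> under an assignment that has
      \<open>y\<close> itself as value at \<open>sc m\<close>. Since \<open>m\<close> and
      \<open>sc m\<close> are not variables of \<open>p\<close>, the assignment
      \<open>upd a (nn 0) z\<close> can be used instead, which avoids the circularity.\<close>
    define y where "y = Collect_in x (\<lambda>z. Tr K n p (upd a (nn 0) z))"
    have "Dfn (\<lambda>e. Tr K n p (upd a (nn 0) (e 0)))" by (intro Dfn_intros Dfn_term_upd)
    then have y: "z \<epsilon> y \<longleftrightarrow> z \<epsilon> x \<and> Tr K n p (upd a (nn 0) z)" for z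
      unfolding y_def by (rule mem_Collect_in)
    have yK: "y \<epsilon> K" by (rule K_subset[OF _ x]) (simp add: sub_def y)
    have "Tr K n p (upd (upd (upd a m x) (sc m) y) (nn 0) z) \<longleftrightarrow> Tr K n p (upd a (nn 0) z)"
      if z: "z \<epsilon> K" for z
    proof (rule Tr_coincidence[OF p mn])
      have "i \<noteq> m" "i \<noteq> sc m" if "i \<epsilon> m" for i
        using that mem_irrefl[of m] mem_irrefl[of "sc m"] mem_sc[of i m] by blast+
      then show "agree m (upd (upd (upd a m x) (sc m) y) (nn 0) z) (upd a (nn 0) z)"
        by (simp add: agree_def pr_mem_upd)
      show "Func (upd (upd (upd a m x) (sc m) y) (nn 0) z) n K"
        using a f x yK z by (intro Func_upd)
      show "Func (upd a (nn 0) z) n K" using a f z by (intro Func_upd)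
    qed
    then show "\<exists>y. y \<epsilon> K \<and> (\<forall>z. z \<epsilon> K \<longrightarrow>
        (z \<epsilon> y \<longleftrightarrow> z \<epsilon> x \<and> Tr K n p (upd (upd (upd a m x) (sc m) y) (nn 0) z)))"
      using yK y by blast
  qed
qed

end

locale elementary_level = limit_level +
  fixes N :: 'a
  assumes N_Level: "Level N" and K_mem: "K \<epsilon> N"
    and elementary: "\<And>n p a. Nat n \<Longrightarrow> Form epsL n p \<Longrightarrow> Func a n K \<Longrightarrow> Tr K n p a \<longleftrightarrow> Tr N n p a"
begin

lemma K_sub_N: "x \<epsilon> K \<Longrightarrow> x \<epsilon> N"
  using trans_setD[OF Level_trans[OF N_Level]] K_mem by blast

lemma Func_N: "Func a n K \<Longrightarrow> Func a n N"
  unfolding Func_def using K_sub_N by blast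

text \<open>The image of a set \<open>x \<in> K\<close> under a definable function of \<open>K\<close> is a subset of \<open>K \<in> N\<close>, hence an
  element of the level \<open>N\<close>. So \<open>N\<close> satisfies that this image is a set, and by elementarity \<open>K\<close> does.\<close>

lemma K_replacement:
  assumes n: "Nat n" and a: "Func a n K" and c: "Form epsL n (crepl m p)" and m: "Nat m" "nn 1 \<epsilon> m"
    and p: "Form epsL m p"
  shows "Tr K n (crepl m p) a"
proof -
  let ?\<theta> = "cex (sc (sc m)) (call (nn 1) (ciff p (cveq (nn 1) (sc (sc m)))))"
  let ?H = "call (nn 0) (cimp (cvmem (nn 0) m) ?\<theta>)"
  let ?\<psi> = "cex (sc m) (call (nn 1) (ciff (cvmem (nn 1) (sc m)) (cex (nn 0) (cand (cvmem (nn 0) m) p))))"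
  have f1: "m \<epsilon> n" "Form epsL n (cimp ?H ?\<psi>)" using Form_call[OF c[unfolded crepl_def]] by blast+
  have f2: "Form epsL n ?H" "Form epsL n ?\<psi>" using Form_cimp[OF f1(2)] by blast+
  have f3: "nn 0 \<epsilon> n" "Form epsL n (cimp (cvmem (nn 0) m) ?\<theta>)" using Form_call[OF f2(1)] by blast+
  have f4: "Form epsL n (cvmem (nn 0) m)" "Form epsL n ?\<theta>" using Form_cimp[OF f3(2)] by blast+
  have f5: "sc (sc m) \<epsilon> n" "Form epsL n (call (nn 1) (ciff p (cveq (nn 1) (sc (sc m)))))"
    using Form_derived(4)[OF f4(2)] by blast+
  have f6: "nn 1 \<epsilon> n" "Form epsL n (ciff p (cveq (nn 1) (sc (sc m))))" using Form_call[OF f5(2)] by blast+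
  have fp: "Form epsL n p" using Form_derived(3)[OF f6(2)] by blast
  have f7: "sc m \<epsilon> n" using Form_derived(4)[OF f2(2)] by blast
  have mn: "sub m n" using Nat_mem_sub[OF n f1(1)] .
  have m0: "nn 0 \<epsilon> m" using Nat_mem_sub[OF m] by (simp add: sub_def nn_mem_iff)
  have ne: "i \<noteq> m" "i \<noteq> sc m" "i \<noteq> sc (sc m)" if "i \<epsilon> m" for i
    using that mem_irrefl[of m] mem_irrefl[of "sc m"] mem_irrefl[of "sc (sc m)"]
      mem_sc[of i m] mem_sc[of i "sc m"] by blast+
  note ne0 = ne[OF m0] and ne1 = ne[OF m(2)]
  have nem: "m \<noteq> sc m" using mem_irrefl[of m] mem_sc[of m m] by metis
  \<comment> \<open>The two occurrences of \<open>p\<close> in the axiom are evaluated under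
    different updates of the fresh variables. As \<open>p\<close> has its variables below
    \<open>m\<close>, both reduce to the assignment \<open>c u v\<close>, which gives the first two
    variables the values \<open>u\<close> and \<open>v\<close>.\<close>
  define c where "c u v = upd (upd a (nn 0) u) (nn 1) v" for u v
  have c1: "Tr A n p (upd (upd (upd (upd a m x) (nn 0) u) (sc (sc m)) w) (nn 1) v) \<longleftrightarrow> Tr A n p (c u v)"
    if "Func a n A" "x \<epsilon> A" "u \<epsilon> A" "w \<epsilon> A" "v \<epsilon> A" for A x u w v
  proof (rule Tr_coincidence[OF p mn])
    show "Func (upd (upd (upd (upd a m x) (nn 0) u) (sc (sc m)) w) (nn 1) v) n A"
      using that f1 f3 f5 f6 by (intro Func_upd)
    show "Func (c u v) n A" unfolding c_def using that f3 f6 by (intro Func_upd)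
    show "agree m (upd (upd (upd (upd a m x) (nn 0) u) (sc (sc m)) w) (nn 1) v) (c u v)"
      using ne by (simp add: agree_def pr_mem_upd c_def)
  qed
  have c2: "Tr A n p (upd (upd (upd (upd a m x) (sc m) z) (nn 1) v) (nn 0) u) \<longleftrightarrow> Tr A n p (c u v)"
    if "Func a n A" "x \<epsilon> A" "u \<epsilon> A" "z \<epsilon> A" "v \<epsilon> A" for A x u z v
  proof (rule Tr_coincidence[OF p mn])
    show "Func (upd (upd (upd (upd a m x) (sc m) z) (nn 1) v) (nn 0) u) n A"
      using that f1 f3 f7 f6 by (intro Func_upd)
    show "Func (c u v) n A" unfolding c_def using that f3 f6 by (intro Func_upd)
    show "agree m (upd (upd (upd (upd a m x) (sc m) z) (nn 1) v) (nn 0) u) (c u v)"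
      using ne by (simp add: agree_def pr_mem_upd c_def)
  qed
  have elem_c: "Tr K n p (c u v) \<longleftrightarrow> Tr N n p (c u v)" if "u \<epsilon> K" "v \<epsilon> K" for u v
    unfolding c_def using that a f3 f6 by (intro elementary n fp Func_upd)
  have "Tr K n (cimp ?H ?\<psi>) (upd a m x)" if x: "x \<epsilon> K" for x
  proof -
    let ?a = "upd a m x"
    have a1: "Func ?a n K" using a f1(1) x by (rule Func_upd)
    have "Tr K n ?\<psi> ?a" if H: "Tr K n ?H ?a"
    proof -
      have \<theta>: "Tr K n ?\<theta> (upd ?a (nn 0) u)" if u: "u \<epsilon> x" for u
      proof -
        have uK: "u \<epsilon> K" using K_trans[OF u x] .
        then have a2: "Func (upd ?a (nn 0) u) n K" by (rule Func_upd[OF a1 f3(1)])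
        have "Tr K n (cimp (cvmem (nn 0) m) ?\<theta>) (upd ?a (nn 0) u)"
          using H uK unfolding Tr_simps(3)[OF a1 f2(1)] by blast
        moreover have "Tr K n (cvmem (nn 0) m) (upd ?a (nn 0) u)"
          unfolding Tr_cvmem[OF a2 f4(1)] using u ne0 by (simp add: ap_upd)
        ultimately show ?thesis using Tr_simps(2)[OF a2 f3(2)] by blast
      qed
      \<comment> \<open>Uniqueness of the value is expressed by the formula \<open>?\<theta>\<close>
        and passes to \<open>N\<close> by elementarity. So a value found in \<open>N\<close> is the
        one found in \<open>K\<close>, and the image as seen in \<open>N\<close> has no further
        elements.\<close>
      have image_in_K: "v \<epsilon> K \<and> Tr K n p (c u v)" if u: "u \<epsilon> x" and v: "v \<epsilon> N" "Tr N n p (c u v)" for u v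
      proof -
        have uK: "u \<epsilon> K" using K_trans[OF u x] .
        then have a2: "Func (upd ?a (nn 0) u) n K" by (rule Func_upd[OF a1 f3(1)])
        note unique = Tr_unique_value[OF _ f4(2) ne1(3)]
        obtain w where w: "w \<epsilon> K" "\<And>y. y \<epsilon> K \<Longrightarrow> Tr K n p (c u y) \<longleftrightarrow> y = w"
          using \<theta>[OF u] unfolding unique[OF a2] by (auto simp: c1[OF a x uK])
        have "Tr N n ?\<theta> (upd ?a (nn 0) u)" using \<theta>[OF u] elementary[OF n f4(2) a2] by blast
        then obtain w' where w': "w' \<epsilon> N" "\<And>y. y \<epsilon> N \<Longrightarrow> Tr N n p (c u y) \<longleftrightarrow> y = w'"
          unfolding unique[OF Func_N[OF a2]]
          by (auto simp: c1[OF Func_N[OF a] K_sub_N[OF x] K_sub_N[OF uK]])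
        have "Tr N n p (c u w)" using w w' elem_c[OF uK w(1)] by blast
        then have "w = w'" using w'(2) K_sub_N[OF w(1)] by blast
        moreover have "v = w'" using v w'(2) by blast
        ultimately show ?thesis using w by blast
      qed
      define B where "B = Collect_in K (\<lambda>v. \<exists>u. u \<epsilon> x \<and> Tr K n p (c u v))"
      have "Dfn (\<lambda>e. \<exists>u. u \<epsilon> x \<and> Tr K n p (c u (e 0)))"
        unfolding c_def by (intro Dfn_intros Dfn_term_upd)
      then have B: "v \<epsilon> B \<longleftrightarrow> v \<epsilon> K \<and> (\<exists>u. u \<epsilon> x \<and> Tr K n p (c u v))" for v
        unfolding B_def by (rule mem_Collect_in)
      have "sub B K" by (simp add: sub_def B)
      then have BN: "B \<epsilon> N" using Level_mem[OF N_Level, of B] K_Level K_mem by blast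
      have "v \<epsilon> B \<longleftrightarrow> (\<exists>u. u \<epsilon> N \<and> u \<epsilon> ap ?a m \<and>
          Tr N n p (upd (upd (upd ?a (sc m) B) (nn 1) v) (nn 0) u))" if v: "v \<epsilon> N" for v
      proof
        assume "v \<epsilon> B"
        then obtain u where u: "u \<epsilon> x" "v \<epsilon> K" "Tr K n p (c u v)" using B by blast
        have uK: "u \<epsilon> K" using K_trans[OF u(1) x] .
        have "Tr N n p (c u v)" using u elem_c[OF uK] by blast
        then have "Tr N n p (upd (upd (upd ?a (sc m) B) (nn 1) v) (nn 0) u)"
          using c2[OF Func_N[OF a] K_sub_N[OF x] K_sub_N[OF uK] BN v] by blast
        moreover have "u \<epsilon> ap ?a m" using u(1) by (simp add: ap_upd)
        ultimately show "\<exists>u. u \<epsilon> N \<and> u \<epsilon> ap ?a m \<and>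
            Tr N n p (upd (upd (upd ?a (sc m) B) (nn 1) v) (nn 0) u)"
          using K_sub_N[OF uK] by blast
      next
        assume "\<exists>u. u \<epsilon> N \<and> u \<epsilon> ap ?a m \<and> Tr N n p (upd (upd (upd ?a (sc m) B) (nn 1) v) (nn 0) u)"
        then obtain u where u: "u \<epsilon> N" "u \<epsilon> x" "Tr N n p (upd (upd (upd ?a (sc m) B) (nn 1) v) (nn 0) u)"
          by (auto simp: ap_upd)
        then have "Tr N n p (c u v)" using c2[OF Func_N[OF a] K_sub_N[OF x] u(1) BN v] by blast
        then show "v \<epsilon> B" using image_in_K[OF u(2) v] B u(2) by blast
      qed
      then have "Tr N n ?\<psi> ?a"
        using BN Tr_image[OF Func_N[OF a1] f2(2)] ne0 ne1 nem by blast
      then show ?thesis using elementary[OF n f2(2) a1] by blast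
    qed
    then show ?thesis using Tr_simps(2)[OF a1 f1(2)] by blast
  qed
  then show ?thesis unfolding crepl_def using Tr_simps(3)[OF a c[unfolded crepl_def]] by blast
qed

lemma K_Model: "Model K"
  unfolding Model_def EpsStr_iff
proof (intro conjI exI allI impI)
  show "trans_set K" by (rule Level_trans[OF K_Level])
  show "b \<epsilon> K" by (rule base_mem)
  fix c assume c: "ZFAx c"
  show "Valid epsL (eps_str K) c"
    unfolding Valid_def eps_str_dom
  proof (intro allI impI)
    fix n A a assume *: "Nat n \<and> Form epsL n c \<and> A = K \<and> Func a n A"
    then have n: "Nat n" "Form epsL n c" "Func a n K" by blast+
    from c show "Tr K n c a"
      unfolding ZFAx_def
    proof (elim disjE bexE exE conjE)
      fix p assume p: "p \<in> {extensionality, foundation, pairing, union, powerset, infinity, choice}"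
        "c = code 0 p"
      show ?thesis
        unfolding p(2) Tr_code[OF closed_axioms[OF p(1)] n(2)[unfolded p(2)] n(3)]
        by (rule K_finite_axioms[OF p(1)])
    next
      fix m p assume "Nat m" "nn 1 \<epsilon> m" "Form epsL m p" "c = csep m p"
      then show ?thesis using K_separation n by blast
    next
      fix m p assume "Nat m" "nn 1 \<epsilon> m" "Form epsL m p" "c = crepl m p"
      then show ?thesis using K_replacement n by blast
    qed
  qed
qed (rule refl)

text \<open>The identity on \<open>K\<close> is a set by separation, and composing an assignment
  with it returns the assignment. The claim is thus \<open>elementary\<close>.\<close>

lemma K_ElSub: "ElSub K N"
proof -
  define j where "j = Collect_in (prod K K) (\<lambda>q. \<exists>x. q = pr x x)"
  have "Dfn (\<lambda>e. \<exists>x. e 0 = pr x x)" by (intro Dfn_intros)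
  then have j: "q \<epsilon> j \<longleftrightarrow> q \<epsilon> prod K K \<and> (\<exists>x. q = pr x x)" for q
    unfolding j_def by (rule mem_Collect_in)
  then have j': "pr x y \<epsilon> j \<longleftrightarrow> x \<epsilon> K \<and> x = y" for x y by auto
  have jF: "Func j K N"
  proof (rule FuncI)
    show "\<exists>x y. p = pr x y" if "p \<epsilon> j" for p using that j by blast
  qed (auto simp: j' K_sub_N)
  have comp: "c = a" if a: "Func a n K" and c: "Comp j a c" for n a c
  proof -
    have "(\<exists>u. pr i u \<epsilon> a) \<longleftrightarrow> i \<epsilon> n" for i using Func_dom[OF a] by blast
    then have cf: "FunOn (\<lambda>i. i \<epsilon> n) c" using c unfolding Comp_def by simp
    have "pr i y \<epsilon> c" if iy: "pr i y \<epsilon> a" for i y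
    proof -
      have "i \<epsilon> n" using Func_dom[OF a] iy by blast
      then obtain z where z: "pr i z \<epsilon> c" using FunOn_dom[OF cf] by blast
      then have "pr y z \<epsilon> j" using c iy unfolding Comp_def by blast
      then show ?thesis using z j' by simp
    qed
    then show ?thesis using FunOn_ext[OF Func_FunOn[OF a] cf] by simp
  qed
  have "Elem epsL (eps_str K) (eps_str N) j"
    unfolding Elem_def eps_str_dom
  proof (rule exI[of _ K], rule exI[of _ N], intro conjI refl jF allI impI)
    fix n p a c assume *: "Nat n \<and> Form epsL n p \<and> Func a n K \<and> Comp j a c"
    then have "c = a" using comp by blast
    then show "Tr K n p a \<longleftrightarrow> Tr N n p c" using elementary * by simp
  qed
  then show ?thesis
    unfolding ElSub_def EpsStr_iff using j' base_mem K_sub_N[OF base_mem] by blast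
qed

end

section \<open>Extendible models from Vopenka's Principle\<close>

context hierarchy
begin

text \<open>The relations of the structure on \<open>\<eta> \<union> {\<eta>}\<close>, for a level \<open>\<eta>\<close>. Index \<open>0\<close> makes the
  embeddings fix \<open>b\<close> and its elements, index \<open>5\<close> makes them move \<open>\<eta>\<close>.\<close>

definition level_rel :: "'a \<Rightarrow> 'a \<Rightarrow> 'a \<Rightarrow> 'a \<Rightarrow> 'a \<Rightarrow> bool" where
  "level_rel \<eta> i y u v \<longleftrightarrow>
     i = nn 0 \<and> u = y \<or>
     i = nn 1 \<and> u \<epsilon> v \<or>
     i = nn 2 \<and> sub u v \<and> Level v \<or>
     i = nn 3 \<and> (\<exists>n p a X. v = pr n (pr p a) \<and> EpsStr u X \<and> Sat X n p a) \<or>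
     i = nn 4 \<and> Model u \<or>
     i = nn 5 \<and> u = \<eta> \<or>
     i = nn 6 \<and> successor u v"

lemma level_rel_simps:
  "level_rel \<eta> (nn 0) y u v \<longleftrightarrow> u = y"
  "level_rel \<eta> (nn 1) y u v \<longleftrightarrow> u \<epsilon> v"
  "level_rel \<eta> (nn 2) y u v \<longleftrightarrow> sub u v \<and> Level v"
  "level_rel \<eta> (nn 3) y u v \<longleftrightarrow> (\<exists>n p a X. v = pr n (pr p a) \<and> EpsStr u X \<and> Sat X n p a)"
  "level_rel \<eta> (nn 4) y u v \<longleftrightarrow> Model u"
  "level_rel \<eta> (nn 5) y u v \<longleftrightarrow> u = \<eta>"
  "level_rel \<eta> (nn 6) y u v \<longleftrightarrow> successor u v"
  by (simp_all add: level_rel_def)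

text \<open>All relations are made binary to fit \<open>rel_structure\<close>: unary properties are
  read off the first argument, and for satisfaction the second argument packs the length, the
  formula and the assignment.\<close>

definition level_ext :: "'a \<Rightarrow> 'a \<Rightarrow> 'a \<Rightarrow> bool" where
  "level_ext \<eta> r e \<longleftrightarrow> (\<exists>i y. r = pr i y \<and>
     (\<forall>s. s \<epsilon> e \<longleftrightarrow> (\<exists>u v. u \<epsilon> sc \<eta> \<and> v \<epsilon> sc \<eta> \<and> s = tup u v \<and> level_rel \<eta> i y u v)))"

text \<open>Pairing the seven indices with the elements of \<open>sc b\<close> provides, at index 0,
  a name for each element of \<open>b\<close> and for \<open>b\<close> itself.\<close>

definition symbols :: 'a where
  "symbols = prod (nn 7) (sc b)"

definition level_interp :: "'a \<Rightarrow> 'a \<Rightarrow> bool" where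
  "level_interp \<eta> I \<longleftrightarrow> (\<forall>q. q \<epsilon> I \<longleftrightarrow> (\<exists>r e. r \<epsilon> symbols \<and> q = pr r e \<and> level_ext \<eta> r e))"

text \<open>The domain includes \<eta> itself, to ensure that an embedding between structures of
  distinct levels moves at least one level in its domain.\<close>

definition level_structure :: "'a \<Rightarrow> bool" where
  "level_structure X \<longleftrightarrow> (\<exists>\<eta> I. Level \<eta> \<and> level_interp \<eta> I \<and> X = pr (sc \<eta>) (pr I emp))"

lemma Dfn_successor: "Dfn_term t \<Longrightarrow> Dfn_term s \<Longrightarrow> Dfn (\<lambda>e. successor (t e) (s e))"
  by (rule Dfn_subst2[of successor]) (unfold successor_def, intro Dfn_intros)

lemma Dfn_level_ext:
  "Dfn_term t \<Longrightarrow> Dfn_term s \<Longrightarrow> Dfn_term r \<Longrightarrow> Dfn (\<lambda>e. level_ext (t e) (s e) (r e))"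
  by (rule Dfn_subst3[of level_ext])
    (unfold level_ext_def level_rel_def tup_def, intro Dfn_intros Dfn_Level Dfn_successor)

lemma Dfn_level_structure: "Dfn (\<lambda>e. level_structure (e 0))"
  unfolding level_structure_def level_interp_def by (intro Dfn_intros Dfn_Level Dfn_level_ext)

text \<open>The bound by a double powerset lets the interpretation be separated from one product
  later, in place of replacement over the symbols.\<close>

lemma ex_level_ext:
  assumes "r \<epsilon> symbols"
  obtains e where "level_ext \<eta> r e" "e \<epsilon> pow (pow (prod (nn 2) (sc \<eta>)))"
proof -
  obtain i y where r: "r = pr i y" using assms by (auto simp: symbols_def)
  let ?P = "\<lambda>s. \<exists>u v. u \<epsilon> sc \<eta> \<and> v \<epsilon> sc \<eta> \<and> s = tup u v \<and> level_rel \<eta> i y u v"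
  define e where "e = Collect_in (pow (prod (nn 2) (sc \<eta>))) ?P"
  have "Dfn (\<lambda>e. ?P (e 0))"
    unfolding level_rel_def tup_def by (intro Dfn_intros Dfn_Level Dfn_successor)
  then have e: "s \<epsilon> e \<longleftrightarrow> s \<epsilon> pow (prod (nn 2) (sc \<eta>)) \<and> ?P s" for s
    unfolding e_def by (rule mem_Collect_in)
  have "tup u v \<epsilon> pow (prod (nn 2) (sc \<eta>))" if "u \<epsilon> sc \<eta>" "v \<epsilon> sc \<eta>" for u v
    using that by (intro Func_in_pow) (simp add: Func_tup)
  then have "s \<epsilon> e \<longleftrightarrow> ?P s" for s using e by blast
  then have "level_ext \<eta> r e" unfolding level_ext_def r by blast
  moreover have "e \<epsilon> pow (pow (prod (nn 2) (sc \<eta>)))"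
    unfolding mem_pow[of e] sub_def[of e] using e by blast
  ultimately show ?thesis by (rule that)
qed

lemma level_ext_unique: "level_ext \<eta> r e \<Longrightarrow> level_ext \<eta> r e' \<Longrightarrow> e = e'"
  unfolding level_ext_def by (auto simp: set_eq_iff[of e e'])

lemma ex_level_interp: "\<exists>I. level_interp \<eta> I"
proof -
  let ?U = "prod symbols (pow (pow (prod (nn 2) (sc \<eta>))))"
  define I where "I = Collect_in ?U (\<lambda>q. \<exists>r e. q = pr r e \<and> level_ext \<eta> r e)"
  have "Dfn (\<lambda>e'. \<exists>r e. e' 0 = pr r e \<and> level_ext \<eta> r e)" by (intro Dfn_intros Dfn_level_ext)
  then have I: "q \<epsilon> I \<longleftrightarrow> q \<epsilon> ?U \<and> (\<exists>r e. q = pr r e \<and> level_ext \<eta> r e)" for q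
    unfolding I_def by (rule mem_Collect_in)
  have U: "pr r e \<epsilon> ?U" if re: "r \<epsilon> symbols" "level_ext \<eta> r e" for r e
  proof -
    obtain e' where e': "level_ext \<eta> r e'" "e' \<epsilon> pow (pow (prod (nn 2) (sc \<eta>)))"
      by (rule ex_level_ext[OF re(1)])
    have "e = e'" by (rule level_ext_unique[OF re(2) e'(1)])
    then show ?thesis unfolding mem_prod using e'(2) re(1) by blast
  qed
  have "level_interp \<eta> I"
    unfolding level_interp_def
  proof
    fix q
    show "q \<epsilon> I \<longleftrightarrow> (\<exists>r e. r \<epsilon> symbols \<and> q = pr r e \<and> level_ext \<eta> r e)"
    proof
      assume "q \<epsilon> I"
      then obtain r e where "q = pr r e" "level_ext \<eta> r e" "q \<epsilon> ?U" using I by blast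
      then show "\<exists>r e. r \<epsilon> symbols \<and> q = pr r e \<and> level_ext \<eta> r e" by auto
    next
      assume "\<exists>r e. r \<epsilon> symbols \<and> q = pr r e \<and> level_ext \<eta> r e"
      then obtain r e where "r \<epsilon> symbols" "q = pr r e" "level_ext \<eta> r e" by blast
      then show "q \<epsilon> I" using I[of q] U[of r e] by blast
    qed
  qed
  then show ?thesis ..
qed

lemma level_interp_mem: "level_interp \<eta> I \<Longrightarrow> pr r e \<epsilon> I \<longleftrightarrow> r \<epsilon> symbols \<and> level_ext \<eta> r e"
  unfolding level_interp_def by simp

lemma level_ext_tup:
  "level_ext \<eta> (pr i y) e \<Longrightarrow> tup u v \<epsilon> e \<longleftrightarrow> u \<epsilon> sc \<eta> \<and> v \<epsilon> sc \<eta> \<and> level_rel \<eta> i y u v"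
  unfolding level_ext_def by auto

lemma level_structure_rel:
  assumes "level_interp \<eta> I"
  shows "rel_structure symbols (sc \<eta>) I"
  unfolding rel_structure_def
proof (intro conjI allI impI)
  show "\<exists>x. x \<epsilon> sc \<eta>" by auto
  show "FunOn (\<lambda>r. r \<epsilon> symbols) I"
  proof (rule FunOnI)
    show "\<exists>x y. p = pr x y" if "p \<epsilon> I" for p using that assms unfolding level_interp_def by blast
    show "r \<epsilon> symbols \<longleftrightarrow> (\<exists>e. pr r e \<epsilon> I)" for r
      unfolding level_interp_mem[OF assms] using ex_level_ext by blast
    show "e = e'" if "pr r e \<epsilon> I" "pr r e' \<epsilon> I" for r e e'
      using that level_ext_unique unfolding level_interp_mem[OF assms] by blast
  qed
next
  fix r e s assume "pr r e \<epsilon> I" "s \<epsilon> e"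
  then obtain u v where "u \<epsilon> sc \<eta>" "v \<epsilon> sc \<eta>" "s = tup u v"
    unfolding level_interp_mem[OF assms] level_ext_def by blast
  then show "Func s (nn 2) (sc \<eta>)" by (simp only: Func_tup)
qed

text \<open>Three unions lead from a structure back to its level, so by separation a set of all
  these structures would yield a set of all levels.\<close>

lemma level_structures_proper: "\<not> (\<exists>s. \<forall>X. X \<epsilon> s \<longleftrightarrow> level_structure X)"
proof
  assume "\<exists>s. \<forall>X. X \<epsilon> s \<longleftrightarrow> level_structure X"
  then obtain s where s: "\<And>X. X \<epsilon> s \<longleftrightarrow> level_structure X" by blast
  define h where "h = Collect_in (un (un (un s))) Level"
  have "Dfn (\<lambda>e. Level (e 0))" by (intro Dfn_Level Dfn_intros)
  then have h: "\<eta> \<epsilon> h \<longleftrightarrow> \<eta> \<epsilon> un (un (un s)) \<and> Level \<eta>" for \<eta> unfolding h_def by (rule mem_Collect_in)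
  have "\<eta> \<epsilon> un (un (un s))" if \<eta>: "Level \<eta>" for \<eta>
  proof -
    obtain I where "level_interp \<eta> I" using ex_level_interp by blast
    then have "pr (sc \<eta>) (pr I emp) \<epsilon> s" using s \<eta> unfolding level_structure_def by blast
    moreover have "upr (sc \<eta>) (sc \<eta>) \<epsilon> pr (sc \<eta>) (pr I emp)" by (simp add: pr_def[of "sc \<eta>"])
    moreover have "sc \<eta> \<epsilon> upr (sc \<eta>) (sc \<eta>)" "\<eta> \<epsilon> sc \<eta>" by simp_all
    ultimately show ?thesis unfolding mem_un by blast
  qed
  then have "\<forall>\<eta>. \<eta> \<epsilon> h \<longleftrightarrow> Level \<eta>" using h by blast
  then show False using Levels_proper by blast
qed

lemma level_embedding:
  obtains \<eta> \<eta>' j where "Level \<eta>" "Level \<eta>'" "\<eta> \<noteq> \<eta>'" "Func j (sc \<eta>) (sc \<eta>')"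
    "\<forall>i y u v. i \<epsilon> nn 7 \<and> y \<epsilon> sc b \<and> u \<epsilon> sc \<eta> \<and> v \<epsilon> sc \<eta> \<longrightarrow>
      (level_rel \<eta> i y u v \<longleftrightarrow> level_rel \<eta>' i y (ap j u) (ap j v))"
proof -
  have str: "\<exists>A I. X = pr A (pr I emp) \<and> rel_structure symbols A I" if "level_structure X" for X
    using that level_structure_rel unfolding level_structure_def by blast
  obtain A I B J j where *: "level_structure (pr A (pr I emp))" "level_structure (pr B (pr J emp))"
    "pr A (pr I emp) \<noteq> pr B (pr J emp)" "Func j A B"
    "\<forall>r e e' x y x' y'. pr r e \<epsilon> I \<and> pr r e' \<epsilon> J \<and> pr x x' \<epsilon> j \<and> pr y y' \<epsilon> j \<longrightarrow>
      (tup x y \<epsilon> e \<longleftrightarrow> tup x' y' \<epsilon> e')"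
    by (rule vopenka_rel[OF Dfn_level_structure str level_structures_proper])
  obtain \<eta> where \<eta>: "Level \<eta>" "level_interp \<eta> I" "A = sc \<eta>" using *(1) unfolding level_structure_def by auto
  obtain \<eta>' where \<eta>': "Level \<eta>'" "level_interp \<eta>' J" "B = sc \<eta>'" using *(2) unfolding level_structure_def by auto
  have "I = J" if "\<eta> = \<eta>'"
    using \<eta>(2) \<eta>'(2) that unfolding level_interp_def by (intro extensional) simp
  then have "\<eta> \<noteq> \<eta>'" using *(3) \<eta>(3) \<eta>'(3) by auto
  moreover have j: "Func j (sc \<eta>) (sc \<eta>')" using *(4) \<eta>(3) \<eta>'(3) by simp
  moreover have "level_rel \<eta> i y u v \<longleftrightarrow> level_rel \<eta>' i y (ap j u) (ap j v)"
    if "i \<epsilon> nn 7" "y \<epsilon> sc b" and uv: "u \<epsilon> sc \<eta>" "v \<epsilon> sc \<eta>" for i y u v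
  proof -
    have r: "pr i y \<epsilon> symbols" unfolding symbols_def mem_prod using that by blast
    obtain e e' where e: "level_ext \<eta> (pr i y) e" "level_ext \<eta>' (pr i y) e'" using ex_level_ext[OF r] by metis
    then have "pr (pr i y) e \<epsilon> I" "pr (pr i y) e' \<epsilon> J"
      using r level_interp_mem[OF \<eta>(2)] level_interp_mem[OF \<eta>'(2)] by blast+
    moreover have "pr u (ap j u) \<epsilon> j" "pr v (ap j v) \<epsilon> j"
      using pr_mem_iff[OF j uv(1)] pr_mem_iff[OF j uv(2)] by blast+
    ultimately have "tup u v \<epsilon> e \<longleftrightarrow> tup (ap j u) (ap j v) \<epsilon> e'" using *(5) by blast
    then show ?thesis
      using level_ext_tup[OF e(1)] level_ext_tup[OF e(2)] uv ap_in[OF j uv(1)] ap_in[OF j uv(2)] by blast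
  qed
  ultimately show ?thesis using that \<eta>(1) \<eta>'(1) by blast
qed

lemma extendible_level:
  assumes omega: "\<exists>w. Om w \<and> w \<epsilon> b"
  shows "\<exists>K. Extd K \<and> b \<epsilon> K"
proof -
  obtain \<eta> \<eta>' j where \<eta>: "Level \<eta>" "Level \<eta>'" "\<eta> \<noteq> \<eta>'" and j: "Func j (sc \<eta>) (sc \<eta>')"
    and rel: "\<forall>i y u v. i \<epsilon> nn 7 \<and> y \<epsilon> sc b \<and> u \<epsilon> sc \<eta> \<and> v \<epsilon> sc \<eta> \<longrightarrow>
      (level_rel \<eta> i y u v \<longleftrightarrow> level_rel \<eta>' i y (ap j u) (ap j v))"
    by (rule level_embedding)
  let ?j = "ap j"
  have nn7: "nn i \<epsilon> nn 7 \<longleftrightarrow> i < 7" for i by (auto simp: nn_mem_iff)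
  have rel': "level_rel \<eta> (nn i) y u v \<longleftrightarrow> level_rel \<eta>' (nn i) y (?j u) (?j v)"
    if "i < 7" "y \<epsilon> sc b" "u \<epsilon> sc \<eta>" "v \<epsilon> sc \<eta>" for i y u v
    using rel that nn7 by blast
  have bb: "b \<epsilon> sc b" by simp
  have j_fix: "u = y \<longleftrightarrow> ?j u = y" if "y \<epsilon> sc b" "u \<epsilon> sc \<eta>" for u y
    using rel'[of 0 y u u] that by (simp add: level_rel_simps)
  have j_mem: "u \<epsilon> v \<longleftrightarrow> ?j u \<epsilon> ?j v" if "u \<epsilon> sc \<eta>" "v \<epsilon> sc \<eta>" for u v
    using rel'[of 1 b u v, OF _ bb that] unfolding level_rel_simps by simp
  have j_sub: "sub u v \<and> Level v \<longleftrightarrow> sub (?j u) (?j v) \<and> Level (?j v)" if "u \<epsilon> sc \<eta>" "v \<epsilon> sc \<eta>" for u v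
    using rel'[of 2 b u v, OF _ bb that] unfolding level_rel_simps by simp
  have j_sat: "(\<exists>n p a X. v = pr n (pr p a) \<and> EpsStr u X \<and> Sat X n p a) \<longleftrightarrow>
      (\<exists>n p a X. ?j v = pr n (pr p a) \<and> EpsStr (?j u) X \<and> Sat X n p a)" if "u \<epsilon> sc \<eta>" "v \<epsilon> sc \<eta>" for u v
    using rel'[of 3 b u v, OF _ bb that] unfolding level_rel_simps by simp
  have j_Model: "Model u \<longleftrightarrow> Model (?j u)" if "u \<epsilon> sc \<eta>" for u
    using rel'[of 4 b u u, OF _ bb that that] unfolding level_rel_simps by simp
  have j_top: "u = \<eta> \<longleftrightarrow> ?j u = \<eta>'" if "u \<epsilon> sc \<eta>" for u
    using rel'[of 5 b u u, OF _ bb that that] unfolding level_rel_simps by simp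
  have j_succ: "successor u v \<longleftrightarrow> successor (?j u) (?j v)" if "u \<epsilon> sc \<eta>" "v \<epsilon> sc \<eta>" for u v
    using rel'[of 6 b u v, OF _ bb that] unfolding level_rel_simps by simp
  have j_iff: "pr x y \<epsilon> j \<longleftrightarrow> y = ?j x" if "x \<epsilon> sc \<eta>" for x y
    using j that by (rule pr_mem_iff)
  have dom_trans: "x \<epsilon> sc \<eta>" if "x \<epsilon> y" "y \<epsilon> sc \<eta>" for x y
    using that trans_setD[OF Level_trans[OF \<eta>(1)]] unfolding mem_sc by blast

  \<comment> \<open>Being moved is expressed by a missing pair in \<open>j\<close>, a form covered
    by \<open>Dfn_intros\<close>, instead of by \<open>ap\<close>. The level \<eta> is moved,
    because \<open>j_top\<close> sends it to the different level \<open>\<eta>'\<close>.\<close>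
  have "Dfn (\<lambda>e. e 0 \<epsilon> sc \<eta> \<and> \<not> pr (e 0) (e 0) \<epsilon> j)" by (intro Dfn_intros)
  moreover have "\<eta> \<epsilon> sc \<eta> \<and> \<not> pr \<eta> \<eta> \<epsilon> j"
    using j_iff[of \<eta> \<eta>] j_top[of \<eta>] \<eta>(3) by auto
  ultimately obtain K where K: "Level K" "K \<epsilon> sc \<eta> \<and> \<not> pr K K \<epsilon> j"
    "\<And>r. Level r \<Longrightarrow> r \<epsilon> K \<Longrightarrow> \<not> (r \<epsilon> sc \<eta> \<and> \<not> pr r r \<epsilon> j)"
    using Level_least[of "\<lambda>r. r \<epsilon> sc \<eta> \<and> \<not> pr r r \<epsilon> j" \<eta>] \<eta>(1) by blast
  define N where "N = ?j K"
  have K_dom: "K \<epsilon> sc \<eta>" using K(2) by blast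
  have dom: "x \<epsilon> sc \<eta>" if "x \<epsilon> K" for x using dom_trans[OF that K_dom] .
  have "N \<noteq> K" using K(2) j_iff[OF K_dom, of K] unfolding N_def by metis
  have fix_level: "?j r = r" if "Level r" "r \<epsilon> K" for r
    using K(3)[OF that] j_iff[OF dom[OF that(2)], of r] dom[OF that(2)] by metis
  \<comment> \<open>At the pair of \<open>K\<close> with itself the inclusion is trivial, so
    relation 2 expresses that \<open>K\<close> is a level.\<close>
  have "Level N" using j_sub[OF K_dom K_dom] K(1) sub_refl[of K] unfolding N_def by simp

  have fix_base: "?j y = y" if "y \<epsilon> sc b" "y \<epsilon> sc \<eta>" for y
    using j_fix[OF that] by simp
  \<comment> \<open>The choice of \<open>K\<close> concerns levels only; this extends fixedness to
    sets. Let \<open>t\<close> be a least level in \<open>K\<close> with a moved subset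
    \<open>y\<close>. The elements of \<open>t\<close> are in \<open>b\<close> or are subsets of
    earlier levels, hence fixed. By relation 2, \<open>?j y\<close> is a subset of
    \<open>?j t = t\<close>, so it has the same elements as \<open>y\<close>.\<close>
  have fix_sub: "\<not> (r \<epsilon> K \<and> (\<exists>y. y \<epsilon> sc \<eta> \<and> sub y r \<and> \<not> pr y y \<epsilon> j))" if rL: "Level r" for r
  proof
    assume r: "r \<epsilon> K \<and> (\<exists>y. y \<epsilon> sc \<eta> \<and> sub y r \<and> \<not> pr y y \<epsilon> j)"
    have "Dfn (\<lambda>e. e 0 \<epsilon> K \<and> (\<exists>y. y \<epsilon> sc \<eta> \<and> sub y (e 0) \<and> \<not> pr y y \<epsilon> j))" by (intro Dfn_intros)
    then obtain t where t: "Level t" "t \<epsilon> K \<and> (\<exists>y. y \<epsilon> sc \<eta> \<and> sub y t \<and> \<not> pr y y \<epsilon> j)"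
      "\<And>s. Level s \<Longrightarrow> s \<epsilon> t \<Longrightarrow> \<not> (s \<epsilon> K \<and> (\<exists>y. y \<epsilon> sc \<eta> \<and> sub y s \<and> \<not> pr y y \<epsilon> j))"
      using Level_least[of "\<lambda>r. r \<epsilon> K \<and> (\<exists>y. y \<epsilon> sc \<eta> \<and> sub y r \<and> \<not> pr y y \<epsilon> j)" r] rL r by blast
    from t(2) have tK: "t \<epsilon> K" by blast
    from t(2) obtain y where y: "y \<epsilon> sc \<eta>" "sub y t" "\<not> pr y y \<epsilon> j" by blast
    have below: "?j z = z" if z: "z \<epsilon> t" for z
    proof (cases "z \<epsilon> b")
      case True
      then show ?thesis using fix_base[of z] dom_trans[OF z dom[OF tK]] by simp
    next
      case False
      then obtain s where s: "Level s" "s \<epsilon> t" "sub z s" using Level_mem[OF t(1), of z] z by blast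
      have "s \<epsilon> K" using trans_setD[OF Level_trans[OF K(1)] s(2) tK] .
      moreover have z': "z \<epsilon> sc \<eta>" using dom_trans[OF z dom[OF tK]] .
      ultimately have "pr z z \<epsilon> j" using t(3)[OF s(1,2)] s(3) by blast
      then show ?thesis using j_iff[OF z'] by simp
    qed
    have t_fix: "?j t = t" using fix_level[OF t(1) tK] .
    have "sub (?j y) t" using j_sub[OF y(1) dom[OF tK]] y(2) t(1) t_fix by simp
    have "?j y = y"
    proof (rule extensional)
      fix z
      have *: "z \<epsilon> y \<longleftrightarrow> z \<epsilon> ?j y" if "z \<epsilon> t"
        using j_mem[OF dom_trans[OF that dom[OF tK]] y(1)] below[OF that] by simp
      show "z \<epsilon> ?j y \<longleftrightarrow> z \<epsilon> y"
        using * subD[OF y(2), of z] subD[OF \<open>sub (?j y) t\<close>, of z] by blast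
    qed
    then show False using y(3) j_iff[OF y(1)] by simp
  qed
  have fix_K: "?j y = y" if y: "y \<epsilon> K" for y
  proof (cases "y \<epsilon> b")
    case True
    then show ?thesis using fix_base[of y] dom[OF y] by simp
  next
    case False
    then obtain r where "Level r" "r \<epsilon> K" "sub y r" using Level_mem[OF K(1), of y] y by blast
    then have "pr y y \<epsilon> j" using fix_sub dom[OF y] by blast
    then show ?thesis using j_iff[OF dom[OF y]] by simp
  qed

  \<comment> \<open>The embedding is not known to move levels upwards, as \<open>\<eta>'\<close> may
    lie below \<eta>. But if \<open>N\<close> were in \<open>K\<close>, it would be fixed, and
    applying \<open>j\<close> to this membership would put \<open>N\<close> into itself.\<close>
  have "\<not> N \<epsilon> K"
  proof
    assume NK: "N \<epsilon> K"
    then have "?j N \<epsilon> ?j K" using j_mem[OF dom[OF NK] K_dom] by blast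
    then have "N \<epsilon> N" using fix_K[OF NK] N_def by simp
    then show False using mem_irrefl by blast
  qed
  then have KN: "K \<epsilon> N" using Level_linear[OF K(1) \<open>Level N\<close>] \<open>N \<noteq> K\<close> by blast
  have "b \<noteq> K" using fix_base[OF bb] K_dom \<open>N \<noteq> K\<close> unfolding N_def by metis
  then have bK: "b \<epsilon> K" using Level_linear[OF K(1) Level_base_set] Level_not_in_base[OF K(1)] by blast
  have limit: "\<exists>t. Level t \<and> successor r t \<and> t \<epsilon> K" if r: "Level r" "r \<epsilon> K" for r
  proof -
    obtain t where t: "Level t" "successor r t" using Level_successor[OF r(1)] by blast
    \<comment> \<open>If \<open>K\<close> were the successor of the fixed level \<open>r\<close>,
      then by relation 6 so would be \<open>N\<close>, and the two would coincide.\<close>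
    have "t \<noteq> K"
    proof
      assume "t = K"
      then have "successor r N"
        using j_succ[OF dom[OF r(2)] K_dom] t(2) fix_level[OF r] unfolding N_def by simp
      then have "N = K" using t(2) \<open>t = K\<close> unfolding successor_def by (intro extensional) blast
      then show False using \<open>N \<noteq> K\<close> by blast
    qed
    moreover have "\<not> K \<epsilon> t"
    proof
      assume "K \<epsilon> t"
      then have "sub K r" using t(2) Level_not_in_base[OF K(1)] unfolding successor_def by blast
      then have "r \<epsilon> r" using r(2) subD by blast
      then show False using mem_irrefl by blast
    qed
    ultimately show ?thesis using Level_linear[OF t(1) K(1)] t by blast
  qed
  interpret limit_level E b K
    using K(1) bK limit omega by unfold_locales
  have ne: "\<exists>x. x \<epsilon> K" "\<exists>x. x \<epsilon> N" using bK KN by blast+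
  interpret elementary_level E b K N
  proof unfold_locales
    fix n p a assume n: "Nat n" and p: "Form epsL n p" and a: "Func a n K"
    \<comment> \<open>This triple is fixed by \<open>j\<close>, so relation 3 compares the same
      formula under the same assignment in \<open>K\<close> and in its image
      \<open>N\<close>.\<close>
    have "pr n (pr p a) \<epsilon> K" using K_pr K_Nat[OF n] K_Form[OF n p] K_Func[OF n a] by blast
    from j_sat[OF K_dom dom[OF this]] fix_K[OF this] show "Tr K n p a \<longleftrightarrow> Tr N n p a"
      using ne unfolding N_def[symmetric] EpsStr_iff by simp
  qed (fact \<open>Level N\<close> KN)+
  have "Model N" using K_Model j_Model[OF K_dom] unfolding N_def by blast
  then show ?thesis using K_Model K_ElSub KN bK unfolding Extd_def by blast
qed

end

context lzfc_vp
begin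

lemma ex_extendible: "\<exists>K. Extd K \<and> x \<epsilon> K"
proof -
  obtain w where w: "Om w" using ex_omega by blast
  \<comment> \<open>By transitivity, a model that contains the unordered pair contains both
    \<open>x\<close> and \<omega>.\<close>
  obtain b where b: "Model b" "upr x w \<epsilon> b" using ex_model by blast
  have "trans_set b" by (rule Model_trans[OF b(1)])
  then interpret hierarchy E b by unfold_locales
  have "x \<epsilon> b" "w \<epsilon> b" using base_transD[OF _ b(2)] by simp_all
  then obtain K where K: "Extd K" "b \<epsilon> K" using extendible_level w by blast
  then have "trans_set K" unfolding Extd_def using Model_trans by blast
  then show ?thesis using K \<open>x \<epsilon> b\<close> trans_setD by blast
qed

end


section \<open>The theorem\<close>

text \<open>If the sentence is provable, then no such saturated set exists and the choice is arbitrary. The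
  definition is unconditional so that the domain of the countermodel can be a type.\<close>

definition counter_theory :: "fm set" where
  "counter_theory = (SOME H. saturated H \<and>
     rename (\<lambda>i. 2 * i) ` insert (Imp Loc_ext_ZFC Bot) (LZFC \<union> VP) \<subseteq> H)"

definition eq_class :: "nat \<Rightarrow> nat set" where
  "eq_class i = {j. Eq i j \<in> counter_theory}"

typedef universe = "range eq_class"
  by blast

text \<open>The elements are the classes of variables under provable equality. Since the theory was
  doubled, its formulas are read under the environment of the even variables.\<close>

lemma countermodel:
  assumes "\<not> LZFC \<union> VP \<turnstile> Loc_ext_ZFC"
  obtains E :: "universe \<Rightarrow> universe \<Rightarrow> bool" and e
  where "\<And>p. p \<in> LZFC \<union> VP \<Longrightarrow> holds E UNIV e p" "\<not> holds E UNIV e Loc_ext_ZFC"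
proof -
  let ?\<Gamma> = "rename (\<lambda>i. 2 * i) ` insert (Imp Loc_ext_ZFC Bot) (LZFC \<union> VP)"
  obtain H where "saturated H" "?\<Gamma> \<subseteq> H"
    using saturated_extension[OF infinite_fresh_double consistent_double[OF assms]] by blast
  then have H: "saturated counter_theory" "?\<Gamma> \<subseteq> counter_theory"
    unfolding counter_theory_def using someI_ex[of "\<lambda>H. saturated H \<and> ?\<Gamma> \<subseteq> H"] by blast+
  define c where "c i = Abs_universe (eq_class i)" for i
  have "c i = c j \<longleftrightarrow> eq_class i = eq_class j" for i j
    unfolding c_def by (simp add: Abs_universe_inject)
  moreover have "eq_class i = eq_class j \<longleftrightarrow> Eq i j \<in> counter_theory" for i j
    using saturated_Eq_refl[OF H(1)] saturated_Eq_sym[OF H(1)] saturated_Eq_trans[OF H(1)]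
    unfolding eq_class_def by blast
  ultimately have c: "c i = c j \<longleftrightarrow> Eq i j \<in> counter_theory" for i j by blast
  have "surj c"
    unfolding surj_def c_def by (metis Rep_universe Rep_universe_inverse imageE)
  note sat = saturated_holds[OF H(1) c this, of "\<lambda>i. 2 * i"]
  show ?thesis
  proof (rule that)
    show "holds (\<lambda>x y. \<exists>i j. x = c i \<and> y = c j \<and> Mem i j \<in> counter_theory) UNIV (\<lambda>i. c (2 * i)) p"
      if "p \<in> LZFC \<union> VP" for p
      unfolding sat using H(2) that by blast
    have "holds (\<lambda>x y. \<exists>i j. x = c i \<and> y = c j \<and> Mem i j \<in> counter_theory) UNIV (\<lambda>i. c (2 * i))
        (Imp Loc_ext_ZFC Bot)"
      unfolding sat using H(2) by blast
    then show "\<not> holds (\<lambda>x y. \<exists>i j. x = c i \<and> y = c j \<and> Mem i j \<in> counter_theory) UNIV (\<lambda>i. c (2 * i))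
        Loc_ext_ZFC"
      by simp
  qed
qed

lemma lzfc_vp_holds:
  assumes "\<And>p. p \<in> LZFC \<union> VP \<Longrightarrow> holds E UNIV e p"
  shows "lzfc_vp E"
proof -
  have BST: "holds E UNIV e p" if "p \<in> BST" for p using assms that by (simp add: LZFC_def)
  have "set_universe E"
  proof
    have "holds E UNIV e extensionality" by (rule BST) (simp add: BST_def)
    then show "x = y" if "\<And>z. E z x \<longleftrightarrow> E z y" for x y
      using that unfolding extensionality_def holds_frag by simp
    have "holds E UNIV e empty_set" by (rule BST) (simp add: BST_def)
    then show "\<exists>x. \<forall>z. \<not> E z x" unfolding empty_set_def is_empty_def holds_frag by simp
    have "holds E UNIV e pairing" by (rule BST) (simp add: BST_def)
    then show "\<exists>w. \<forall>z. E z w \<longleftrightarrow> z = x \<or> z = y" for x y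
      unfolding pairing_def is_upair_def holds_frag by simp
    have "holds E UNIV e Defs.union" by (rule BST) (simp add: BST_def)
    then show "\<exists>w. \<forall>z. E z w \<longleftrightarrow> (\<exists>y. E y x \<and> E z y)" for x
      unfolding union_def holds_frag by simp
  qed
  then interpret set_universe E .
  show ?thesis
  proof
    have "holds E UNIV e cartesian_product" by (rule BST) (simp add: BST_def)
    then show "\<exists>c. \<forall>z. E z c \<longleftrightarrow> (\<exists>x y. E x a \<and> E y b \<and> z = pr x y)" for a b
      unfolding cartesian_product_def holds_frag by simp
    have "holds E UNIV e omega_exists" by (rule BST) (simp add: BST_def)
    then show "\<exists>w. Om w" unfolding omega_exists_def holds_frag by simp
    have "holds E UNIV e Loc_ZFC" by (rule assms) (simp add: LZFC_def)
    then show "\<exists>M. Model M \<and> E x M" for x unfolding Loc_ZFC_def holds_frag by simp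
    show "\<exists>b. \<forall>x. E x b \<longleftrightarrow> E x a \<and> holds E UNIV (case_nat x v) p" if "delta0 p" for p a v
    proof -
      \<comment> \<open>The scheme is indexed by the number \<open>n\<close> of parameters bound in
        front. Any \<open>n\<close> that bounds the free variables of \<open>p\<close> will
        do.\<close>
      obtain n where n: "closed_at (Suc n) p" using ex_closed_at by blast
      have "holds E UNIV e (separation n p)" by (rule BST) (use that n in \<open>auto simp: BST_def\<close>)
      then have "ev e (\<^bold>\<forall>a. \<^bold>\<exists>b. \<^bold>\<forall>x. x \<^bold>\<in> b \<^bold>\<longleftrightarrow> (x \<^bold>\<in> a \<^bold>\<and> inst p x)) n v"
        unfolding separation_def holds_closure by blast
      then have "\<forall>a. \<exists>b. \<forall>x. E x b \<longleftrightarrow> E x a \<and> holds E UNIV (case_nat x (v(n := a, Suc n := b, Suc (Suc n) := x))) p"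
        by (simp add: tr_inst[OF n])
      \<comment> \<open>The quantifiers of the axiom bind the levels from \<open>n\<close> on, while
        the parameters of \<open>p\<close> occupy the levels below \<open>n\<close>.\<close>
      moreover have "holds E UNIV (case_nat x (v(n := a, Suc n := b, Suc (Suc n) := x))) p \<longleftrightarrow>
          holds E UNIV (case_nat x v) p" for a b x
        by (rule holds_cong[OF n]) (auto split: nat.split)
      ultimately show ?thesis by simp
    qed
    show "\<exists>x y j. P x \<and> P y \<and> x \<noteq> y \<and> Elem L x y j"
      if P: "Dfn (\<lambda>e. P (e 0))" and proper_class: "Lang L" "\<And>x. P x \<Longrightarrow> Struct L x" "\<not> (\<exists>s. \<forall>x. E x s \<longleftrightarrow> P x)" for P L
    proof -
      obtain n p v where n: "closed_at (Suc n) p" and p: "\<And>x. P x \<longleftrightarrow> holds E UNIV (case_nat x v) p"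
        by (rule Dfn_formula[OF P], rule that) simp_all
      have "holds E UNIV e (vopenka n p)" by (rule assms) (use n in \<open>auto simp: VP_def\<close>)
      then have "ev e (\<^bold>\<forall>L. is_language L \<^bold>\<and> (\<^bold>\<forall>x. inst p x \<^bold>\<longrightarrow> is_structure L x) \<^bold>\<and>
          \<^bold>\<not> (\<^bold>\<exists>s. \<^bold>\<forall>x. x \<^bold>\<in> s \<^bold>\<longleftrightarrow> inst p x) \<^bold>\<longrightarrow>
          (\<^bold>\<exists>x y j. inst p x \<^bold>\<and> inst p y \<^bold>\<and> \<^bold>\<not> x \<^bold>= y \<^bold>\<and> elementary_embedding L x y j)) n v"
        unfolding vopenka_def holds_closure by blast
      moreover have "holds E UNIV (case_nat x w) p \<longleftrightarrow> P x" if "\<And>i. i < n \<Longrightarrow> w i = v i" for w x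
        unfolding p using that by (intro holds_cong[OF n]) (auto split: nat.split)
      ultimately have "Lang L \<and> (\<forall>x. P x \<longrightarrow> Struct L x) \<and> \<not> (\<exists>s. \<forall>x. E x s \<longleftrightarrow> P x) \<longrightarrow>
          (\<exists>x y j. P x \<and> P y \<and> x \<noteq> y \<and> Elem L x y j)"
        by (simp add: tr_inst[OF n])
      then show ?thesis using proper_class by blast
    qed
  qed
qed

theorem proposition6p19:
  shows "LZFC \<union> VP \<turnstile> Loc_ext_ZFC"
proof (rule ccontr)
  assume "\<not> LZFC \<union> VP \<turnstile> Loc_ext_ZFC"
  then obtain E :: "universe \<Rightarrow> universe \<Rightarrow> bool" and e
    where E: "\<And>p. p \<in> LZFC \<union> VP \<Longrightarrow> holds E UNIV e p" "\<not> holds E UNIV e Loc_ext_ZFC"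
    by (rule countermodel) blast
  interpret lzfc_vp E by (rule lzfc_vp_holds[OF E(1)])
  have "holds E UNIV e Loc_ext_ZFC"
    unfolding Loc_ext_ZFC_def holds_frag using ex_extendible by simp
  then show False using E(2) by blast
qed

end
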